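(* Let $k\ge3$. For generic parameters $(\alpha,\beta)\in\mathbb{C}^{k+1}\times\mathbb{C}^{k+1}$, the dynamical degrees of the map $f=f_{\alpha,\beta}$ and of its inverse satisfy: (i) $\delta(f)=\Delta_k^+$ is the largest root of $x^k-(x^k-1)/(x-1)$; (ii) $\delta(f^{-1})=\Delta_k^-$ is the largest root of $x^k-x^{k-1}+(-1)^{k-1}$. Furthermore $\lim_{k\to\infty}\Delta_k^+=2$ and $\lim_{k\to\infty}\Delta_k^-=1$.
   Context: For $\alpha=(\alpha_0,\dots,\alpha_k)$, $\beta=(\beta_0,\dots,\beta_k)$, $f_{\alpha,\beta}$ is the rational self-map of $\mathbf{P}^k$ over $\mathbb{C}$ given in the affine chart by $$f_{\alpha,\beta}(x_1,\dots,x_k)=\Big(x_2,\dots,x_k,\frac{\alpha_0+\alpha_1x_1+\cdots+\alpha_kx_k}{\beta_0+\beta_1x_1+\cdots+\beta_kx_k}\Big);$$ it is birational for generic parameters. For a birational map $g$ of $\mathbf{P}^k$, the (first) dynamical degree is $\delta(g)=\lim_{n\to\infty}(\deg g^n)^{1/n}$, where $\deg$ is the common degree of the homogeneous polynomials without common factor defining the map. "Generic" means: for all $(\alpha,\beta)$ outside a countable union of proper algebraic subvarieties of $\mathbb{C}^{2k+2}$. Here $(x^k-1)/(x-1)$ denotes the polynomial $1+x+\cdots+x^{k-1}$.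
   Formalization: In (ii) the polynomial is taken as x^k-x^{k-1}-1 for every k; the printed constant (-1)^{k-1} agrees for even k, but for odd k it gives x^k-x^{k-1}+1, which has no root in [0,∞), whereas a dynamical degree is at least 1. "Largest root" means largest real root. *)

theory Defs
  imports
    "HOL-Analysis.Analysis"
    "HOL-Library.Poly_Mapping"
    "HOL-Computational_Algebra.Polynomial"
begin

section \<open>Polynomials in several variables\<close>

text \<open>
  A monomial is a finitely supported exponent map, and a polynomial is a finitely supported
  map from monomials to coefficients; the ring structure (convolution product) is the one of
  \<^theory>\<open>HOL-Library.Poly_Mapping\<close>. The variables are indexed by the natural numbers.
\<close>

type_synonym mpol = "(nat \<Rightarrow>\<^sub>0 nat) \<Rightarrow>\<^sub>0 complex"

definition mconst :: "complex \<Rightarrow> mpol" where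
  "mconst c = Poly_Mapping.single 0 c"

definition mvar :: "nat \<Rightarrow> mpol" where
  "mvar i = Poly_Mapping.single (Poly_Mapping.single i 1) 1"

definition mvars :: "mpol \<Rightarrow> nat set" where
  "mvars p = (\<Union>m\<in>Poly_Mapping.keys p. Poly_Mapping.keys m)"

definition homogeneous :: "nat \<Rightarrow> mpol \<Rightarrow> bool" where
  "homogeneous d p \<longleftrightarrow>
     (\<forall>m\<in>Poly_Mapping.keys p. (\<Sum>i\<in>Poly_Mapping.keys m. Poly_Mapping.lookup m i) = d)"

definition meval :: "(nat \<Rightarrow> complex) \<Rightarrow> mpol \<Rightarrow> complex" where
  "meval x p = (\<Sum>m\<in>Poly_Mapping.keys p.
     Poly_Mapping.lookup p m * (\<Prod>i\<in>Poly_Mapping.keys m. x i ^ Poly_Mapping.lookup m i))"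

definition msubst :: "(nat \<Rightarrow> mpol) \<Rightarrow> mpol \<Rightarrow> mpol" where
  "msubst G p = (\<Sum>m\<in>Poly_Mapping.keys p.
     mconst (Poly_Mapping.lookup p m) * (\<Prod>i\<in>Poly_Mapping.keys m. G i ^ Poly_Mapping.lookup m i))"


section \<open>Rational self-maps of projective space\<close>

text \<open>
  A rational self-map of \<open>P\<^sup>k\<close> is represented by homogeneous coordinates \<open>[F 0 : \<dots> : F k]\<close>,
  polynomials in the variables \<open>0, \<dots>, k\<close> that are homogeneous of one common degree and not
  all zero. Common factors are allowed, so a map has many representatives. The values \<open>F i\<close>
  for \<open>i > k\<close> are irrelevant.
\<close>

definition rational_map :: "nat \<Rightarrow> (nat \<Rightarrow> mpol) \<Rightarrow> bool" where
  "rational_map k F \<longleftrightarrow>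
     (\<exists>d. \<forall>i\<le>k. mvars (F i) \<subseteq> {..k} \<and> homogeneous d (F i)) \<and> (\<exists>i\<le>k. F i \<noteq> 0)"

definition same_rational_map :: "nat \<Rightarrow> (nat \<Rightarrow> mpol) \<Rightarrow> (nat \<Rightarrow> mpol) \<Rightarrow> bool" where
  "same_rational_map k F G \<longleftrightarrow> rational_map k F \<and> rational_map k G \<and>
     (\<forall>i\<le>k. \<forall>j\<le>k. F i * G j = F j * G i)"

definition no_common_factor :: "nat \<Rightarrow> (nat \<Rightarrow> mpol) \<Rightarrow> bool" where
  "no_common_factor k F \<longleftrightarrow> (\<forall>h. (\<forall>i\<le>k. h dvd F i) \<longrightarrow> h dvd 1)"

definition map_degree :: "nat \<Rightarrow> (nat \<Rightarrow> mpol) \<Rightarrow> nat" where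
  "map_degree k F = (THE d. \<exists>G. same_rational_map k F G \<and> no_common_factor k G \<and>
     (\<forall>i\<le>k. homogeneous d (G i)))"

text \<open>
  If the image of \<open>G\<close> lies in the indeterminacy locus of \<open>F\<close>, all coordinates of the
  composite vanish and it is not a \<^const>\<open>rational_map\<close>; this does not happen for birational
  maps.
\<close>

definition map_comp :: "(nat \<Rightarrow> mpol) \<Rightarrow> (nat \<Rightarrow> mpol) \<Rightarrow> (nat \<Rightarrow> mpol)" where
  "map_comp F G = (\<lambda>i. msubst G (F i))"

fun map_iterate :: "(nat \<Rightarrow> mpol) \<Rightarrow> nat \<Rightarrow> (nat \<Rightarrow> mpol)" where
  "map_iterate F 0 = mvar"
| "map_iterate F (Suc n) = map_comp F (map_iterate F n)"

definition inverse_map :: "nat \<Rightarrow> (nat \<Rightarrow> mpol) \<Rightarrow> (nat \<Rightarrow> mpol) \<Rightarrow> bool" where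
  "inverse_map k F G \<longleftrightarrow> rational_map k F \<and> rational_map k G \<and>
     same_rational_map k (map_comp F G) mvar \<and> same_rational_map k (map_comp G F) mvar"

definition birational_map :: "nat \<Rightarrow> (nat \<Rightarrow> mpol) \<Rightarrow> bool" where
  "birational_map k F \<longleftrightarrow> (\<exists>G. inverse_map k F G)"

definition has_dynamical_degree :: "nat \<Rightarrow> (nat \<Rightarrow> mpol) \<Rightarrow> real \<Rightarrow> bool" where
  "has_dynamical_degree k F \<delta> \<longleftrightarrow>
     (\<lambda>n. root n (real (map_degree k (map_iterate F n)))) \<longlonglongrightarrow> \<delta>"


section \<open>Linear fractional recurrences\<close>

definition linear_form :: "nat \<Rightarrow> (nat \<Rightarrow> complex) \<Rightarrow> mpol" where
  "linear_form k \<gamma> = (\<Sum>i\<le>k. mconst (\<gamma> i) * mvar i)"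

text \<open>
  In the affine chart \<open>x\<^sub>0 = 1\<close>, with \<open>a(x) = \<alpha>\<^sub>0 x\<^sub>0 + \<dots> + \<alpha>\<^sub>k x\<^sub>k\<close> and
  \<open>b(x) = \<beta>\<^sub>0 x\<^sub>0 + \<dots> + \<beta>\<^sub>k x\<^sub>k\<close>, the map is
  \<open>(x\<^sub>1, \<dots>, x\<^sub>k) \<mapsto> (x\<^sub>2, \<dots>, x\<^sub>k, a(x) / b(x))\<close>. Homogenizing \<open>[1 : x\<^sub>2 : \<dots> : x\<^sub>k : a / b]\<close>
  and multiplying by \<open>x\<^sub>0 b(x)\<close> gives
  \<open>[x\<^sub>0 b(x) : x\<^sub>2 b(x) : \<dots> : x\<^sub>k b(x) : x\<^sub>0 a(x)]\<close>.
\<close>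

definition linfrac_map ::
    "nat \<Rightarrow> (nat \<Rightarrow> complex) \<Rightarrow> (nat \<Rightarrow> complex) \<Rightarrow> (nat \<Rightarrow> mpol)" where
  "linfrac_map k \<alpha> \<beta> = (\<lambda>i.
     if i = 0 then mvar 0 * linear_form k \<beta>
     else if i < k then mvar (Suc i) * linear_form k \<beta>
     else mvar 0 * linear_form k \<alpha>)"


section \<open>Generic parameters\<close>

definition affine_space :: "nat \<Rightarrow> (nat \<Rightarrow> complex) set" where
  "affine_space N = {..<N} \<rightarrow>\<^sub>E UNIV"

definition proper_subvariety :: "nat \<Rightarrow> (nat \<Rightarrow> complex) set \<Rightarrow> bool" where
  "proper_subvariety N V \<longleftrightarrow> V \<noteq> affine_space N \<and>
     (\<exists>S. (\<forall>p\<in>S. mvars p \<subseteq> {..<N}) \<and> V = {x \<in> affine_space N. \<forall>p\<in>S. meval x p = 0})"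

text \<open>The point \<open>(\<alpha>\<^sub>0, \<dots>, \<alpha>\<^sub>k, \<beta>\<^sub>0, \<dots>, \<beta>\<^sub>k)\<close> of the affine space of dimension \<open>2k + 2\<close>.\<close>

definition param_point :: "nat \<Rightarrow> (nat \<Rightarrow> complex) \<Rightarrow> (nat \<Rightarrow> complex) \<Rightarrow> (nat \<Rightarrow> complex)" where
  "param_point k \<alpha> \<beta> =
     (\<lambda>i\<in>{..<2 * k + 2}. if i \<le> k then \<alpha> i else \<beta> (i - (k + 1)))"

definition for_generic_params ::
    "nat \<Rightarrow> ((nat \<Rightarrow> complex) \<Rightarrow> (nat \<Rightarrow> complex) \<Rightarrow> bool) \<Rightarrow> bool" where
  "for_generic_params k P \<longleftrightarrow>
     (\<exists>\<V>. countable \<V> \<and> (\<forall>V\<in>\<V>. proper_subvariety (2 * k + 2) V) \<and>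
       (\<forall>\<alpha> \<beta>. param_point k \<alpha> \<beta> \<notin> \<Union>\<V> \<longrightarrow> P \<alpha> \<beta>))"


section \<open>The growth rates\<close>

definition largest_root :: "real poly \<Rightarrow> real" where
  "largest_root p = Max {x. poly p x = 0}"

definition Delta_plus :: "nat \<Rightarrow> real" where
  "Delta_plus k = largest_root (monom 1 k - (\<Sum>i<k. monom 1 i))"

text \<open>
  The source prints the constant term as \<open>(-1)\<^sup>k\<^sup>-\<^sup>1\<close>, which is \<open>-1\<close> for even \<open>k\<close>. This is
  a sign error for odd \<open>k\<close>: there \<open>x\<^sup>k - x\<^sup>k\<^sup>-\<^sup>1 + 1\<close> is positive on \<open>[0, \<infinity>)\<close>, while a
  dynamical degree is at least \<open>1\<close>. The constant term \<open>-1\<close> is used for every \<open>k\<close>.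
\<close>

definition Delta_minus :: "nat \<Rightarrow> real" where
  "Delta_minus k = largest_root (monom 1 k - monom 1 (k - 1) - 1)"

end

theory Submission
  imports
    Defs
    "HOL-Computational_Algebra.Computational_Algebra"
    "HOL-Computational_Algebra.Field_as_Ring"
    "HOL-Real_Asymp.Real_Asymp"
begin

text \<open>
  Iterating the recurrence \<open>x\<^sub>n\<^sub>+\<^sub>k = a(x\<^sub>n, \<dots>) / b(x\<^sub>n, \<dots>)\<close> without ever cancelling, a term is a quotient
  \<open>p / q\<close> whose common denominator is the product of the denominators of the previous \<open>k\<close> terms,
  so the degrees obey \<open>d\<^sub>n\<^sub>+\<^sub>k = d\<^sub>n + \<dots> + d\<^sub>n\<^sub>+\<^sub>k\<^sub>-\<^sub>1\<close>. Backwards, each denominator divides the next one and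
  the degrees obey \<open>d\<^sub>n = d\<^sub>n\<^sub>-\<^sub>1 + d\<^sub>n\<^sub>-\<^sub>k\<close>. This bounds the degrees from above by sequences that grow
  like \<open>\<Delta>\<^sup>n\<close> for the largest roots \<open>\<Delta>\<close> of the two characteristic polynomials.

  That generically nothing cancels is tested on the line \<open>x\<^sub>1 = \<dots> = x\<^sub>k = t\<close>. The absence of a
  relation \<open>u q = v p\<close> with \<open>u\<close>, \<open>v\<close> of small degree is a linear independence condition, hence holds
  off a proper subvariety of the parameter space as soon as it holds for one parameter, which need
  not even define a birational map. For \<open>f\<close> the parameter \<open>a = 1\<close>, \<open>b = 1 + x\<^sub>1 + \<dots> + x\<^sub>k\<close> works because
  the denominators stay pairwise coprime; for the inverse the parameter \<open>a = x\<^sub>1\<close>, \<open>b = x\<^sub>1 + x\<^sub>2\<close>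
  works because the numerators become powers of \<open>t\<close>.

  Comparing the lower bound with the reduced representative of an iterate requires unique
  factorization of polynomials in several variables.
\<close>

section \<open>Evaluation of polynomials\<close>

text \<open>Why a missing relation bounds the degree: let \<open>G\<close> represent an iterate in
  its degree d, and let p / q be one affine coordinate of that iterate. Then
  \<open>G i * q = G 0 * p\<close>, and on the test line \<open>G i\<close> and \<open>G 0\<close>
  become polynomials u, v in t of degree at most d. If u q = v p has no nonzero solution of degree
  below D, then D \<le> d. The obstacle is that the line may lie in the common zero set of
  \<open>G i\<close> and \<open>G 0\<close>, so that u = v = 0; the curve is therefore deformed and
  the lowest order in the deformation parameter compared. Relations are preferred to degrees of
  reduced fractions because they are linear in u and v: their absence is an open condition on the
  parameter, although greatest common divisors jump. Each iterate excludes one hypersurface, whence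
  the countable union; one more condition, a determinant, provides an explicit inverse. On the test
  line the starting denominators have degree 0, whereas their homogeneous versions have degree 1.
  The forward lower bound therefore lags behind the upper one by a fixed number of steps, which n-th
  roots do not see.\<close>

abbreviation kys :: "('a \<Rightarrow>\<^sub>0 'b::zero) \<Rightarrow> 'a set" where "kys \<equiv> Poly_Mapping.keys"
abbreviation lkp :: "('a \<Rightarrow>\<^sub>0 'b::zero) \<Rightarrow> 'a \<Rightarrow> 'b" where "lkp \<equiv> Poly_Mapping.lookup"

text \<open>A predicate, because the same laws are needed for many targets: complex numbers,
  polynomials in several variables, and univariate polynomials over either, also nested.\<close>

definition is_ring_hom :: "('a::comm_ring_1 \<Rightarrow> 'b::comm_ring_1) \<Rightarrow> bool" where
  "is_ring_hom h \<longleftrightarrow> h 1 = 1 \<and> (\<forall>a b. h (a + b) = h a + h b) \<and> (\<forall>a b. h (a * b) = h a * h b)"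

lemma is_ring_homI:
  assumes "h 1 = 1" "\<And>a b. h (a + b) = h a + h b" "\<And>a b. h (a * b) = h a * h b"
  shows "is_ring_hom h"
  using assms by (simp add: is_ring_hom_def)

context
  fixes h :: "'a::comm_ring_1 \<Rightarrow> 'b::comm_ring_1"
  assumes h: "is_ring_hom h"
begin

lemma is_ring_hom_1: "h 1 = 1"
  and is_ring_hom_add: "h (a + b) = h a + h b"
  and is_ring_hom_mult: "h (a * b) = h a * h b"
  using h by (auto simp: is_ring_hom_def)

lemma is_ring_hom_0: "h 0 = 0"
  using is_ring_hom_add[of 0 0] by simp

lemma is_ring_hom_uminus: "h (- a) = - h a"
  using is_ring_hom_add[of a "- a"] is_ring_hom_0 by (simp add: eq_neg_iff_add_eq_0 add.commute)

lemma is_ring_hom_diff: "h (a - b) = h a - h b"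
  using is_ring_hom_add[of a "- b"] is_ring_hom_uminus[of b] by simp

lemma is_ring_hom_sum: "h (sum f A) = (\<Sum>x\<in>A. h (f x))"
  by (induction A rule: infinite_finite_induct) (simp_all add: is_ring_hom_0 is_ring_hom_add)

lemma is_ring_hom_prod: "h (prod f A) = (\<Prod>x\<in>A. h (f x))"
  by (induction A rule: infinite_finite_induct) (simp_all add: is_ring_hom_1 is_ring_hom_mult)

lemma is_ring_hom_power: "h (a ^ n) = h a ^ n"
  by (induction n) (simp_all add: is_ring_hom_1 is_ring_hom_mult)

lemmas is_ring_hom_simps = is_ring_hom_0 is_ring_hom_1 is_ring_hom_add is_ring_hom_mult
  is_ring_hom_uminus is_ring_hom_diff is_ring_hom_sum is_ring_hom_prod is_ring_hom_power

end

lemma is_ring_hom_comp: "is_ring_hom g \<Longrightarrow> is_ring_hom h \<Longrightarrow> is_ring_hom (\<lambda>x. g (h x))"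
  by (simp add: is_ring_hom_def)

lemma is_ring_hom_id [simp]: "is_ring_hom (\<lambda>x. x)"
  by (simp add: is_ring_hom_def)

lemma is_ring_hom_const_poly [simp]: "is_ring_hom (\<lambda>c. [:c:])"
  by (simp add: is_ring_hom_def)

lemma is_ring_hom_poly [simp]: "is_ring_hom (\<lambda>p. poly p x)"
  by (simp add: is_ring_hom_def)

section \<open>Monomials and the universal evaluation homomorphism\<close>

definition pmon :: "(nat \<Rightarrow> 'r::comm_ring_1) \<Rightarrow> (nat \<Rightarrow>\<^sub>0 nat) \<Rightarrow> 'r" where
  "pmon G m = (\<Prod>i\<in>kys m. G i ^ lkp m i)"

lemma pmon_superset: "finite A \<Longrightarrow> kys m \<subseteq> A \<Longrightarrow> pmon G m = (\<Prod>i\<in>A. G i ^ lkp m i)"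
  unfolding pmon_def by (rule prod.mono_neutral_left) (auto simp: in_keys_iff)

lemma pmon_0 [simp]: "pmon G 0 = 1"
  by (simp add: pmon_def)

lemma pmon_single [simp]: "pmon G (Poly_Mapping.single i n) = G i ^ n"
  by (cases "n = 0") (simp_all add: pmon_def)

lemma pmon_add: "pmon G (m + m') = pmon G m * pmon G m'"
proof -
  let ?A = "kys m \<union> kys m'"
  have "kys (m + m') \<subseteq> ?A" by (rule keys_add)
  then show ?thesis
    using pmon_superset[of ?A m G] pmon_superset[of ?A m' G] pmon_superset[of ?A "m + m'" G]
    by (simp add: lookup_add power_add prod.distrib)
qed

text \<open>The universal property of the polynomial ring, with \<open>\<kappa>\<close> acting on
  coefficients and \<open>G\<close> giving the images of the variables. \<open>meval\<close>,
  \<open>msubst\<close> and the expansions below are instances and share their algebra.\<close>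

definition mev :: "(complex \<Rightarrow> 'r::comm_ring_1) \<Rightarrow> (nat \<Rightarrow> 'r) \<Rightarrow> mpol \<Rightarrow> 'r" where
  "mev \<kappa> G p = (\<Sum>m\<in>kys p. \<kappa> (lkp p m) * pmon G m)"

lemma meval_eq_mev: "meval x p = mev (\<lambda>c. c) x p"
  by (simp add: meval_def mev_def pmon_def)

lemma msubst_eq_mev: "msubst G p = mev mconst G p"
  by (simp add: msubst_def mev_def pmon_def)

lemma mpol_expansion: "(p :: mpol) = (\<Sum>m\<in>kys p. Poly_Mapping.single m (lkp p m))"
proof (rule poly_mapping_eqI)
  fix k
  have "lkp (\<Sum>m\<in>kys p. Poly_Mapping.single m (lkp p m)) k = (\<Sum>m\<in>kys p. if m = k then lkp p m else 0)"
    by (simp add: lookup_sum lookup_single when_def)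
  also have "\<dots> = lkp p k" by (simp add: in_keys_iff)
  finally show "lkp p k = lkp (\<Sum>m\<in>kys p. Poly_Mapping.single m (lkp p m)) k" by simp
qed

lemma mpol_single_induct [case_names zero add single]:
  fixes p :: mpol
  assumes "P 0" "\<And>p q. P p \<Longrightarrow> P q \<Longrightarrow> P (p + q)" "\<And>m c. P (Poly_Mapping.single m c)"
  shows "P p"
proof -
  have "P (\<Sum>m\<in>A. Poly_Mapping.single m (lkp p m))" if "finite A" for A
    using that by (induction A) (simp_all add: assms)
  from this[of "kys p"] show ?thesis by (subst mpol_expansion) simp
qed

lemma mconst_ring_hom [simp]: "is_ring_hom mconst"
  by (rule is_ring_homI) (simp_all add: mconst_def single_add mult_single)

lemma mconst_0 [simp]: "mconst 0 = 0"
  and mconst_1 [simp]: "mconst 1 = 1"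
  by (simp_all add: mconst_def)

lemma mconst_eq_0_iff [simp]: "mconst c = 0 \<longleftrightarrow> c = 0"
  by (metis mconst_def lookup_single_eq lookup_zero mconst_0)

lemma single_eq_pmon: "Poly_Mapping.single m c = mconst c * pmon mvar m"
proof -
  have pw: "mvar i ^ n = Poly_Mapping.single (Poly_Mapping.single i n) 1" for i n
    by (induction n) (simp_all add: mvar_def mult_single single_add[symmetric])
  have *: "(\<Prod>i\<in>A. mvar i ^ f i) = Poly_Mapping.single (\<Sum>i\<in>A. Poly_Mapping.single i (f i)) 1"
    if "finite A" for A and f :: "nat \<Rightarrow> nat"
    using that by (induction A) (simp_all add: pw mult_single)
  have "(\<Sum>i\<in>kys m. Poly_Mapping.single i (lkp m i)) = m"
  proof (rule poly_mapping_eqI)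
    fix k
    show "lkp (\<Sum>i\<in>kys m. Poly_Mapping.single i (lkp m i)) k = lkp m k"
      by (simp add: lookup_sum lookup_single when_def in_keys_iff)
  qed
  then show ?thesis by (simp add: pmon_def * mconst_def mult_single)
qed

lemma mpol_induct [case_names mconst mvar add mult]:
  fixes p :: mpol
  assumes c: "\<And>c. P (mconst c)" and v: "\<And>i. P (mvar i)"
    and a: "\<And>p q. P p \<Longrightarrow> P q \<Longrightarrow> P (p + q)" and m: "\<And>p q. P p \<Longrightarrow> P q \<Longrightarrow> P (p * q)"
  shows "P p"
proof (induction p rule: mpol_single_induct)
  case zero
  then show ?case using c[of 0] by simp
next
  case (single mm cc)
  have 1: "P 1" using c[of 1] by simp
  have pw: "P (mvar i ^ n)" for i n by (induction n) (auto intro: 1 m v)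
  have "P (\<Prod>i\<in>A. mvar i ^ f i)" if "finite A" for A f
    using that by (induction A) (auto intro: 1 m pw)
  then show ?case unfolding single_eq_pmon pmon_def by (intro m c) simp
qed (rule a)

lemma mev_superset:
  assumes "is_ring_hom \<kappa>" "finite A" "kys p \<subseteq> A"
  shows "mev \<kappa> G p = (\<Sum>m\<in>A. \<kappa> (lkp p m) * pmon G m)"
  unfolding mev_def using assms
  by (intro sum.mono_neutral_left) (auto simp: in_keys_iff is_ring_hom_0)

lemma mev_single:
  assumes "is_ring_hom \<kappa>"
  shows "mev \<kappa> G (Poly_Mapping.single m c) = \<kappa> c * pmon G m"
  using assms by (cases "c = 0") (simp_all add: mev_def is_ring_hom_0)

lemma mev_add:
  assumes "is_ring_hom \<kappa>"
  shows "mev \<kappa> G (p + q) = mev \<kappa> G p + mev \<kappa> G q"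
proof -
  let ?A = "kys p \<union> kys q"
  have "kys (p + q) \<subseteq> ?A" by (rule keys_add)
  then show ?thesis
    using mev_superset[OF assms, of ?A p G] mev_superset[OF assms, of ?A q G]
      mev_superset[OF assms, of ?A "p + q" G]
    by (simp add: lookup_add is_ring_hom_add[OF assms] algebra_simps sum.distrib)
qed

lemma mev_0 [simp]: "mev \<kappa> G 0 = 0"
  by (simp add: mev_def)

lemma mev_mult:
  assumes k: "is_ring_hom \<kappa>"
  shows "mev \<kappa> G (p * q) = mev \<kappa> G p * mev \<kappa> G q"
proof (induction p rule: mpol_single_induct)
  case (single m c)
  show ?case
  proof (induction q rule: mpol_single_induct)
    case (single m' c')
    then show ?case
      by (simp add: mult_single mev_single[OF k] pmon_add is_ring_hom_mult[OF k])
  qed (simp_all add: distrib_left mev_add[OF k])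
qed (simp_all add: distrib_right mev_add[OF k])

lemma mev_mconst [simp]: "is_ring_hom \<kappa> \<Longrightarrow> mev \<kappa> G (mconst c) = \<kappa> c"
  by (simp add: mconst_def mev_single)

lemma mev_mvar [simp]: "is_ring_hom \<kappa> \<Longrightarrow> mev \<kappa> G (mvar i) = G i"
  by (simp add: mvar_def mev_single is_ring_hom_1)

lemma mev_ring_hom [simp]: "is_ring_hom \<kappa> \<Longrightarrow> is_ring_hom (mev \<kappa> G)"
  using mev_mconst[of \<kappa> G 1] by (auto intro!: is_ring_homI simp: mev_add mev_mult is_ring_hom_1)

text \<open>Uniqueness in the universal property; all later interchange laws between homomorphisms
  and substitutions come from it.\<close>

lemma ring_hom_eq_mev:
  assumes "is_ring_hom \<Phi>"
  shows "\<Phi> p = mev (\<lambda>c. \<Phi> (mconst c)) (\<lambda>i. \<Phi> (mvar i)) p"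
proof -
  have k: "is_ring_hom (\<lambda>c. \<Phi> (mconst c))"
    by (rule is_ring_hom_comp[OF assms mconst_ring_hom])
  show ?thesis
    by (induction p rule: mpol_induct)
      (simp_all add: k is_ring_hom_simps[OF assms] is_ring_hom_simps[OF mev_ring_hom[OF k]])
qed

lemma hom_mev:
  assumes "is_ring_hom \<Phi>" "is_ring_hom \<kappa>"
  shows "\<Phi> (mev \<kappa> G p) = mev (\<lambda>c. \<Phi> (\<kappa> c)) (\<lambda>i. \<Phi> (G i)) p"
  using ring_hom_eq_mev[OF is_ring_hom_comp[OF assms(1) mev_ring_hom[OF assms(2)]], of G p] assms
  by simp

lemma mev_msubst:
  assumes "is_ring_hom \<kappa>"
  shows "mev \<kappa> Y (msubst G p) = mev \<kappa> (\<lambda>i. mev \<kappa> Y (G i)) p"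
  unfolding msubst_eq_mev using assms by (simp add: hom_mev)

lemma mev_mconst_mvar [simp]: "mev mconst mvar p = p"
  using ring_hom_eq_mev[OF is_ring_hom_id, of p] by simp

lemma mev_cong: "(\<And>i. i \<in> mvars p \<Longrightarrow> G i = G' i) \<Longrightarrow> mev \<kappa> G p = mev \<kappa> G' p"
  unfolding mev_def pmon_def mvars_def
  by (intro sum.cong arg_cong2[of _ _ _ _ "(*)"] prod.cong refl arg_cong2[of _ _ _ _ "(^)"]) blast

text \<open>Meant for subrings cut out by a bound on the occurring variables.\<close>

lemma mev_closed:
  assumes k: "\<And>c. \<kappa> c \<in> S" and G: "\<And>i. i \<in> mvars p \<Longrightarrow> G i \<in> S"
    and S: "0 \<in> S" "1 \<in> S" "\<And>a b. a \<in> S \<Longrightarrow> b \<in> S \<Longrightarrow> a + b \<in> S"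
      "\<And>a b. a \<in> S \<Longrightarrow> b \<in> S \<Longrightarrow> a * b \<in> S"
  shows "mev \<kappa> G p \<in> S"
proof -
  have sm: "sum f A \<in> S" if "\<And>x. x \<in> A \<Longrightarrow> f x \<in> S" for f and A :: "(nat \<Rightarrow>\<^sub>0 nat) set"
    using that by (induction A rule: infinite_finite_induct) (auto intro: S)
  have pr: "prod f A \<in> S" if "\<And>x. x \<in> A \<Longrightarrow> f x \<in> S" for f and A :: "nat set"
    using that by (induction A rule: infinite_finite_induct) (auto intro: S)
  have pw: "a ^ n \<in> S" if "a \<in> S" for a n
    using that by (induction n) (auto intro: S)
  show ?thesis
    unfolding mev_def pmon_def using G
    by (auto intro!: sm pr pw S(4) k simp: mvars_def)
qed

section \<open>Variables occurring in a polynomial\<close>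

lemma mvars_0 [simp]: "mvars 0 = {}"
  and mvars_mconst [simp]: "mvars (mconst c) = {}"
  and mvars_mvar [simp]: "mvars (mvar i) = {i}"
  by (auto simp: mvars_def mconst_def mvar_def)

lemma mvars_1 [simp]: "mvars 1 = {}"
  using mvars_mconst[of 1] by simp

lemma mvars_add: "mvars (p + q) \<subseteq> mvars p \<union> mvars q"
  using keys_add[of p q] by (auto simp: mvars_def)

lemma mvars_uminus [simp]: "mvars (- p) = mvars p"
  by (simp add: mvars_def)

lemma mvars_diff: "mvars (p - q) \<subseteq> mvars p \<union> mvars q"
  using mvars_add[of p "- q"] by simp

lemma mvars_mult_subset: "mvars (p * q) \<subseteq> mvars p \<union> mvars q"
proof
  fix i assume "i \<in> mvars (p * q)"
  then obtain m where m: "m \<in> kys (p * q)" "i \<in> kys m" by (auto simp: mvars_def)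
  obtain a b where "m = a + b" "a \<in> kys p" "b \<in> kys q"
    using keys_mult[of p q] m(1) by auto
  then show "i \<in> mvars p \<union> mvars q" using m(2) keys_add[of a b] by (auto simp: mvars_def)
qed

lemma mvars_sum: "mvars (sum f A) \<subseteq> (\<Union>x\<in>A. mvars (f x))"
proof (induction A rule: infinite_finite_induct)
  case (insert x F)
  then show ?case using mvars_add[of "f x" "sum f F"] by auto
qed auto

lemma mvars_prod: "mvars (prod f A) \<subseteq> (\<Union>x\<in>A. mvars (f x))"
proof (induction A rule: infinite_finite_induct)
  case (insert x F)
  then show ?case using mvars_mult_subset[of "f x" "prod f F"] by auto
qed auto

lemma mvars_addI: "mvars p \<subseteq> V \<Longrightarrow> mvars q \<subseteq> V \<Longrightarrow> mvars (p + q) \<subseteq> V"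
  and mvars_diffI: "mvars p \<subseteq> V \<Longrightarrow> mvars q \<subseteq> V \<Longrightarrow> mvars (p - q) \<subseteq> V"
  and mvars_multI: "mvars p \<subseteq> V \<Longrightarrow> mvars q \<subseteq> V \<Longrightarrow> mvars (p * q) \<subseteq> V"
  using mvars_add[of p q] mvars_diff[of p q] mvars_mult_subset[of p q] by auto

lemma mvars_sumI: "(\<And>x. x \<in> A \<Longrightarrow> mvars (f x) \<subseteq> V) \<Longrightarrow> mvars (sum f A) \<subseteq> V"
  and mvars_prodI: "(\<And>x. x \<in> A \<Longrightarrow> mvars (f x) \<subseteq> V) \<Longrightarrow> mvars (prod f A) \<subseteq> V"
  using mvars_sum[of f A] mvars_prod[of f A] by blast+

lemma mvars_powerI: "mvars p \<subseteq> V \<Longrightarrow> mvars (p ^ n) \<subseteq> V"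
  by (induction n) (simp_all add: mvars_multI)

section \<open>Degrees and homogeneous polynomials\<close>

text \<open>Isolates the variable \<open>y\<close>: the coefficients no longer contain it, which
  Gauss's argument and the use of leading coefficients require.\<close>

definition vpoly :: "nat \<Rightarrow> mpol \<Rightarrow> mpol poly" where
  "vpoly y = mev (\<lambda>c. [:mconst c:]) (\<lambda>i. if i = y then [:0, 1:] else [:mvar i:])"

text \<open>The substitution \<open>x\<^sub>i \<mapsto> x\<^sub>i T\<close>; it turns the grading by total degree into the grading by
  powers of \<open>T\<close>.\<close>

definition tpoly :: "mpol \<Rightarrow> mpol poly" where
  "tpoly = mev (\<lambda>c. [:mconst c:]) (\<lambda>i. [:0, mvar i:])"

lemma const_mconst_ring_hom [simp]: "is_ring_hom (\<lambda>c. [:mconst c:])"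
  by (rule is_ring_hom_comp) simp_all

lemma vpoly_ring_hom [simp]: "is_ring_hom (vpoly y)"
  and tpoly_ring_hom [simp]: "is_ring_hom tpoly"
  by (simp_all add: vpoly_def tpoly_def)

lemmas vpoly_simps = is_ring_hom_simps[OF vpoly_ring_hom]
lemmas tpoly_simps = is_ring_hom_simps[OF tpoly_ring_hom]

lemma vpoly_mconst [simp]: "vpoly y (mconst c) = [:mconst c:]"
  and vpoly_mvar: "vpoly y (mvar i) = (if i = y then [:0, 1:] else [:mvar i:])"
  by (simp_all add: vpoly_def)

lemma tpoly_mconst [simp]: "tpoly (mconst c) = [:mconst c:]"
  and tpoly_mvar [simp]: "tpoly (mvar i) = [:0, mvar i:]"
  by (simp_all add: tpoly_def)

lemma poly_vpoly [simp]: "poly (vpoly y p) (mvar y) = p"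
  by (induction p rule: mpol_induct) (simp_all add: vpoly_simps vpoly_mvar)

lemma poly_tpoly [simp]: "poly (tpoly p) 1 = p"
  by (induction p rule: mpol_induct) (simp_all add: tpoly_simps)

lemma vpoly_eq_0_iff [simp]: "vpoly y p = 0 \<longleftrightarrow> p = 0"
  by (metis poly_vpoly poly_0 is_ring_hom_0 vpoly_ring_hom)

lemma tpoly_eq_0_iff [simp]: "tpoly p = 0 \<longleftrightarrow> p = 0"
  by (metis poly_tpoly poly_0 is_ring_hom_0 tpoly_ring_hom)

lemma vpoly_const:
  assumes "y \<notin> mvars p"
  shows "vpoly y p = [:p:]"
proof -
  have "vpoly y p = mev (\<lambda>c. [:mconst c:]) (\<lambda>i. [:mvar i:]) p"
    unfolding vpoly_def using assms by (intro mev_cong) auto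
  also have "\<dots> = [:p:]"
    using ring_hom_eq_mev[OF is_ring_hom_const_poly, of p] by simp
  finally show ?thesis .
qed

lemma mvars_coeff_vpoly: "mvars (coeff (vpoly y p) i) \<subseteq> mvars p - {y}"
proof -
  let ?S = "{h. \<forall>i. mvars (coeff h i) \<subseteq> mvars p - {y}}"
  have "vpoly y p \<in> ?S"
    unfolding vpoly_def
  proof (rule mev_closed)
    fix a b assume ab: "a \<in> ?S" "b \<in> ?S"
    then show "a + b \<in> ?S" using mvars_add by fastforce
    show "a * b \<in> ?S"
    proof (clarsimp simp: coeff_mult)
      fix i x assume "x \<in> mvars (\<Sum>j\<le>i. coeff a j * coeff b (i - j))"
      then obtain j where "x \<in> mvars (coeff a j * coeff b (i - j))"
        using mvars_sum by fastforce
      then have "x \<in> mvars (coeff a j) \<union> mvars (coeff b (i - j))"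
        using mvars_mult_subset by blast
      then show "x \<in> mvars p \<and> x \<noteq> y" using ab by blast
    qed
  qed (auto simp: coeff_pCons split: nat.splits)
  then show ?thesis by simp
qed

definition vdeg :: "nat \<Rightarrow> mpol \<Rightarrow> nat" where "vdeg y p = degree (vpoly y p)"
definition tdeg :: "mpol \<Rightarrow> nat" where "tdeg p = degree (tpoly p)"

lemma vdeg_mult: "p \<noteq> 0 \<Longrightarrow> q \<noteq> 0 \<Longrightarrow> vdeg y (p * q) = vdeg y p + vdeg y q"
  by (simp add: vdeg_def vpoly_simps degree_mult_eq)

lemma tdeg_mult: "p \<noteq> 0 \<Longrightarrow> q \<noteq> 0 \<Longrightarrow> tdeg (p * q) = tdeg p + tdeg q"
  by (simp add: tdeg_def tpoly_simps degree_mult_eq)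

lemma vdeg_eq_0_iff: "vdeg y p = 0 \<longleftrightarrow> y \<notin> mvars p"
proof
  assume "vdeg y p = 0"
  then obtain c where c: "vpoly y p = [:c:]" by (metis vdeg_def degree_eq_zeroE)
  then have "p = c" by (metis poly_vpoly poly_const_conv)
  then show "y \<notin> mvars p" using mvars_coeff_vpoly[of y p 0] c by auto
qed (simp add: vdeg_def vpoly_const)

lemma mvars_mult:
  assumes "p \<noteq> 0" "q \<noteq> 0"
  shows "mvars (p * q) = mvars p \<union> mvars q"
proof (intro set_eqI)
  fix y
  show "y \<in> mvars (p * q) \<longleftrightarrow> y \<in> mvars p \<union> mvars q"
    using vdeg_mult[OF assms, of y] vdeg_eq_0_iff[of y "p * q"] vdeg_eq_0_iff[of y p] vdeg_eq_0_iff[of y q] by auto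
qed

lemma tpoly_single:
  "tpoly (Poly_Mapping.single m c) = monom (Poly_Mapping.single m c) (\<Sum>i\<in>kys m. lkp m i)"
proof -
  have pw: "[:0, mvar i:] ^ n = monom (mvar i ^ n) n" for i n
  proof (induction n)
    case (Suc n)
    have "[:0, mvar i:] = monom (mvar i) 1" by (simp add: monom_Suc monom_0)
    then show ?case using Suc by (simp add: mult_monom)
  qed simp
  have pr: "(\<Prod>i\<in>A. monom (g i) (f i)) = monom (prod g A) (sum f A)"
    if "finite A" for A :: "nat set" and g :: "nat \<Rightarrow> mpol" and f
    using that by (induction A) (simp_all add: mult_monom)
  show ?thesis
    by (subst single_eq_pmon)
      (simp add: tpoly_simps pmon_def pw pr single_eq_pmon[of m c] smult_monom)
qed

text \<open>A monomial contributes the power of T given by its total degree. Homogeneity becomes an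
  equation between univariate polynomials over a domain, and its closure and factor properties
  become facts about \<open>monom\<close>.\<close>

lemma homogeneous_iff_tpoly: "homogeneous d p \<longleftrightarrow> tpoly p = monom p d"
proof
  assume h: "homogeneous d p"
  have "tpoly p = (\<Sum>m\<in>kys p. tpoly (Poly_Mapping.single m (lkp p m)))"
    by (subst (1) mpol_expansion) (simp add: tpoly_simps)
  also have "\<dots> = (\<Sum>m\<in>kys p. monom (Poly_Mapping.single m (lkp p m)) d)"
    using h by (intro sum.cong) (auto simp: tpoly_single homogeneous_def)
  also have "\<dots> = monom (\<Sum>m\<in>kys p. Poly_Mapping.single m (lkp p m)) d"
    by (intro poly_eqI) (simp add: coeff_sum)
  finally show "tpoly p = monom p d" by (simp add: mpol_expansion[symmetric])
next
  assume t: "tpoly p = monom p d"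
  show "homogeneous d p"
    unfolding homogeneous_def
  proof (rule ballI, rule ccontr)
    fix m assume m: "m \<in> kys p" and d: "(\<Sum>i\<in>kys m. lkp m i) \<noteq> d"
    let ?j = "\<Sum>i\<in>kys m. lkp m i"
    have "tpoly p = (\<Sum>m\<in>kys p. tpoly (Poly_Mapping.single m (lkp p m)))"
      by (subst (1) mpol_expansion) (simp add: tpoly_simps)
    then have "coeff (tpoly p) ?j
        = (\<Sum>m'\<in>kys p. if (\<Sum>i\<in>kys m'. lkp m' i) = ?j then Poly_Mapping.single m' (lkp p m') else 0)"
      by (simp add: coeff_sum tpoly_single)
    \<comment> \<open>Different monomials cannot cancel: within the part of degree
      \<open>?j\<close>, the coefficient at \<open>m\<close> comes from \<open>m\<close>
      alone.\<close>
    then have "lkp (coeff (tpoly p) ?j) m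
        = (\<Sum>m'\<in>kys p. if m' = m then lkp p m' else 0)"
      by (simp only: lookup_sum) (intro sum.cong, auto simp: lookup_single when_def)
    also have "\<dots> = lkp p m" using m by simp
    finally show False using m t d by (simp add: in_keys_iff)
  qed
qed

section \<open>Closure properties and factors of homogeneous polynomials\<close>

lemma homogeneous_0 [simp]: "homogeneous d 0"
  by (simp add: homogeneous_def)

lemma homogeneous_mconst [simp]: "homogeneous 0 (mconst c)"
  by (simp add: homogeneous_iff_tpoly monom_0)

lemma homogeneous_1 [simp]: "homogeneous 0 1"
  using homogeneous_mconst[of 1] by simp

lemma homogeneous_mvar [simp]: "homogeneous 1 (mvar i)"
  by (simp add: homogeneous_iff_tpoly monom_Suc monom_0)

lemma homogeneous_mult: "homogeneous d p \<Longrightarrow> homogeneous e q \<Longrightarrow> homogeneous (d + e) (p * q)"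
  by (simp add: homogeneous_iff_tpoly tpoly_simps mult_monom)

lemma homogeneous_add: "homogeneous d p \<Longrightarrow> homogeneous d q \<Longrightarrow> homogeneous d (p + q)"
  by (simp add: homogeneous_iff_tpoly tpoly_simps add_monom)

lemma homogeneous_diff: "homogeneous d p \<Longrightarrow> homogeneous d q \<Longrightarrow> homogeneous d (p - q)"
  by (simp add: homogeneous_iff_tpoly tpoly_simps diff_monom)

lemma homogeneous_sum: "(\<And>x. x \<in> A \<Longrightarrow> homogeneous d (f x)) \<Longrightarrow> homogeneous d (sum f A)"
  by (induction A rule: infinite_finite_induct) (simp_all add: homogeneous_add)

lemma homogeneous_prod:
  "(\<And>x. x \<in> A \<Longrightarrow> homogeneous (d x) (f x)) \<Longrightarrow> homogeneous (sum d A) (prod f A)"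
  by (induction A rule: infinite_finite_induct) (simp_all add: homogeneous_mult)

lemma homogeneous_tdeg: "homogeneous d p \<Longrightarrow> p \<noteq> 0 \<Longrightarrow> tdeg p = d"
  by (simp add: homogeneous_iff_tpoly tdeg_def degree_monom_eq)

lemma mev_homogeneous_scale:
  assumes k: "is_ring_hom \<kappa>" and h: "homogeneous d p"
  shows "mev \<kappa> (\<lambda>i. l * Y i) p = l ^ d * mev \<kappa> Y p"
proof -
  have "pmon (\<lambda>i. l * Y i) m = l ^ d * pmon Y m" if "m \<in> kys p" for m
    using that h by (simp add: pmon_def homogeneous_def power_mult_distrib prod.distrib flip: power_sum)
  then show ?thesis by (simp add: mev_def sum_distrib_left algebra_simps)
qed

text \<open>Splitting off the full power of the variable leaves factors with nonzero constant terms.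
  The coefficient at the sum of the two orders is then nonzero, so these orders account for all of
  \<open>d\<close> and the remaining product is constant.\<close>

lemma monom_factor:
  fixes p q :: "'a::idom poly"
  assumes "p * q = monom c d" "c \<noteq> 0"
  shows "\<exists>a n. p = monom a n"
proof -
  have nz: "p \<noteq> 0" "q \<noteq> 0" using assms by auto
  obtain p' where p': "p = [:- 0, 1:] ^ order 0 p * p'" "\<not> [:- 0, 1:] dvd p'"
    using order_decomp[OF nz(1)] by blast
  obtain q' where q': "q = [:- 0, 1:] ^ order 0 q * q'" "\<not> [:- 0, 1:] dvd q'"
    using order_decomp[OF nz(2)] by blast
  have X: "[:- 0, 1::'a:] ^ n = monom 1 n" for n
    by (induction n) (simp_all add: monom_Suc)
  have c: "coeff p' 0 \<noteq> 0" "coeff q' 0 \<noteq> 0"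
    using p'(2) q'(2) poly_eq_0_iff_dvd[of p' 0] poly_eq_0_iff_dvd[of q' 0]
    by (simp_all add: poly_0_coeff_0)
  let ?e = "order 0 p + order 0 q"
  have eq: "monom c d = monom 1 ?e * (p' * q')"
    using assms(1) p'(1) q'(1) unfolding X by (metis (no_types, lifting) mult.assoc mult.left_commute mult_monom mult_1)
  have "coeff (monom c d) ?e = coeff p' 0 * coeff q' 0"
    unfolding eq by (simp add: coeff_monom_mult coeff_mult_0)
  then have "d = ?e" using c by (auto split: if_splits)
  then have "monom 1 d * (p' * q') = monom 1 d * [:c:]" using eq by (simp add: smult_monom)
  then have "p' * q' = [:c:]" by (subst (asm) mult_left_cancel) auto
  then have "degree p' + degree q' = 0"
    using assms(2) by (metis degree_mult_eq degree_pCons_0 mult_eq_0_iff pCons_eq_0_iff)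
  then obtain a where "p' = [:a:]" by (metis add_is_0 degree_eq_zeroE)
  then have "p = monom a (order 0 p)" using p'(1) unfolding X by (simp add: smult_monom)
  then show ?thesis by blast
qed

lemma homogeneous_factor:
  assumes "homogeneous d (p * q)" "p * q \<noteq> 0"
  shows "\<exists>n. homogeneous n p"
proof -
  have "tpoly p * tpoly q = monom (p * q) d"
    using assms by (simp add: homogeneous_iff_tpoly tpoly_simps)
  then obtain a n where an: "tpoly p = monom a n" using monom_factor[OF _ assms(2)] by blast
  then have "p = a" by (metis poly_tpoly poly_monom mult_1_right power_one)
  then show ?thesis using an by (auto simp: homogeneous_iff_tpoly)
qed

lemma tdeg_0_imp_const:
  assumes "tdeg p = 0"
  shows "p = mconst (lkp p 0)"
proof -
  obtain c where "tpoly p = [:c:]" using assms by (metis tdeg_def degree_eq_zeroE)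
  then have "tpoly p = monom p 0" by (metis poly_tpoly poly_const_conv monom_0)
  then have h: "homogeneous 0 p" by (simp add: homogeneous_iff_tpoly)
  have "m = 0" if "m \<in> kys p" for m
    using h that by (auto simp: homogeneous_def in_keys_iff intro!: poly_mapping_eqI)
  then have "kys p \<subseteq> {0}" by auto
  then show ?thesis
    by (intro poly_mapping_eqI) (auto simp: mconst_def lookup_single when_def in_keys_iff)
qed

text \<open>Total degree is additive and nonzero complex constants are invertible. Inductions on
  total degree use it to see that removing a non-unit lowers the degree.\<close>

lemma mpol_unit_iff: "(p :: mpol) dvd 1 \<longleftrightarrow> p \<noteq> 0 \<and> tdeg p = 0"
proof
  assume u: "p dvd 1"
  then obtain q where q: "1 = p * q" by (auto elim: dvdE)
  then have nz: "p \<noteq> 0" "q \<noteq> 0" by auto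
  have "tdeg 1 = 0" by (simp add: tdeg_def tpoly_simps)
  then show "p \<noteq> 0 \<and> tdeg p = 0" using q tdeg_mult[OF nz] nz by simp
next
  assume p: "p \<noteq> 0 \<and> tdeg p = 0"
  then obtain c where c: "p = mconst c" using tdeg_0_imp_const by blast
  then have "p * mconst (1 / c) = 1"
    using p by (simp flip: is_ring_hom_mult[OF mconst_ring_hom])
  then show "p dvd 1" by (metis dvd_triv_left)
qed

section \<open>Unique factorization and the degree of a rational map\<close>

text \<open>Primality is tested only against polynomials in the variables \<open>V\<close>, which
  permits induction on \<open>V\<close>.\<close>

definition prime_in :: "nat set \<Rightarrow> mpol \<Rightarrow> bool" where
  "prime_in V p \<longleftrightarrow> (\<forall>f g. mvars f \<subseteq> V \<longrightarrow> mvars g \<subseteq> V \<longrightarrow> p dvd f * g \<longrightarrow> p dvd f \<or> p dvd g)"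

lemma irreducible_factor_exists:
  fixes p :: mpol
  assumes "p \<noteq> 0" "\<not> p dvd 1"
  shows "\<exists>h. irreducible h \<and> h dvd p"
  using assms
proof (induction "tdeg p" arbitrary: p rule: less_induct)
  case less
  show ?case
  proof (cases "irreducible p")
    case False
    then obtain a b where ab: "p = a * b" "\<not> a dvd 1" "\<not> b dvd 1"
      using less.prems by (auto simp: irreducible_def)
    have nz: "a \<noteq> 0" "b \<noteq> 0" using ab less.prems by auto
    then have "tdeg a < tdeg p" using ab tdeg_mult[OF nz] mpol_unit_iff[of b] by auto
    then obtain h where "irreducible h" "h dvd a" using less.hyps[of a] ab nz by blast
    then show ?thesis using ab by (metis dvd_mult2)
  qed (use dvd_refl in blast)
qed

lemma mvars_dvd: "p dvd q \<Longrightarrow> q \<noteq> 0 \<Longrightarrow> mvars p \<subseteq> mvars q"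
  by (metis Un_upper1 dvdE mult_eq_0_iff mvars_mult)

lemma dvd_iff_dvd_coeff_vpoly:
  assumes "y \<notin> mvars p"
  shows "p dvd f \<longleftrightarrow> (\<forall>i. p dvd coeff (vpoly y f) i)"
proof
  assume "p dvd f"
  then obtain h where "f = p * h" by blast
  then have "vpoly y f = [:p:] * vpoly y h" using assms by (simp add: vpoly_simps vpoly_const)
  then show "\<forall>i. p dvd coeff (vpoly y f) i" by simp
next
  assume "\<forall>i. p dvd coeff (vpoly y f) i"
  then have "p dvd poly (vpoly y f) (mvar y)"
    unfolding poly_altdef by (intro dvd_sum dvd_mult2) auto
  then show "p dvd f" by simp
qed

text \<open>Take the first coefficients of \<open>f\<close> and \<open>g\<close> not divisible by
  \<open>p\<close>. In the coefficient of the product at the sum of their positions every other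
  summand is divisible by \<open>p\<close>.\<close>

lemma prime_in_insert:
  assumes p: "prime_in V p" and y: "y \<notin> mvars p"
  shows "prime_in (insert y V) p"
  unfolding prime_in_def
proof (intro allI impI, rule ccontr)
  fix f g
  assume V: "mvars f \<subseteq> insert y V" "mvars g \<subseteq> insert y V" and d: "p dvd f * g"
    and n: "\<not> (p dvd f \<or> p dvd g)"
  let ?F = "coeff (vpoly y f)" and ?G = "coeff (vpoly y g)"
  define i where "i = (LEAST i. \<not> p dvd ?F i)"
  define j where "j = (LEAST i. \<not> p dvd ?G i)"
  have ex: "\<exists>i. \<not> p dvd ?F i" "\<exists>i. \<not> p dvd ?G i"
    using n dvd_iff_dvd_coeff_vpoly[OF y] by blast+
  have i: "\<not> p dvd ?F i" "\<And>l. l < i \<Longrightarrow> p dvd ?F l"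
    unfolding i_def using LeastI_ex[OF ex(1)] not_less_Least by blast+
  have j: "\<not> p dvd ?G j" "\<And>l. l < j \<Longrightarrow> p dvd ?G l"
    unfolding j_def using LeastI_ex[OF ex(2)] not_less_Least by blast+
  have "p dvd coeff (vpoly y (f * g)) (i + j)"
    using d dvd_iff_dvd_coeff_vpoly[OF y] by blast
  then have "p dvd (\<Sum>l\<le>i + j. ?F l * ?G (i + j - l))"
    by (simp add: vpoly_simps coeff_mult)
  moreover have "(\<Sum>l\<le>i + j. ?F l * ?G (i + j - l))
      = ?F i * ?G j + (\<Sum>l\<in>{..i + j} - {i}. ?F l * ?G (i + j - l))"
    by (subst sum.remove[of _ i]) auto
  moreover have "p dvd (\<Sum>l\<in>{..i + j} - {i}. ?F l * ?G (i + j - l))"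
  proof (rule dvd_sum)
    fix l assume l: "l \<in> {..i + j} - {i}"
    show "p dvd ?F l * ?G (i + j - l)"
    proof (cases "l < i")
      case True
      then show ?thesis by (rule dvd_mult2[OF i(2)])
    next
      case False
      then have "i + j - l < j" using l by auto
      then show ?thesis by (rule dvd_mult[OF j(2)])
    qed
  qed
  ultimately have "p dvd ?F i * ?G j" by (simp add: dvd_add_left_iff)
  moreover have "mvars (?F i) \<subseteq> V" "mvars (?G j) \<subseteq> V"
    using mvars_coeff_vpoly[of y f i] mvars_coeff_vpoly[of y g j] V by blast+
  ultimately show False using p i(1) j(1) unfolding prime_in_def by blast
qed

text \<open>The inductive step of Gauss's theorem: \<open>\<pi>\<close> involves the new variable \<open>y\<close>, and \<open>c\<close> is a
  constant with respect to \<open>y\<close> all of whose irreducible factors are prime. Cancelling these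
  one by one replaces the passage to the field of fractions.\<close>

context
  fixes V :: "nat set" and y :: nat
  assumes y: "y \<notin> V"
    and IH: "\<And>p. mvars p \<subseteq> V \<Longrightarrow> irreducible p \<Longrightarrow> prime_in V p"
begin

lemma prime_constant:
  assumes "mvars p \<subseteq> V" "irreducible p"
  shows "prime_in (insert y V) p"
  using IH[OF assms] prime_in_insert[of V p y] assms(1) y by blast

text \<open>The cofactor would be a unit, hence free of variables, and \<open>h\<close> could not
  involve \<open>y\<close>.\<close>

lemma not_dvd_constant:
  assumes "irreducible h" "y \<in> mvars h" "mvars p \<subseteq> V" "irreducible p"
  shows "\<not> p dvd h"
proof
  assume "p dvd h"
  then obtain w where w: "h = p * w" by blast
  then have "w dvd 1" using assms by (auto simp: irreducible_def)
  moreover have "p \<noteq> 0" "w \<noteq> 0" using w assms(1) by auto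
  moreover have "mvars w = {}"
  proof -
    have "mvars w \<subseteq> mvars 1" using \<open>w dvd 1\<close> by (rule mvars_dvd) simp
    then show ?thesis by simp
  qed
  ultimately have "mvars h = mvars p" using w mvars_mult[of p w] by simp
  then show False using assms(2,3) y by blast
qed

text \<open>A prime factor of \<open>c\<close> divides \<open>h * w\<close> but not
  \<open>h\<close>, so it can be removed from \<open>c\<close> and \<open>w\<close> together until
  \<open>c\<close> is a unit.\<close>

lemma cancel_constant:
  assumes h: "irreducible h" "y \<in> mvars h" "mvars h \<subseteq> insert y V"
    and c: "mvars c \<subseteq> V" "c \<noteq> 0" and f: "mvars f \<subseteq> insert y V" and eq: "h * w = c * f"
  shows "h dvd f"
  using c eq
proof (induction "tdeg c" arbitrary: c w rule: less_induct)
  case less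
  show ?case
  proof (cases "c dvd 1")
    case True
    then obtain c' where c': "1 = c * c'" by blast
    have "h * (w * c') = (h * w) * c'" by (simp only: mult.assoc)
    also have "\<dots> = (c * c') * f" using less.prems(3) by (simp only: ac_simps)
    finally have "h * (w * c') = f" using c' by simp
    then show ?thesis by (metis dvd_triv_left)
  next
    case False
    then obtain p where p: "irreducible p" "p dvd c"
      using irreducible_factor_exists less.prems by blast
    have pV: "mvars p \<subseteq> V" using mvars_dvd[OF p(2)] less.prems by blast
    obtain c' where c': "c = p * c'" using p(2) by blast
    have nz: "p \<noteq> 0" "c' \<noteq> 0" using c' less.prems by auto
    have "tdeg c' < tdeg c" using tdeg_mult[OF nz] c' p(1) mpol_unit_iff[of p] nz
      by (auto simp: irreducible_def)
    moreover have "mvars c' \<subseteq> V" using mvars_dvd[of c' c] c' less.prems by auto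
    moreover have "\<exists>w'. h * w' = c' * f"
    proof (cases "f = 0")
      case True
      then show ?thesis by (intro exI[of _ 0]) simp
    next
      case False
      have wz: "w \<noteq> 0" using less.prems False by auto
      have "mvars (h * w) \<subseteq> insert y V" using less.prems f mvars_mult_subset[of c f] by auto
      then have "mvars w \<subseteq> insert y V" using mvars_mult[of h w] h(1) wz by (auto simp: irreducible_def)
      moreover have "p dvd h * w" using less.prems c' by (metis dvd_triv_left mult.assoc)
      ultimately have "p dvd h \<or> p dvd w"
        using prime_constant[OF pV p(1)] h(3) unfolding prime_in_def by blast
      then have "p dvd w" using not_dvd_constant[OF h(1,2) pV p(1)] by blast
      then obtain w' where w': "w = p * w'" by blast
      have "p * (h * w') = p * (c' * f)" using less.prems(3) c' w' by (simp add: ac_simps)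
      then show ?thesis using nz by auto
    qed
    ultimately show ?thesis using less.hyps nz by blast
  qed
qed

text \<open>Every prime factor of \<open>c\<close> divides \<open>q\<close> or \<open>r\<close>.
  Removing it there leads to a factorization of \<open>\<pi>\<close> itself; \<open>d\<close>
  collects what was taken out of \<open>r\<close>.\<close>

lemma split_constant:
  assumes c: "mvars c \<subseteq> V" "c \<noteq> 0" and \<pi>: "mvars \<pi> \<subseteq> insert y V" "\<pi> \<noteq> 0" and eq: "c * \<pi> = q * r"
  shows "\<exists>q' r' d. \<pi> = q' * r' \<and> r = d * r' \<and> mvars d \<subseteq> V \<and> d \<noteq> 0"
  using c eq
proof (induction "tdeg c" arbitrary: c q r rule: less_induct)
  case less
  show ?case
  proof (cases "c dvd 1")
    case True
    then obtain c' where "1 = c * c'" by blast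
    then have "\<pi> = (c' * q) * r" using less.prems(3) by (metis mult.assoc mult.commute mult_1)
    then show ?thesis by (intro exI[of _ "c' * q"] exI[of _ r] exI[of _ 1]) simp
  next
    case False
    then obtain p where p: "irreducible p" "p dvd c"
      using irreducible_factor_exists less.prems by blast
    have pV: "mvars p \<subseteq> V" using mvars_dvd[OF p(2)] less.prems by blast
    obtain c' where c': "c = p * c'" using p(2) by blast
    have nz: "p \<noteq> 0" "c' \<noteq> 0" using c' less.prems by auto
    have td: "tdeg c' < tdeg c" using tdeg_mult[OF nz] c' p(1) mpol_unit_iff[of p] nz
      by (auto simp: irreducible_def)
    have V': "mvars c' \<subseteq> V" using mvars_dvd[of c' c] c' less.prems by auto
    have qr: "q \<noteq> 0" "r \<noteq> 0" using less.prems \<pi> by auto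
    have "mvars (q * r) \<subseteq> insert y V" using less.prems \<pi> mvars_mult_subset[of c \<pi>] by auto
    then have "mvars q \<subseteq> insert y V" "mvars r \<subseteq> insert y V" using mvars_mult[OF qr] by auto
    moreover have "p dvd q * r" using less.prems c' by (metis dvd_triv_left mult.assoc)
    ultimately consider "p dvd q" | "p dvd r"
      using prime_constant[OF pV p(1)] unfolding prime_in_def by blast
    then show ?thesis
    proof cases
      case 1
      then obtain q1 where q1: "q = p * q1" by blast
      have "p * (c' * \<pi>) = p * (q1 * r)" using less.prems(3) c' q1 by (simp add: ac_simps)
      then have "c' * \<pi> = q1 * r" using nz by simp
      then show ?thesis by (rule less.hyps[OF td V' nz(2)])
    next
      case 2
      then obtain r1 where r1: "r = p * r1" by blast
      have "p * (c' * \<pi>) = p * (q * r1)" using less.prems(3) c' r1 by (simp add: ac_simps)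
      then obtain q' r' d where *: "\<pi> = q' * r'" "r1 = d * r'" "mvars d \<subseteq> V" "d \<noteq> 0"
        using less.hyps[OF td V' nz(2), of q r1] nz by auto
      have "mvars (p * d) \<subseteq> V" using mvars_mult_subset[of p d] * pV by blast
      then show ?thesis using * r1 nz
        by (intro exI[of _ q'] exI[of _ r'] exI[of _ "p * d"]) (auto simp: ac_simps)
    qed
  qed
qed

text \<open>Bezout's argument without denominators: an element \<open>r\<close> of least degree in
  \<open>y\<close> in the ideal of \<open>\<pi>\<close> and \<open>f\<close> divides every element
  up to a constant factor. As \<open>\<pi>\<close> is irreducible, either \<open>r\<close> is
  \<open>\<pi>\<close> up to constants and \<open>\<pi>\<close> divides \<open>f\<close>, or
  \<open>r\<close> is free of \<open>y\<close>, and the combination producing it, multiplied by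
  \<open>g\<close>, shows that \<open>\<pi>\<close> divides \<open>r * g\<close>.\<close>

lemma prime_new_variable:
  assumes \<pi>: "irreducible \<pi>" "y \<in> mvars \<pi>" "mvars \<pi> \<subseteq> insert y V"
  shows "prime_in (insert y V) \<pi>"
  unfolding prime_in_def
proof (intro allI impI)
  fix f g
  assume fg: "mvars f \<subseteq> insert y V" "mvars g \<subseteq> insert y V" "\<pi> dvd f * g"
  have \<pi>0: "\<pi> \<noteq> 0" using \<pi>(1) by (simp add: irreducible_def)
  define I where "I = {u * \<pi> + v * f | u v. mvars u \<subseteq> insert y V \<and> mvars v \<subseteq> insert y V}"
  have \<pi>I: "\<pi> \<in> I" unfolding I_def by (rule CollectI, intro exI[of _ 1] exI[of _ 0]) simp
  have fI: "f \<in> I" unfolding I_def by (rule CollectI, intro exI[of _ 0] exI[of _ 1]) simp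
  have I_comb: "a * s - b * t \<in> I" if I: "s \<in> I" "t \<in> I" and V: "mvars a \<subseteq> insert y V" "mvars b \<subseteq> insert y V" for a b s t
  proof -
    obtain u v u' v' where *: "s = u * \<pi> + v * f" "t = u' * \<pi> + v' * f"
      "mvars u \<subseteq> insert y V" "mvars v \<subseteq> insert y V" "mvars u' \<subseteq> insert y V" "mvars v' \<subseteq> insert y V"
      using I unfolding I_def by blast
    have "mvars (a * u - b * u') \<subseteq> insert y V" "mvars (a * v - b * v') \<subseteq> insert y V"
      using * V by (simp_all add: mvars_diffI mvars_multI)
    moreover have "a * s - b * t = (a * u - b * u') * \<pi> + (a * v - b * v') * f"
      using * by (simp add: algebra_simps)
    ultimately show ?thesis unfolding I_def by blast
  qed
  have IV: "mvars s \<subseteq> insert y V" if s: "s \<in> I" for s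
  proof -
    obtain u v where "s = u * \<pi> + v * f" "mvars u \<subseteq> insert y V" "mvars v \<subseteq> insert y V"
      using s unfolding I_def by blast
    then show ?thesis
      using \<pi>(3) fg(1) by (simp add: mvars_addI mvars_multI)
  qed
  obtain r where r: "r \<in> I" "r \<noteq> 0" and rmin: "\<And>s. s \<in> I \<Longrightarrow> s \<noteq> 0 \<Longrightarrow> vdeg y r \<le> vdeg y s"
    using ex_has_least_nat[of "\<lambda>s. s \<in> I \<and> s \<noteq> 0" \<pi> "vdeg y"] \<pi>I \<pi>0 by blast
  define lr where "lr = lead_coeff (vpoly y r)"
  have lrV: "mvars lr \<subseteq> V"
    unfolding lr_def using mvars_coeff_vpoly[of y r] IV[OF r(1)] by blast
  have lr0: "lr \<noteq> 0" using r(2) by (simp add: lr_def)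
  have pseudo_div: "\<exists>c q. mvars c \<subseteq> V \<and> c \<noteq> 0 \<and> c * s = q * r" if "s \<in> I" for s
    using that
  proof (induction "vdeg y s" arbitrary: s rule: less_induct)
    case less
    show ?case
    proof (cases "s = 0")
      case True
      then show ?thesis by (intro exI[of _ 1] exI[of _ 0]) simp
    next
      case False
      define ls where "ls = lead_coeff (vpoly y s)"
      define e where "e = vdeg y s - vdeg y r"
      \<comment> \<open>The pseudo-remainder: cross-multiplying by leading coefficients cancels the
        top terms without division.\<close>
      define t where "t = lr * s - (ls * mvar y ^ e) * r"
      have le: "vdeg y r \<le> vdeg y s" using rmin[OF less.prems False] .
      have lsV: "mvars ls \<subseteq> V"
        unfolding ls_def using mvars_coeff_vpoly[of y s] IV[OF less.prems] by blast
      have ls0: "ls \<noteq> 0" using False by (simp add: ls_def)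
      have "mvars (ls * mvar y ^ e) \<subseteq> insert y V"
        using lsV by (intro mvars_multI mvars_powerI) auto
      then have tI: "t \<in> I"
        unfolding t_def using lrV by (intro I_comb less.prems r(1)) auto
      have vt: "vpoly y t = smult lr (vpoly y s) - smult ls (monom 1 e * vpoly y r)"
      proof -
        have "y \<notin> mvars lr" "y \<notin> mvars ls" using y lrV lsV by blast+
        then show ?thesis
          unfolding t_def by (simp add: vpoly_simps vpoly_mvar vpoly_const monom_altdef)
      qed
      \<comment> \<open>In degree 0 the degree cannot drop, but then the pseudo-remainder is
        zero.\<close>
      have tdeg: "t = 0 \<or> vdeg y t < vdeg y s"
      proof (cases "vdeg y s = 0")
        case True
        then have "e = 0" "vdeg y r = 0" using le by (auto simp: e_def)
        then have "degree (vpoly y s) = 0" "degree (vpoly y r) = 0" using True by (auto simp: vdeg_def)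
        then obtain a b where ab: "vpoly y s = [:a:]" "vpoly y r = [:b:]" by (metis degree_eq_zeroE)
        then have "vpoly y t = 0"
          unfolding vt lr_def ls_def using \<open>e = 0\<close> by (simp add: monom_0)
        then show ?thesis by simp
      next
        case False
        have dm: "degree (monom 1 e * vpoly y r) = vdeg y s"
          using r(2) le by (subst degree_mult_eq) (auto simp: degree_monom_eq e_def vdeg_def)
        have "degree (vpoly y t) < vdeg y s"
        proof (rule degree_lessI)
          show "vpoly y t \<noteq> 0 \<or> 0 < vdeg y s" using False by simp
          show "\<forall>k\<ge>vdeg y s. coeff (vpoly y t) k = 0"
          proof (intro allI impI)
            fix k assume k: "vdeg y s \<le> k"
            show "coeff (vpoly y t) k = 0"
            proof (cases "k = vdeg y s")
              case True
              have "k - e = degree (vpoly y r)" "e \<le> k" using True le by (auto simp: e_def vdeg_def)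
              then show ?thesis unfolding vt using True
                by (simp add: coeff_monom_mult lr_def ls_def vdeg_def)
            next
              case False
              then have "k > vdeg y s" using k by simp
              then have "coeff (vpoly y s) k = 0" "coeff (monom 1 e * vpoly y r) k = 0"
                using dm by (auto simp: vdeg_def intro!: coeff_eq_0)
              then show ?thesis unfolding vt by simp
            qed
          qed
        qed
        then show ?thesis by (simp add: vdeg_def)
      qed
      have "\<exists>c q. mvars c \<subseteq> V \<and> c \<noteq> 0 \<and> c * t = q * r"
      proof (cases "t = 0")
        case True
        then show ?thesis by (intro exI[of _ 1] exI[of _ 0]) simp
      qed (use tdeg less.hyps[OF _ tI] in blast)
      then obtain c q where cq: "mvars c \<subseteq> V" "c \<noteq> 0" "c * t = q * r" by blast
      have "(c * lr) * s = (q + c * (ls * mvar y ^ e)) * r"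
        using cq(3) by (simp add: t_def algebra_simps)
      moreover have "mvars (c * lr) \<subseteq> V" using mvars_mult_subset[of c lr] cq lrV by blast
      ultimately show ?thesis using cq lr0 by (intro exI) auto
    qed
  qed
  obtain c q where cq: "mvars c \<subseteq> V" "c \<noteq> 0" "c * \<pi> = q * r" using pseudo_div[OF \<pi>I] by blast
  obtain q' r' d where d: "\<pi> = q' * r'" "r = d * r'" "mvars d \<subseteq> V" "d \<noteq> 0"
    using split_constant[OF cq(1,2) \<pi>(3) \<pi>0 cq(3)] by blast
  have "q' dvd 1 \<or> r' dvd 1" using \<pi>(1) d(1) by (auto simp: irreducible_def)
  then show "\<pi> dvd f \<or> \<pi> dvd g"
  proof
    assume "q' dvd 1"
    then obtain w where w: "1 = q' * w" by blast
    then have r': "r' = w * \<pi>" using d(1) by (metis mult.assoc mult.commute mult_1)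
    obtain c' q'' where c': "mvars c' \<subseteq> V" "c' \<noteq> 0" "c' * f = q'' * r" using pseudo_div[OF fI] by blast
    have "\<pi> * (q'' * d * w) = c' * f" using c'(3) d(2) r' by (simp add: ac_simps)
    then have "\<pi> dvd f" using cancel_constant[OF \<pi> c'(1,2) fg(1)] by blast
    then show ?thesis ..
  next
    assume "r' dvd 1"
    then have "mvars r' \<subseteq> mvars 1" by (rule mvars_dvd) simp
    then have rV: "mvars r \<subseteq> V" using d mvars_mult_subset[of d r'] by auto
    obtain u v where "r = u * \<pi> + v * f" using r(1) unfolding I_def by blast
    then have "r * g = \<pi> * (u * g) + v * (f * g)" by (simp add: algebra_simps)
    moreover obtain z where "f * g = \<pi> * z" using fg(3) by blast
    ultimately have "\<pi> * (u * g + v * z) = r * g" by (simp add: algebra_simps)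
    then have "\<pi> dvd g" using cancel_constant[OF \<pi> rV r(2) fg(2)] by blast
    then show ?thesis ..
  qed
qed

end

lemma irreducible_imp_prime_in:
  assumes "finite V" "mvars p \<subseteq> V" "irreducible p"
  shows "prime_in V p"
  using assms
proof (induction V arbitrary: p)
  case empty
  \<comment> \<open>Without variables only constants remain, and no constant is irreducible.\<close>
  have no: "h dvd 1" if "mvars h = {}" "h \<noteq> 0" for h
  proof -
    have "h = mconst (lkp h 0)"
    proof (rule poly_mapping_eqI)
      fix m
      show "lkp h m = lkp (mconst (lkp h 0)) m"
      proof (cases "m \<in> kys h")
        case True
        then have "kys m = {}" using that by (auto simp: mvars_def)
        then show ?thesis by (simp add: mconst_def)
      next
        case False
        then show ?thesis by (auto simp: mconst_def lookup_single when_def in_keys_iff)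
      qed
    qed
    then have "tdeg h = 0" by (metis tdeg_def tpoly_mconst degree_pCons_0)
    then show ?thesis using that mpol_unit_iff by blast
  qed
  then have False using empty by (auto simp: irreducible_def)
  then show ?case ..
next
  case (insert y V)
  show ?case
  proof (cases "y \<in> mvars p")
    case True
    then show ?thesis using prime_new_variable[of y V p] insert by blast
  next
    case False
    then have "mvars p \<subseteq> V" using insert.prems by blast
    then show ?thesis using prime_constant[of y V p] insert by blast
  qed
qed

section \<open>Equality of rational maps and reduced representatives\<close>

lemma same_rational_map_refl: "rational_map k F \<Longrightarrow> same_rational_map k F F"
  by (simp add: same_rational_map_def mult.commute)

lemma same_rational_map_nz:
  assumes "same_rational_map k F G" "i \<le> k"
  shows "F i = 0 \<longleftrightarrow> G i = 0"
proof -
  obtain a b where a: "a \<le> k" "F a \<noteq> 0" and b: "b \<le> k" "G b \<noteq> 0"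
    using assms by (auto simp: same_rational_map_def rational_map_def)
  have "F i * G a = F a * G i" "F i * G b = F b * G i"
    using assms a b by (auto simp: same_rational_map_def)
  then show ?thesis using a b by auto
qed

lemma same_rational_map_trans:
  assumes FG: "same_rational_map k F G" and GH: "same_rational_map k G H"
  shows "same_rational_map k F H"
proof -
  obtain a where a: "a \<le> k" "G a \<noteq> 0"
    using FG by (auto simp: same_rational_map_def rational_map_def)
  have "F i * H j = F j * H i" if "i \<le> k" "j \<le> k" for i j
  proof -
    have "F i * G a = F a * G i" "F j * G a = F a * G j" "G a * H j = G j * H a" "G a * H i = G i * H a"
      using FG GH a that unfolding same_rational_map_def by blast+
    then have "(F i * G a) * (G a * H j) = (F j * G a) * (G a * H i)" by (simp add: ac_simps)
    then have "(G a * G a) * (F i * H j) = (G a * G a) * (F j * H i)" by (simp add: ac_simps)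
    then show ?thesis using a by simp
  qed
  then show ?thesis using FG GH by (simp add: same_rational_map_def)
qed

lemma same_rational_map_sym: "same_rational_map k F G \<Longrightarrow> same_rational_map k G F"
  unfolding same_rational_map_def by (metis mult.commute)

text \<open>Cancelling the prime factors of \<open>u\<close>, none of which can divide all \<open>G i\<close>.\<close>

lemma reduced_divides:
  assumes "no_common_factor k G" "\<forall>i\<le>k. mvars (G i) \<subseteq> {..k}" "\<forall>i\<le>k. u * H i = w * G i"
    "u \<noteq> 0" "mvars u \<subseteq> {..k}" "mvars w \<subseteq> {..k}"
  shows "u dvd w"
  using assms(3-)
proof (induction "tdeg u" arbitrary: u w rule: less_induct)
  case less
  show ?case
  proof (cases "u dvd 1 \<or> w = 0")
    case True
    then show ?thesis by (metis dvd_0_right dvd_trans one_dvd)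
  next
    case False
    then obtain p where p: "irreducible p" "p dvd u"
      using irreducible_factor_exists less.prems by blast
    obtain u' where u': "u = p * u'" using p(2) by blast
    have nz: "p \<noteq> 0" "u' \<noteq> 0" using u' less.prems by auto
    have td: "tdeg u' < tdeg u" using tdeg_mult[OF nz] u' p(1) mpol_unit_iff[of p] nz
      by (auto simp: irreducible_def)
    have pV: "mvars p \<subseteq> {..k}" "mvars u' \<subseteq> {..k}"
      using mvars_mult[OF nz] u' less.prems by auto
    have pr: "prime_in {..k} p" using irreducible_imp_prime_in[OF _ pV(1) p(1)] by simp
    have "p dvd w"
    proof (rule ccontr)
      assume n: "\<not> p dvd w"
      have "p dvd G i" if "i \<le> k" for i
      proof -
        have "p dvd w * G i" using less.prems(1) that u' by (metis dvd_triv_left mult.assoc)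
        then show ?thesis using pr n assms(2) less.prems(4) that unfolding prime_in_def by blast
      qed
      then have "p dvd 1" using assms(1) by (simp add: no_common_factor_def)
      then show False using p(1) by (simp add: irreducible_def)
    qed
    then obtain w' where w': "w = p * w'" by blast
    have w'V: "mvars w' \<subseteq> {..k}" using w' False less.prems mvars_mult[of p w'] by auto
    have "\<forall>i\<le>k. u' * H i = w' * G i"
    proof (intro allI impI)
      fix i assume "i \<le> k"
      then have "p * (u' * H i) = p * (w' * G i)" using less.prems(1) u' w' by (simp add: ac_simps)
      then show "u' * H i = w' * G i" using nz by simp
    qed
    then have "u' dvd w'" using less.hyps[OF td _ nz(2) pV(2) w'V] by blast
    then show ?thesis using u' w' by simp
  qed
qed

text \<open>The cross-multiplied equations fall under \<open>reduced_divides\<close> with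
  \<open>u = G a\<close> and \<open>w = H a\<close>, so a nonzero coordinate of \<open>G\<close>
  divides that of \<open>H\<close>.\<close>

lemma reduced_degree_minimal:
  assumes GH: "same_rational_map k G H" and red: "no_common_factor k G"
    and d: "\<forall>i\<le>k. homogeneous d (G i)" and e: "\<forall>i\<le>k. homogeneous e (H i)"
  shows "d \<le> e"
proof -
  obtain a where a: "a \<le> k" "G a \<noteq> 0"
    using GH by (auto simp: same_rational_map_def rational_map_def)
  have V: "\<forall>i\<le>k. mvars (G i) \<subseteq> {..k}" "\<forall>i\<le>k. mvars (H i) \<subseteq> {..k}"
    using GH by (auto simp: same_rational_map_def rational_map_def)
  have Ha: "H a \<noteq> 0" using same_rational_map_nz[OF GH a(1)] a by simp
  have "\<forall>i\<le>k. G a * H i = H a * G i"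
    using GH a unfolding same_rational_map_def by (metis mult.commute)
  then have "G a dvd H a" using reduced_divides[OF red V(1)] a V by blast
  then obtain w where w: "H a = G a * w" by blast
  then have "tdeg (H a) = tdeg (G a) + tdeg w" using Ha by (auto intro: tdeg_mult)
  then show ?thesis using homogeneous_tdeg[of d "G a"] homogeneous_tdeg[of e "H a"] a Ha d e by simp
qed

text \<open>A representative of least degree works: a common factor is itself homogeneous, so
  dividing by it gives another representative, of smaller degree unless the factor is a
  unit.\<close>

lemma reduced_representative_exists:
  assumes F: "rational_map k F"
  shows "\<exists>d G. same_rational_map k F G \<and> no_common_factor k G \<and> (\<forall>i\<le>k. homogeneous d (G i))"
proof -
  define P where "P d \<longleftrightarrow> (\<exists>G. same_rational_map k F G \<and> (\<forall>i\<le>k. homogeneous d (G i)))" for d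
  have "\<exists>d. P d" using F same_rational_map_refl[OF F] by (auto simp: P_def rational_map_def)
  then obtain d where d: "P d" and dmin: "\<And>e. P e \<Longrightarrow> d \<le> e"
    by (metis LeastI_ex Least_le)
  obtain G where G: "same_rational_map k F G" "\<forall>i\<le>k. homogeneous d (G i)" using d by (auto simp: P_def)
  have "h dvd 1" if h: "\<forall>i\<le>k. h dvd G i" for h
  proof -
    define K where "K i = (SOME z. G i = h * z)" for i
    have K: "G i = h * K i" if "i \<le> k" for i
      unfolding K_def by (rule someI_ex) (use h that in blast)
    obtain a where a: "a \<le> k" "G a \<noteq> 0"
      using G by (auto simp: same_rational_map_def rational_map_def)
    have h0: "h \<noteq> 0" using a K by auto
    obtain n where n: "homogeneous n h"
      using homogeneous_factor[of d h "K a"] K[OF a(1)] a G(2) by metis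
    have Kh: "homogeneous (d - n) (K i)" if i: "i \<le> k" for i
    proof (cases "K i = 0")
      case False
      then obtain m where m: "homogeneous m (K i)"
        using homogeneous_factor[of d "K i" h] K[OF i] G(2) i by (metis mult.commute mult_eq_0_iff h0)
      have "d = n + m"
        using tdeg_mult[OF h0 False] homogeneous_tdeg[OF n h0] homogeneous_tdeg[OF m False]
          homogeneous_tdeg[of d "G i"] K[OF i] G(2) i h0 False by (metis mult_eq_0_iff)
      then show ?thesis using m by simp
    qed simp
    have nd: "n \<le> d"
      using tdeg_mult[of h "K a"] homogeneous_tdeg[OF n h0] homogeneous_tdeg[of d "G a"] K[OF a(1)] a G(2) h0
      by (cases "K a = 0") auto
    have "same_rational_map k F K"
    proof -
      have KV: "mvars (K i) \<subseteq> {..k}" if "i \<le> k" for i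
      proof (cases "K i = 0")
        case False
        have "mvars (G i) \<subseteq> {..k}" using G(1) that by (auto simp: same_rational_map_def rational_map_def)
        then show ?thesis using K[OF that] mvars_mult[OF h0 False] by simp
      qed simp
      have "K a \<noteq> 0" using a K by auto
      then have "rational_map k K"
        unfolding rational_map_def using Kh KV a by blast
      moreover have "F i * K j = F j * K i" if ij: "i \<le> k" "j \<le> k" for i j
      proof -
        have "F i * G j = F j * G i" using G(1) ij by (simp add: same_rational_map_def)
        then have "h * (F i * K j) = h * (F j * K i)" using K ij by (simp add: ac_simps)
        then show ?thesis using h0 by simp
      qed
      ultimately show ?thesis using F by (simp add: same_rational_map_def)
    qed
    then have "d \<le> d - n" using dmin Kh by (auto simp: P_def)
    then have "tdeg h = 0" using nd homogeneous_tdeg[OF n h0] by simp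
    then show ?thesis using h0 mpol_unit_iff by blast
  qed
  then show ?thesis using G by (auto simp: no_common_factor_def)
qed

text \<open>Minimality makes the degree of a reduced representative unique, so the definite
  description in \<open>map_degree\<close> denotes it. Later arguments use only these two
  properties.\<close>

lemma map_degree_exists:
  assumes F: "rational_map k F"
  shows "\<exists>G. same_rational_map k F G \<and> (\<forall>i\<le>k. homogeneous (map_degree k F) (G i))"
    and map_degree_le: "same_rational_map k F H \<Longrightarrow> \<forall>i\<le>k. homogeneous e (H i) \<Longrightarrow> map_degree k F \<le> e"
proof -
  obtain d G where G: "same_rational_map k F G" "no_common_factor k G" "\<forall>i\<le>k. homogeneous d (G i)"
    using reduced_representative_exists[OF F] by blast
  have min: "d' \<le> e" if "same_rational_map k F G'" "no_common_factor k G'" "\<forall>i\<le>k. homogeneous d' (G' i)"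
    "same_rational_map k F H" "\<forall>i\<le>k. homogeneous e (H i)" for d' e G' H
    using reduced_degree_minimal[of k G' H d' e] that same_rational_map_trans same_rational_map_sym by blast
  have "map_degree k F = d"
    unfolding map_degree_def
  proof (rule the_equality)
    fix d' assume "\<exists>G. same_rational_map k F G \<and> no_common_factor k G \<and> (\<forall>i\<le>k. homogeneous d' (G i))"
    then show "d' = d" using min G by (meson order_antisym)
  qed (use G in blast)
  then show "\<exists>G. same_rational_map k F G \<and> (\<forall>i\<le>k. homogeneous (map_degree k F) (G i))"
    "same_rational_map k F H \<Longrightarrow> \<forall>i\<le>k. homogeneous e (H i) \<Longrightarrow> map_degree k F \<le> e"
    using G min by blast+
qed

section \<open>The growth rates\<close>

lemma largest_root_gt:
  assumes "a < b" "poly p a < 0" "poly p b > 0"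
  shows "poly p (largest_root p) = 0" "largest_root p > a"
proof -
  obtain x where x: "x > a" "poly p x = 0" using poly_IVT_pos[OF assms] by blast
  have "p \<noteq> 0" using assms(2) by auto
  then have fin: "finite {x. poly p x = 0}" by (rule poly_roots_finite)
  then have "largest_root p \<in> {x. poly p x = 0}"
    unfolding largest_root_def using x by (intro Max_in) auto
  then show "poly p (largest_root p) = 0" by simp
  have "x \<le> largest_root p" unfolding largest_root_def using fin x by (intro Max_ge) auto
  then show "largest_root p > a" using x by simp
qed

lemma Delta_plus:
  assumes k: "k \<ge> 3"
  shows "Delta_plus k > 3 / 2" "Delta_plus k ^ k = (\<Sum>i<k. Delta_plus k ^ i)"
proof -
  let ?p = "monom 1 k - (\<Sum>i<k. monom 1 i) :: real poly"
  have ev: "poly ?p x = x ^ k - (\<Sum>i<k. x ^ i)" for x by (simp add: poly_monom poly_sum)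
  define y where "y = (3 / 2 :: real) ^ k"
  \<comment> \<open>The value of the polynomial at 3 / 2 is \<open>2 - y\<close>, and 27 / 8 exceeds
    2. The bound 3 / 2 keeps the root away from 1, which the limit needs.\<close>
  have "(3 / 2 :: real) ^ 3 \<le> y" unfolding y_def by (rule power_increasing) (use k in auto)
  then have "y > 2" by (simp add: power3_eq_cube)
  moreover have "(\<Sum>i<k. (3 / 2 :: real) ^ i) = 2 * (y - 1)"
    unfolding y_def by (subst sum_gp_strict) (simp del: power_divide)
  ultimately have "poly ?p (3 / 2) < 0" unfolding ev y_def[symmetric] by simp
  moreover have "poly ?p 2 > 0" unfolding ev by (simp add: sum_gp_strict)
  ultimately have "poly ?p (Delta_plus k) = 0" "Delta_plus k > 3 / 2"
    using largest_root_gt[of "3 / 2" 2 ?p] unfolding Delta_plus_def by simp_all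
  then show "Delta_plus k > 3 / 2" "Delta_plus k ^ k = (\<Sum>i<k. Delta_plus k ^ i)"
    unfolding ev by simp_all
qed

lemma Delta_minus:
  assumes k: "k \<ge> 3"
  shows "Delta_minus k > 1" "Delta_minus k ^ k = Delta_minus k ^ (k - 1) + 1"
proof -
  let ?p = "monom 1 k - monom 1 (k - 1) - 1 :: real poly"
  have ev: "poly ?p x = x ^ k - x ^ (k - 1) - 1" for x by (simp add: poly_monom)
  have "poly ?p 1 < 0" unfolding ev by simp
  moreover have "poly ?p 2 > 0"
  proof -
    have "(2 :: real) ^ 1 \<le> 2 ^ (k - 1)" by (rule power_increasing) (use k in auto)
    moreover have "(2 :: real) ^ k = 2 * 2 ^ (k - 1)" using k by (cases k) auto
    ultimately show ?thesis unfolding ev by simp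
  qed
  ultimately have "poly ?p (Delta_minus k) = 0" "Delta_minus k > 1"
    using largest_root_gt[of 1 2 ?p] unfolding Delta_minus_def by simp_all
  then show "Delta_minus k > 1" "Delta_minus k ^ k = Delta_minus k ^ (k - 1) + 1"
    unfolding ev by simp_all
qed

text \<open>Multiplying the equation of the root x by x - 1 gives (2 - x) x^k = 1, so the distance
  to 2 is at most (2 / 3)^k.\<close>

lemma Delta_plus_tendsto: "Delta_plus \<longlonglongrightarrow> 2"
proof (rule tendsto_sandwich)
  have *: "2 - (2 / 3) ^ k \<le> Delta_plus k \<and> Delta_plus k \<le> 2" if k: "k \<ge> 3" for k
  proof -
    let ?x = "Delta_plus k"
    note x = Delta_plus[OF k]
    have "?x ^ k * (?x - 1) = ?x ^ k - 1"
      using x(1) by (subst x(2)) (simp add: sum_gp_strict field_simps)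
    then have eq: "(2 - ?x) * ?x ^ k = 1" by (simp add: algebra_simps)
    have pos: "?x ^ k > 0" using x(1) by simp
    have "2 - ?x = 1 / ?x ^ k" using eq pos by (metis less_irrefl nonzero_eq_divide_eq)
    then have "2 - ?x = (1 / ?x) ^ k" by (simp add: power_one_over)
    moreover have "(1 / ?x) ^ k \<le> (2 / 3) ^ k"
      using x(1) by (intro power_mono) (auto simp: field_simps)
    moreover have "(1 / ?x) ^ k \<ge> 0" using x(1) by simp
    ultimately show ?thesis by linarith
  qed
  show "\<forall>\<^sub>F k in sequentially. 2 - (2 / 3) ^ k \<le> Delta_plus k"
    "\<forall>\<^sub>F k in sequentially. Delta_plus k \<le> 2"
    using * by (auto intro!: eventually_sequentiallyI[of 3])
  show "(\<lambda>k. 2 - (2 / 3 :: real) ^ k) \<longlonglongrightarrow> 2"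
    using tendsto_diff[OF tendsto_const LIMSEQ_realpow_zero[of "2 / 3 :: real"]] by simp
qed simp

text \<open>With y = x - 1 the equation of the root x reads y (1 + y)^(k - 1) = 1, and Bernoulli's
  inequality gives (k - 1) y^2 \<le> 1.\<close>

lemma Delta_minus_tendsto: "Delta_minus \<longlonglongrightarrow> 1"
proof (rule tendsto_sandwich)
  have *: "Delta_minus k \<le> 1 + 1 / sqrt (real (k - 1))" if k: "k \<ge> 3" for k
  proof -
    let ?x = "Delta_minus k"
    note x = Delta_minus[OF k]
    let ?y = "?x - 1"
    have y: "?y > 0" using x by simp
    have "?x ^ k = ?x * ?x ^ (k - 1)" using k by (cases k) auto
    then have eq: "?y * ?x ^ (k - 1) = 1" using x(2) by (simp add: algebra_simps)
    have "1 + real (k - 1) * ?y \<le> (1 + ?y) ^ (k - 1)"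
      using y by (intro Bernoulli_inequality) auto
    then have "real (k - 1) * ?y \<le> ?x ^ (k - 1)" by simp
    then have "?y * (real (k - 1) * ?y) \<le> 1" using y eq by (metis mult_left_mono less_imp_le)
    then have "?y ^ 2 \<le> 1 / real (k - 1)" using k by (simp add: field_simps power2_eq_square)
    then have "?y \<le> sqrt (1 / real (k - 1))" by (rule real_le_rsqrt)
    then show ?thesis by (simp add: real_sqrt_divide)
  qed
  show "\<forall>\<^sub>F k in sequentially. Delta_minus k \<le> 1 + 1 / sqrt (real (k - 1))"
    "\<forall>\<^sub>F k in sequentially. 1 \<le> Delta_minus k"
    using * less_imp_le[OF Delta_minus(1)] by (intro eventually_sequentiallyI[of 3]; blast)+
  show "(\<lambda>k. 1 + 1 / sqrt (real (k - 1))) \<longlonglongrightarrow> 1"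
    by real_asymp
qed simp

text \<open>Constant factors disappear under n-th roots.\<close>

lemma root_tendsto_growth_rate:
  fixes d :: "nat \<Rightarrow> nat"
  assumes l: "l \<ge> 0" and c: "c > 0" "C > 0"
    and lo: "\<And>n. n \<ge> N \<Longrightarrow> c * l ^ n \<le> real (d n)" and hi: "\<And>n. n \<ge> N \<Longrightarrow> real (d n) \<le> C * l ^ n"
  shows "(\<lambda>n. root n (real (d n))) \<longlonglongrightarrow> l"
proof -
  have lim: "(\<lambda>n. root n (b * l ^ n)) \<longlonglongrightarrow> l" if "b > 0" for b
  proof -
    have "(\<lambda>n. root n b * l) \<longlonglongrightarrow> 1 * l"
      using that by (intro tendsto_mult LIMSEQ_root_const tendsto_const)
    moreover have "\<forall>\<^sub>F n in sequentially. root n b * l = root n (b * l ^ n)"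
      using l by (intro eventually_sequentiallyI[of 1]) (simp add: real_root_mult real_root_power_cancel)
    ultimately show ?thesis by (simp add: tendsto_cong)
  qed
  show ?thesis
  proof (rule tendsto_sandwich[OF _ _ lim[OF c(1)] lim[OF c(2)]])
    show "\<forall>\<^sub>F n in sequentially. root n (c * l ^ n) \<le> root n (real (d n))"
      "\<forall>\<^sub>F n in sequentially. root n (real (d n)) \<le> root n (C * l ^ n)"
      using lo hi by (auto intro!: eventually_sequentiallyI[of "max 1 N"])
  qed
qed

text \<open>The degrees of the last \<open>k\<close> terms of the forward recurrence, oldest first.\<close>

primrec fdeg :: "nat \<Rightarrow> nat \<Rightarrow> nat \<Rightarrow> nat" where
  "fdeg k 0 i = 1"
| "fdeg k (Suc n) i = (if Suc i < k then fdeg k n (Suc i) else \<Sum>j<k. fdeg k n j)"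

text \<open>The degrees of the last \<open>k\<close> terms of the backward recurrence, newest first.\<close>

primrec bdeg :: "nat \<Rightarrow> nat \<Rightarrow> nat \<Rightarrow> nat" where
  "bdeg k 0 i = 1"
| "bdeg k (Suc n) i = (case i of 0 \<Rightarrow> bdeg k n 0 + bdeg k n (k - 1) | Suc j \<Rightarrow> bdeg k n j)"

text \<open>The powers of \<open>l\<close> solve the same recurrence, whose coefficients are
  nonnegative, so a comparison up to the factor \<open>l ^ k\<close> on the starting window
  persists. Position \<open>i\<close> at step \<open>n\<close> is the term of index
  \<open>n + i\<close>.\<close>

lemma fdeg_bounds:
  fixes l :: real
  assumes l: "l \<ge> 1" "l ^ k = (\<Sum>i<k. l ^ i)" and i: "i < k"
  shows "real (fdeg k n i) \<le> l ^ (n + i) \<and> l ^ (n + i) \<le> l ^ k * real (fdeg k n i)"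
  using i
proof (induction n arbitrary: i)
  case 0
  have "l ^ i \<le> l ^ k" by (rule power_increasing) (use l 0 in auto)
  then show ?case using l(1) by simp
next
  case (Suc n)
  show ?case
  proof (cases "Suc i < k")
    case True
    then show ?thesis using Suc.IH[of "Suc i"] by simp
  next
    case False
    then have k: "k = Suc i" using Suc.prems by simp
    have "l ^ (Suc n + i) = l ^ n * l ^ k" by (simp add: k power_add)
    also have "\<dots> = (\<Sum>j<k. l ^ (n + j))" by (subst l(2)) (simp add: sum_distrib_left power_add)
    finally have eq: "l ^ (Suc n + i) = (\<Sum>j<k. l ^ (n + j))" .
    have "(\<Sum>j<k. real (fdeg k n j)) \<le> (\<Sum>j<k. l ^ (n + j))"
      using Suc.IH by (intro sum_mono) auto
    moreover have "(\<Sum>j<k. l ^ (n + j)) \<le> (\<Sum>j<k. l ^ k * real (fdeg k n j))"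
      using Suc.IH by (intro sum_mono) auto
    ultimately show ?thesis unfolding eq using False by (simp add: sum_distrib_left)
  qed
qed

lemma bdeg_bounds:
  fixes l :: real
  assumes l: "l \<ge> 1" "l ^ k = l ^ (k - 1) + 1" and i: "i < k"
  shows "real (bdeg k n i) \<le> l ^ (n + (k - 1 - i)) \<and> l ^ (n + (k - 1 - i)) \<le> l ^ k * real (bdeg k n i)"
  using i
proof (induction n arbitrary: i)
  case 0
  have "l ^ (k - 1 - i) \<le> l ^ k" by (rule power_increasing) (use l 0 in auto)
  then show ?case using l(1) by simp
next
  case (Suc n)
  show ?case
  proof (cases i)
    case (Suc j)
    then have "Suc n + (k - 1 - i) = n + (k - 1 - j)" using Suc.prems by simp
    then show ?thesis using Suc.IH[of j] Suc Suc.prems by simp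
  next
    case 0
    \<comment> \<open>With the newest term first, position \<open>k - 1\<close> carries the exponent
      \<open>n\<close>; the recurrence is the equation for \<open>l ^ k\<close> times
      \<open>l ^ n\<close>.\<close>
    have "l ^ (Suc n + (k - 1)) = l ^ n * l ^ k" using Suc.prems by (simp flip: power_add)
    also have "\<dots> = l ^ (n + (k - 1)) + l ^ n" by (subst l(2)) (simp add: algebra_simps power_add)
    finally have eq: "l ^ (Suc n + (k - 1)) = l ^ (n + (k - 1)) + l ^ n" .
    show ?thesis using Suc.IH[of 0] Suc.IH[of "k - 1"] Suc.prems 0 eq
      by (simp add: algebra_simps)
  qed
qed

section \<open>Generic parameters\<close>

definition polyfun :: "nat \<Rightarrow> ((nat \<Rightarrow> complex) \<Rightarrow> complex) \<Rightarrow> bool" where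
  "polyfun N \<phi> \<longleftrightarrow> (\<exists>p. mvars p \<subseteq> {..<N} \<and> \<phi> = (\<lambda>x. meval x p))"

lemma polyfun_const: "polyfun N (\<lambda>x. c)"
  unfolding polyfun_def by (intro exI[of _ "mconst c"]) (simp add: meval_eq_mev)

lemma polyfun_var: "i < N \<Longrightarrow> polyfun N (\<lambda>x. x i)"
  unfolding polyfun_def by (intro exI[of _ "mvar i"]) (simp add: meval_eq_mev)

lemma polyfun_add:
  assumes "polyfun N f" "polyfun N g"
  shows "polyfun N (\<lambda>x. f x + g x)"
proof -
  obtain p q where "mvars p \<subseteq> {..<N}" "f = (\<lambda>x. meval x p)" "mvars q \<subseteq> {..<N}" "g = (\<lambda>x. meval x q)"
    using assms unfolding polyfun_def by blast
  then show ?thesis unfolding polyfun_def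
    by (intro exI[of _ "p + q"]) (simp add: meval_eq_mev mev_add mvars_addI)
qed

lemma polyfun_mult:
  assumes "polyfun N f" "polyfun N g"
  shows "polyfun N (\<lambda>x. f x * g x)"
proof -
  obtain p q where "mvars p \<subseteq> {..<N}" "f = (\<lambda>x. meval x p)" "mvars q \<subseteq> {..<N}" "g = (\<lambda>x. meval x q)"
    using assms unfolding polyfun_def by blast
  then show ?thesis unfolding polyfun_def
    by (intro exI[of _ "p * q"]) (simp add: meval_eq_mev mev_mult mvars_multI)
qed

lemma polyfun_diff: "polyfun N f \<Longrightarrow> polyfun N g \<Longrightarrow> polyfun N (\<lambda>x. f x - g x)"
  using polyfun_add[of N f "\<lambda>x. (- 1) * g x"] polyfun_mult[of N "\<lambda>x. - 1" g] polyfun_const[of N "- 1"]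
  by simp

lemma polyfun_sum: "(\<And>j. j \<in> A \<Longrightarrow> polyfun N (f j)) \<Longrightarrow> polyfun N (\<lambda>x. \<Sum>j\<in>A. f j x)"
  by (induction A rule: infinite_finite_induct) (simp_all add: polyfun_const polyfun_add)

lemma proper_subvariety_zeros:
  assumes f: "polyfun N f" and x: "f x \<noteq> 0"
  shows "proper_subvariety N {y \<in> affine_space N. f y = 0}"
proof -
  obtain p where p: "mvars p \<subseteq> {..<N}" "f = (\<lambda>x. meval x p)" using f unfolding polyfun_def by blast
  let ?x = "restrict x {..<N}"
  have "f ?x = f x" unfolding p(2) meval_eq_mev using p(1) by (intro mev_cong) auto
  moreover have "?x \<in> affine_space N" by (simp add: affine_space_def)
  ultimately have "{y \<in> affine_space N. f y = 0} \<noteq> affine_space N"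
    using x by (metis (mono_tags, lifting) mem_Collect_eq)
  then show ?thesis unfolding proper_subvariety_def using p
    by (intro conjI exI[of _ "{p}"]) auto
qed

text \<open>The index type is any countable type, so that families indexed by the iterates and
  single conditions can be joined in a sum type.\<close>

lemma for_generic_params_polyfun:
  assumes f: "\<And>n::'i::countable. polyfun (2 * k + 2) (f n)" "\<And>n. \<exists>x. f n x \<noteq> 0"
    and P: "\<And>\<alpha> \<beta>. (\<And>n. f n (param_point k \<alpha> \<beta>) \<noteq> 0) \<Longrightarrow> P \<alpha> \<beta>"
  shows "for_generic_params k P"
  unfolding for_generic_params_def
proof (intro exI conjI allI impI ballI)
  let ?V = "\<lambda>n. {y \<in> affine_space (2 * k + 2). f n y = 0}"
  show "countable (range ?V)" by simp
  show "proper_subvariety (2 * k + 2) V" if "V \<in> range ?V" for V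
    using that f proper_subvariety_zeros by blast
  fix \<alpha> \<beta> assume n: "param_point k \<alpha> \<beta> \<notin> \<Union> (range ?V)"
  have "param_point k \<alpha> \<beta> \<in> affine_space (2 * k + 2)"
    by (simp add: affine_space_def param_point_def)
  then show "P \<alpha> \<beta>" using n by (intro P) blast
qed

text \<open>Gaussian elimination: the pivot stays invertible near \<open>x\<^sub>0\<close>.\<close>

lemma generic_independence:
  fixes w :: "nat \<Rightarrow> (nat \<Rightarrow> complex) \<Rightarrow> nat \<Rightarrow> complex"
  assumes "\<And>j r. j < K \<Longrightarrow> polyfun N (\<lambda>x. w j x r)"
    and "\<And>c. (\<And>r. (\<Sum>j<K. c j * w j x0 r) = 0) \<Longrightarrow> \<forall>j<K. c j = 0"
  shows "\<exists>\<phi>. polyfun N \<phi> \<and> \<phi> x0 \<noteq> 0 \<and>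
    (\<forall>x. \<phi> x \<noteq> 0 \<longrightarrow> (\<forall>c. (\<forall>r. (\<Sum>j<K. c j * w j x r) = 0) \<longrightarrow> (\<forall>j<K. c j = 0)))"
  using assms
proof (induction K arbitrary: w)
  case 0
  show ?case by (intro exI[of _ "\<lambda>_. 1"]) (simp add: polyfun_const)
next
  case (Suc K)
  have "\<exists>r. w K x0 r \<noteq> 0"
  proof (rule ccontr)
    assume "\<not> (\<exists>r. w K x0 r \<noteq> 0)"
    then have "\<forall>j<Suc K. (if j = K then 1 else 0 :: complex) = 0"
      by (intro Suc.prems(2)) (simp add: if_distrib[of "\<lambda>a. a * _"])
    then show False by auto
  qed
  then obtain r0 where r0: "w K x0 r0 \<noteq> 0" by blast
  \<comment> \<open>Elimination in fraction-free form, so that entries remain polynomial in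
    \<open>x\<close>; the entries at \<open>r0\<close> become zero.\<close>
  define w' where "w' j x r = w K x r0 * w j x r - w j x r0 * w K x r" for j x r
  have sum': "(\<Sum>j<K. c j * w' j x r)
      = w K x r0 * (\<Sum>j<K. c j * w j x r) - (\<Sum>j<K. c j * w j x r0) * w K x r" for c x r
    unfolding w'_def by (simp add: algebra_simps sum_distrib_left sum_distrib_right sum_subtractf)
  have "\<exists>\<phi>. polyfun N \<phi> \<and> \<phi> x0 \<noteq> 0 \<and>
    (\<forall>x. \<phi> x \<noteq> 0 \<longrightarrow> (\<forall>c. (\<forall>r. (\<Sum>j<K. c j * w' j x r) = 0) \<longrightarrow> (\<forall>j<K. c j = 0)))"
  proof (rule Suc.IH)
    show "polyfun N (\<lambda>x. w' j x r)" if "j < K" for j r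
      unfolding w'_def using that by (intro polyfun_diff polyfun_mult Suc.prems(1)) auto
    fix c assume c: "\<And>r. (\<Sum>j<K. c j * w' j x0 r) = 0"
    define d where "d j = (if j = K then - (\<Sum>j<K. c j * w j x0 r0) else w K x0 r0 * c j)" for j
    have "\<forall>j<Suc K. d j = 0"
    proof (rule Suc.prems(2))
      fix r
      have "(\<Sum>j<K. d j * w j x0 r) = w K x0 r0 * (\<Sum>j<K. c j * w j x0 r)"
        unfolding sum_distrib_left by (intro sum.cong) (auto simp: d_def)
      then show "(\<Sum>j<Suc K. d j * w j x0 r) = 0"
        using c[of r] unfolding sum' by (simp add: d_def)
    qed
    then show "\<forall>j<K. c j = 0" using r0 by (auto simp: d_def less_Suc_eq split: if_splits)
  qed
  then obtain \<phi> where \<phi>: "polyfun N \<phi>" "\<phi> x0 \<noteq> 0"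
    "\<And>x c. \<phi> x \<noteq> 0 \<Longrightarrow> (\<And>r. (\<Sum>j<K. c j * w' j x r) = 0) \<Longrightarrow> \<forall>j<K. c j = 0" by blast
  show ?case
  proof (intro exI[of _ "\<lambda>x. \<phi> x * w K x r0"] conjI allI impI)
    show "polyfun N (\<lambda>x. \<phi> x * w K x r0)" by (intro polyfun_mult \<phi> Suc.prems) simp
    show "\<phi> x0 * w K x0 r0 \<noteq> 0" using \<phi> r0 by simp
    fix x c j
    assume x: "\<phi> x * w K x r0 \<noteq> 0" and c: "\<forall>r. (\<Sum>j<Suc K. c j * w j x r) = 0" and j: "j < Suc K"
    have s: "(\<Sum>j<K. c j * w j x r) = - (c K * w K x r)" for r
      using c by (simp add: add_eq_0_iff2)
    have z: "\<forall>j<K. c j = 0" by (rule \<phi>(3)[of x]) (use x in \<open>simp_all add: sum' s\<close>)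
    have "c K * w K x r0 = 0" using s[of r0] z by simp
    then have "c K = 0" using x by simp
    then show "c j = 0" using z j by (auto simp: less_Suc_eq)
  qed
qed

section \<open>Relations with coefficients of bounded degree\<close>

definition small :: "nat \<Rightarrow> 'a::zero poly \<Rightarrow> bool" where
  "small D u \<longleftrightarrow> (\<forall>i\<ge>D. coeff u i = 0)"

text \<open>For \<open>Q \<noteq> 0\<close> this says that the rational function \<open>P / Q\<close> has degree at least \<open>D\<close>.\<close>

definition no_small_relation :: "nat \<Rightarrow> complex poly \<Rightarrow> complex poly \<Rightarrow> bool" where
  "no_small_relation D P Q \<longleftrightarrow> (\<forall>u v. small D u \<longrightarrow> small D v \<longrightarrow> u * Q = v * P \<longrightarrow> u = 0 \<and> v = 0)"

text \<open>A relation is a linear dependency among the 2 D polynomials t^j Q and - t^j P, with the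
  coefficients of u and v as unknowns; \<open>generic_independence\<close> spreads independence from
  \<open>x0\<close>.\<close>

lemma generic_no_small_relation:
  fixes P Q :: "(nat \<Rightarrow> complex) \<Rightarrow> complex poly"
  assumes P: "\<And>r. polyfun N (\<lambda>x. coeff (P x) r)" and Q: "\<And>r. polyfun N (\<lambda>x. coeff (Q x) r)"
    and x0: "no_small_relation D (P x0) (Q x0)"
  shows "\<exists>\<phi>. polyfun N \<phi> \<and> \<phi> x0 \<noteq> 0 \<and> (\<forall>x. \<phi> x \<noteq> 0 \<longrightarrow> no_small_relation D (P x) (Q x))"
proof -
  define w where "w j x r = (if j < D then coeff (monom 1 j * Q x) r else - coeff (monom 1 (j - D) * P x) r)"
    for j x r
  define up where "up c = (\<Sum>j<D. monom (c j) j)" for c :: "nat \<Rightarrow> complex"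
  have up_coeff: "coeff (up c) i = (if i < D then c i else 0)" for c i
    by (simp add: up_def coeff_sum)
  have sm: "small D (up c)" for c by (simp add: small_def up_coeff)
  have up_mult: "coeff (up c * R) r = (\<Sum>j<D. c j * coeff (monom 1 j * R) r)" for c R r
  proof -
    have "up c * R = (\<Sum>j<D. smult (c j) (monom 1 j * R))"
      by (simp add: up_def sum_distrib_right smult_monom flip: mult_smult_left)
    then show ?thesis by (simp add: coeff_sum)
  qed
  have sum_w: "(\<Sum>j<D + D. c j * w j x r) = coeff (up c * Q x - up (\<lambda>j. c (D + j)) * P x) r" for c x r
  proof -
    have "(\<Sum>j<D + D. c j * w j x r) = (\<Sum>j<D. c j * w j x r) + (\<Sum>j=D..<D + D. c j * w j x r)"
      unfolding lessThan_atLeast0 by (rule sum.atLeastLessThan_concat[symmetric]) auto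
    also have "(\<Sum>j=D..<D + D. c j * w j x r) = (\<Sum>j<D. c (D + j) * w (D + j) x r)"
      using sum.shift_bounds_nat_ivl[of "\<lambda>j. c j * w j x r" 0 D D] by (simp add: atLeast0LessThan add.commute)
    finally show ?thesis by (simp add: up_mult w_def sum_negf)
  qed
  have "\<exists>\<phi>. polyfun N \<phi> \<and> \<phi> x0 \<noteq> 0 \<and>
    (\<forall>x. \<phi> x \<noteq> 0 \<longrightarrow> (\<forall>c. (\<forall>r. (\<Sum>j<D + D. c j * w j x r) = 0) \<longrightarrow> (\<forall>j<D + D. c j = 0)))"
  proof (rule generic_independence)
    fix j r assume "j < D + D"
    have shift: "polyfun N (\<lambda>x. coeff (monom 1 i * R x) r)" if "\<And>r. polyfun N (\<lambda>x. coeff (R x) r)"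
      for R :: "(nat \<Rightarrow> complex) \<Rightarrow> complex poly" and i
      using that by (cases "r < i") (simp_all add: coeff_monom_mult polyfun_const)
    then show "polyfun N (\<lambda>x. w j x r)"
      using shift[OF Q, of j] polyfun_diff[OF polyfun_const[of N 0] shift[OF P, of "j - D"]] unfolding w_def
      by (cases "j < D") simp_all
  next
    fix c assume c: "\<And>r. (\<Sum>j<D + D. c j * w j x0 r) = 0"
    then have "up c * Q x0 - up (\<lambda>j. c (D + j)) * P x0 = 0" unfolding sum_w by (intro poly_eqI) simp
    then have z: "up c = 0" "up (\<lambda>j. c (D + j)) = 0"
      using x0 sm unfolding no_small_relation_def by auto
    show "\<forall>j<D + D. c j = 0"
    proof (intro allI impI)
      fix j assume j: "j < D + D"
      show "c j = 0"
      proof (cases "j < D")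
        case True
        then show ?thesis using up_coeff[of c j] z(1) by simp
      next
        case False
        then obtain i where i: "j = D + i" by (metis le_Suc_ex not_less)
        then show ?thesis using up_coeff[of "\<lambda>j. c (D + j)" i] z(2) j by simp
      qed
    qed
  qed
  then obtain \<phi> where \<phi>: "polyfun N \<phi>" "\<phi> x0 \<noteq> 0"
    "\<And>x c. \<phi> x \<noteq> 0 \<Longrightarrow> (\<And>r. (\<Sum>j<D + D. c j * w j x r) = 0) \<Longrightarrow> \<forall>j<D + D. c j = 0" by blast
  have "no_small_relation D (P x) (Q x)" if x: "\<phi> x \<noteq> 0" for x
    unfolding no_small_relation_def
  proof (intro allI impI)
    fix u v assume uv: "small D u" "small D v" "u * Q x = v * P x"
    define c where "c j = (if j < D then coeff u j else coeff v (j - D))" for j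
    have "up c = u" "up (\<lambda>j. c (D + j)) = v"
      using uv by (auto intro!: poly_eqI simp: up_coeff c_def small_def)
    then have z: "\<forall>j<D + D. c j = 0" using uv by (intro \<phi>(3)[OF x]) (simp add: sum_w)
    have "coeff u i = 0" "coeff v i = 0" for i
      using uv(1,2) z[rule_format, of i] z[rule_format, of "D + i"] unfolding c_def small_def
      by (cases "i < D"; simp)+
    then show "u = 0 \<and> v = 0" by (simp add: poly_eq_iff)
  qed
  then show ?thesis using \<phi> by blast
qed

section \<open>A lower bound for the degree\<close>

text \<open>Choose the other variables so that the leading coefficient in \<open>y\<close> survives;
  a nonzero polynomial in \<open>y\<close> is left, and it has a point that is not a root.\<close>

lemma meval_nonzero_exists:
  assumes "p \<noteq> 0"
  shows "\<exists>x. meval x p \<noteq> 0"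
proof -
  have fin: "finite (mvars p)" for p by (simp add: mvars_def)
  show ?thesis
    using assms
  proof (induction "card (mvars p)" arbitrary: p rule: less_induct)
    case less
    show ?case
    proof (cases "mvars p = {}")
      case True
      then have "tpoly p = mev (\<lambda>c. [:mconst c:]) (\<lambda>i. [:mvar i:]) p"
        unfolding tpoly_def by (intro mev_cong) auto
      also have "\<dots> = [:p:]"
        using ring_hom_eq_mev[OF is_ring_hom_const_poly, of p] by simp
      finally have "tdeg p = 0" by (simp add: tdeg_def)
      then obtain c where "p = mconst c" using tdeg_0_imp_const by blast
      then show ?thesis using less.prems by (auto simp: meval_eq_mev)
    next
      case False
      then obtain y where y: "y \<in> mvars p" by blast
      let ?q = "lead_coeff (vpoly y p)"
      have qV: "mvars ?q \<subseteq> mvars p - {y}" by (rule mvars_coeff_vpoly)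
      then have "card (mvars ?q) < card (mvars p)" using y fin by (intro psubset_card_mono) auto
      then obtain x where x: "meval x ?q \<noteq> 0" using less by fastforce
      define h where "h = mev (\<lambda>c. [:c:]) (\<lambda>i. if i = y then [:0, 1:] else [:x i:]) p"
      have h_eval: "poly h t = meval (x(y := t)) p" for t
        unfolding h_def meval_eq_mev by (subst hom_mev[OF is_ring_hom_poly]) (auto intro!: mev_cong)
      have "map_poly (meval x) (vpoly y p) = h"
      proof -
        have hm: "is_ring_hom (meval x)" unfolding meval_eq_mev by simp
        have "is_ring_hom (map_poly (meval x))"
          by (rule is_ring_homI; intro poly_eqI)
            (simp_all add: coeff_map_poly is_ring_hom_simps[OF hm] coeff_mult)
        then have "map_poly (meval x) (vpoly y p) = mev (\<lambda>c. map_poly (meval x) [:mconst c:])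
            (\<lambda>i. map_poly (meval x) (if i = y then [:0, 1:] else [:mvar i:])) p"
          unfolding vpoly_def by (rule hom_mev) simp
        moreover have "map_poly (meval x) [:mconst c:] = [:c:]" for c
          by (simp add: map_poly_pCons is_ring_hom_0[OF hm] meval_eq_mev)
        moreover have "map_poly (meval x) (if i = y then [:0, 1:] else [:mvar i:])
            = (if i = y then [:0, 1:] else [:x i:])" for i
          by (simp add: map_poly_pCons is_ring_hom_simps[OF hm]) (simp add: meval_eq_mev)
        ultimately show ?thesis by (simp add: h_def)
      qed
      then have "coeff h (degree (vpoly y p)) = meval x ?q"
        by (metis coeff_map_poly meval_eq_mev mev_0)
      then have "h \<noteq> 0" using x by auto
      then obtain t where "poly h t \<noteq> 0" using poly_all_0_iff_0 by blast
      then show ?thesis using h_eval by auto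
    qed
  qed
qed

text \<open>The inner variable is the curve parameter t, the outer one the deformation parameter s.
  Coordinates at most linear in t give a form of degree at most \<open>d\<close> in t, at every
  power of s.\<close>

lemma degree_coeff_mev_homogeneous:
  fixes C :: "nat \<Rightarrow> complex poly poly"
  assumes C: "\<And>i j. degree (coeff (C i) j) \<le> 1" and h: "homogeneous d p"
  shows "degree (coeff (mev (\<lambda>a. [:[:a:]:]) C p) j) \<le> d"
proof -
  let ?W = "\<lambda>d (f :: complex poly poly). \<forall>j. degree (coeff f j) \<le> d"
  have mult: "?W (d + e) (f * g)" if "?W d f" "?W e g" for d e f g
    unfolding coeff_mult
    using that by (intro allI degree_sum_le) (auto intro: order_trans[OF degree_mult_le] add_mono)
  have pw: "?W n (C i ^ n)" for i n
  proof (induction n)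
    case 0
    then show ?case by (auto simp: coeff_pCons one_pCons split: nat.splits)
  next
    case (Suc n)
    then show ?case using mult[where d = 1 and e = n and f = "C i" and g = "C i ^ n"] C by simp
  qed
  have pr: "?W (sum f A) (\<Prod>i\<in>A. C i ^ f i)" if "finite A" for A and f :: "nat \<Rightarrow> nat"
    using that
  proof (induction A)
    case empty
    then show ?case by (auto simp: coeff_pCons one_pCons split: nat.splits)
  next
    case (insert i A)
    then show ?case using mult[where d = "f i" and e = "sum f A", OF pw insert.IH] by simp
  qed
  have "?W d ([:[:lkp p m:]:] * pmon C m)" if "m \<in> kys p" for m
    using mult[where d = 0 and e = d and f = "[:[:lkp p m:]:]" and g = "pmon C m"] pr[of "kys m" "lkp m"] h that
    by (auto simp: pmon_def homogeneous_def coeff_pCons split: nat.splits)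
  then have "?W d (mev (\<lambda>a. [:[:a:]:]) C p)"
    unfolding mev_def coeff_sum by (intro allI degree_sum_le) auto
  then show ?thesis by simp
qed

text \<open>The curve \<open>c\<close> may lie in the common zero set of \<open>G\<close> and \<open>G'\<close>; it is moved to
  \<open>c + s e\<close>, and the lowest coefficients with respect to \<open>s\<close> are compared.\<close>

lemma degree_lower_bound:
  fixes c :: "nat \<Rightarrow> complex poly"
  assumes h: "homogeneous d G" "homogeneous d G'" and G': "G' \<noteq> 0" and eq: "G * q = G' * p"
    and c: "\<And>i. degree (c i) \<le> 1"
    and no: "no_small_relation D (mev (\<lambda>a. [:a:]) c p) (mev (\<lambda>a. [:a:]) c q)"
  shows "D \<le> d"
proof (rule ccontr)
  assume "\<not> D \<le> d"
  then have dD: "d < D" by simp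
  obtain e where e: "meval e G' \<noteq> 0" using meval_nonzero_exists[OF G'] by blast
  \<comment> \<open>At s = 0 this is the given curve; at s = 1 and t = 0 it reaches
    \<open>e\<close>, where \<open>G'\<close> does not vanish, so \<open>ev G'\<close> is
    nonzero.\<close>
  define C where "C i = [:c i, [:e i - coeff (c i) 0:]:]" for i
  have k: "is_ring_hom (\<lambda>a. [:[:a:]:] :: complex poly poly)"
    by (rule is_ring_hom_comp) simp_all
  define ev where "ev = mev (\<lambda>a. [:[:a:]:]) C"
  have hom: "is_ring_hom ev" unfolding ev_def using k by simp
  have ev0: "coeff (ev f) 0 = mev (\<lambda>a. [:a:]) c f" for f
    unfolding ev_def poly_0_coeff_0[symmetric] by (subst hom_mev[OF is_ring_hom_poly k]) (simp add: C_def)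
  have deg: "degree (coeff (ev f) j) \<le> d" if "homogeneous d f" for f j
    unfolding ev_def using c by (intro degree_coeff_mev_homogeneous that) (auto simp: C_def coeff_pCons split: nat.splits)
  have "poly (poly (ev G') 1) 0 = meval e G'"
  proof -
    have "is_ring_hom (\<lambda>f :: complex poly poly. poly (poly f 1) 0)"
      by (rule is_ring_hom_comp) simp_all
    then show ?thesis unfolding ev_def meval_eq_mev
      by (subst hom_mev[OF _ k]) (auto simp: C_def poly_0_coeff_0)
  qed
  then have "ev G' \<noteq> 0" using e by auto
  then have ex: "\<exists>m. coeff (ev G) m \<noteq> 0 \<or> coeff (ev G') m \<noteq> 0" by (metis leading_coeff_0_iff)
  define m where "m = (LEAST m. coeff (ev G) m \<noteq> 0 \<or> coeff (ev G') m \<noteq> 0)"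
  have m: "coeff (ev G) m \<noteq> 0 \<or> coeff (ev G') m \<noteq> 0" unfolding m_def by (rule LeastI_ex[OF ex])
  have low: "coeff (ev G) i = 0" "coeff (ev G') i = 0" if "i < m" for i
    using not_less_Least[OF that[unfolded m_def]] by auto
  \<comment> \<open>In the lowest power of s the second factor enters only through s = 0, that is,
    through its restriction to the original curve.\<close>
  have single: "coeff (A * B) m = coeff A m * coeff B 0" if "\<And>i. i < m \<Longrightarrow> coeff A i = 0"
    for A B :: "complex poly poly"
  proof -
    have "coeff (A * B) m = (\<Sum>i\<le>m. if i = m then coeff A m * coeff B 0 else 0)"
      unfolding coeff_mult using that by (intro sum.cong) auto
    then show ?thesis by simp
  qed
  have "ev G * ev q = ev G' * ev p" using eq by (simp flip: is_ring_hom_mult[OF hom])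
  then have "coeff (ev G) m * mev (\<lambda>a. [:a:]) c q = coeff (ev G') m * mev (\<lambda>a. [:a:]) c p"
    using single[of "ev G" "ev q"] single[of "ev G'" "ev p"] low ev0 by simp
  moreover have "small D (coeff (ev G) m)" "small D (coeff (ev G') m)"
    unfolding small_def using deg[OF h(1), of m] deg[OF h(2), of m] dD by (auto intro!: coeff_eq_0)
  ultimately show False using no m unfolding no_small_relation_def by blast
qed

section \<open>Iterates of birational maps\<close>

lemma msubst_ring_hom: "is_ring_hom (msubst G)"
proof -
  have "msubst G = mev mconst G" by (rule ext) (rule msubst_eq_mev)
  then show ?thesis by simp
qed

lemmas msubst_simps = is_ring_hom_simps[OF msubst_ring_hom]

lemma msubst_mconst [simp]: "msubst G (mconst c) = mconst c"
  and msubst_mvar [simp]: "msubst G (mvar i) = G i"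
  by (simp_all add: msubst_eq_mev)

lemma msubst_msubst: "msubst Y (msubst G p) = msubst (map_comp G Y) p"
  using mev_msubst[of mconst Y G p] by (simp add: msubst_eq_mev map_comp_def)

lemma homogeneous_msubst:
  assumes p: "homogeneous d p" "mvars p \<subseteq> {..k}" and G: "\<And>i. i \<le> k \<Longrightarrow> homogeneous e (G i)"
  shows "homogeneous (d * e) (msubst G p)"
proof -
  have m: "monom g e = monom 1 e * [:g:]" for g :: mpol by (simp add: smult_monom)
  have pw: "monom (1::mpol) e ^ d = monom 1 (d * e)" by (simp add: monom_power mult.commute)
  have "tpoly (msubst G p) = mev (\<lambda>c. [:mconst c:]) (\<lambda>i. tpoly (G i)) p"
    unfolding msubst_eq_mev by (subst hom_mev[OF tpoly_ring_hom]) simp_all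
  also have "\<dots> = mev (\<lambda>c. [:mconst c:]) (\<lambda>i. monom 1 e * [:G i:]) p"
  proof (rule mev_cong)
    fix i assume "i \<in> mvars p"
    then have "tpoly (G i) = monom (G i) e" using G p(2) by (auto simp: homogeneous_iff_tpoly)
    then show "tpoly (G i) = monom 1 e * [:G i:]" by (simp only: m[symmetric])
  qed
  also have "\<dots> = monom 1 (d * e) * mev (\<lambda>c. [:mconst c:]) (\<lambda>i. [:G i:]) p"
    by (simp only: mev_homogeneous_scale[OF const_mconst_ring_hom p(1)] pw)
  also have "mev (\<lambda>c. [:mconst c:]) (\<lambda>i. [:G i:]) p = [:msubst G p:]"
    unfolding msubst_eq_mev by (subst hom_mev[OF is_ring_hom_const_poly]) simp_all
  finally show ?thesis unfolding homogeneous_iff_tpoly by (simp add: smult_monom)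
qed

lemma mvars_msubst:
  assumes "mvars p \<subseteq> {..k}" "\<And>i. i \<le> k \<Longrightarrow> mvars (G i) \<subseteq> V"
  shows "mvars (msubst G p) \<subseteq> V"
proof -
  have "\<And>i. i \<in> mvars p \<Longrightarrow> mvars (G i) \<subseteq> V" using assms by blast
  then have "msubst G p \<in> {q. mvars q \<subseteq> V}"
    unfolding msubst_eq_mev by (intro mev_closed) (simp_all add: mvars_addI mvars_multI)
  then show ?thesis by simp
qed

text \<open>No hypersurface contains the image. This property survives composition and keeps
  coordinates and linear forms of iterates nonzero.\<close>

definition dominant :: "nat \<Rightarrow> (nat \<Rightarrow> mpol) \<Rightarrow> bool" where
  "dominant k Y \<longleftrightarrow> (\<forall>d p. homogeneous d p \<longrightarrow> mvars p \<subseteq> {..k} \<longrightarrow> p \<noteq> 0 \<longrightarrow> msubst Y p \<noteq> 0)"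

lemma dominantD:
  "dominant k Y \<Longrightarrow> homogeneous d p \<Longrightarrow> mvars p \<subseteq> {..k} \<Longrightarrow> p \<noteq> 0 \<Longrightarrow> msubst Y p \<noteq> 0"
  unfolding dominant_def by blast

lemma mvar_nonzero [simp]: "mvar i \<noteq> 0"
  by (metis empty_not_insert mvars_0 mvars_mvar)

lemma inverse_map_sym: "inverse_map k F G \<Longrightarrow> inverse_map k G F"
  by (simp add: inverse_map_def)

text \<open>If \<open>p(G) = 0\<close> then \<open>p(G(F(x))) = 0\<close>, but \<open>G(F(x))\<close> is a multiple of \<open>x\<close>.\<close>

lemma inverse_map_dominant:
  assumes inv: "inverse_map k F G"
  shows "dominant k G"
  unfolding dominant_def
proof (intro allI impI notI)
  fix d p assume p: "homogeneous d p" "mvars p \<subseteq> {..k}" "p \<noteq> 0" and z: "msubst G p = 0"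
  define Z where "Z = map_comp G F"
  have Z: "same_rational_map k Z mvar" using inv by (simp add: inverse_map_def Z_def)
  then have Z0: "Z 0 \<noteq> 0" using same_rational_map_nz[of k Z mvar 0] by simp
  have "msubst Z p = 0" using z by (simp add: Z_def msubst_simps flip: msubst_msubst)
  then have "mvar 0 ^ d * mev mconst Z p = 0" by (simp add: msubst_eq_mev)
  then have "mev mconst (\<lambda>i. mvar 0 * Z i) p = 0"
    using mev_homogeneous_scale[OF mconst_ring_hom p(1)] by simp
  moreover have "mev mconst (\<lambda>i. mvar 0 * Z i) p = mev mconst (\<lambda>i. Z 0 * mvar i) p"
    using Z p(2) unfolding same_rational_map_def by (intro mev_cong) (auto simp: mult.commute)
  ultimately have "Z 0 ^ d * p = 0"
    using mev_homogeneous_scale[OF mconst_ring_hom p(1), of "Z 0" mvar] by simp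
  then show False using Z0 p by simp
qed

text \<open>Substituting \<open>F\<close> into a nonzero form gives a nonzero form again, to which
  dominance of the previous iterate applies.\<close>

lemma map_iterate_dominant:
  assumes inv: "inverse_map k F G"
  shows "rational_map k (map_iterate F n) \<and> dominant k (map_iterate F n)"
proof (induction n)
  case 0
  have "rational_map k mvar" unfolding rational_map_def using homogeneous_mvar
    by (intro conjI exI[of _ 1] exI[of _ 0]) auto
  then show ?case by (simp add: dominant_def msubst_eq_mev)
next
  case (Suc n)
  let ?Y = "map_iterate F n"
  obtain e where F: "\<And>i. i \<le> k \<Longrightarrow> mvars (F i) \<subseteq> {..k}" "\<And>i. i \<le> k \<Longrightarrow> homogeneous e (F i)"
    using inv by (auto simp: inverse_map_def rational_map_def)
  obtain d where Y: "\<And>i. i \<le> k \<Longrightarrow> mvars (?Y i) \<subseteq> {..k}" "\<And>i. i \<le> k \<Longrightarrow> homogeneous d (?Y i)"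
    using Suc by (auto simp: rational_map_def)
  have F_dom: "dominant k F" using inverse_map_dominant[OF inverse_map_sym[OF inv]] .
  have dom: "dominant k (map_comp F ?Y)"
    unfolding dominant_def
  proof (intro allI impI)
    fix c p assume p: "homogeneous c p" "mvars p \<subseteq> {..k}" "p \<noteq> 0"
    have "homogeneous (c * e) (msubst F p)" by (rule homogeneous_msubst[OF p(1,2) F(2)])
    moreover have "mvars (msubst F p) \<subseteq> {..k}" by (rule mvars_msubst[OF p(2) F(1)])
    moreover have "msubst F p \<noteq> 0" by (rule dominantD[OF F_dom p])
    ultimately show "msubst (map_comp F ?Y) p \<noteq> 0"
      unfolding msubst_msubst[symmetric] using Suc by (intro dominantD[of k ?Y]) auto
  qed
  have "homogeneous (e * d) (map_comp F ?Y i)" "mvars (map_comp F ?Y i) \<subseteq> {..k}" if "i \<le> k" for i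
    unfolding map_comp_def
    using homogeneous_msubst[OF F(2)[OF that] F(1)[OF that], where G = ?Y and e = d]
      mvars_msubst[OF F(1)[OF that], where G = ?Y and V = "{..k}"] Y
    by blast+
  moreover have "map_comp F ?Y 0 \<noteq> 0"
    using dominantD[OF dom homogeneous_mvar, of 0] by simp
  ultimately have "rational_map k (map_comp F ?Y)" unfolding rational_map_def by blast
  then show ?case using dom by simp
qed

lemma same_rational_mapI:
  assumes Y: "rational_map k Y" and H: "\<And>i. i \<le> k \<Longrightarrow> mvars (H i) \<subseteq> {..k}" "\<And>i. i \<le> k \<Longrightarrow> homogeneous d (H i)"
    and eq: "\<And>i. i \<le> k \<Longrightarrow> Y i * H 0 = Y 0 * H i" and nz: "H 0 \<noteq> 0" "Y 0 \<noteq> 0"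
  shows "same_rational_map k Y H"
proof -
  have "Y i * H j = Y j * H i" if "i \<le> k" "j \<le> k" for i j
  proof -
    have "(Y 0 * H 0) * (Y i * H j) = (Y i * H 0) * (Y 0 * H j)" by (simp add: ac_simps)
    also have "\<dots> = (Y 0 * H i) * (Y j * H 0)" using eq that by simp
    also have "\<dots> = (Y 0 * H 0) * (Y j * H i)" by (simp add: ac_simps)
    finally show ?thesis using nz by simp
  qed
  moreover have "rational_map k H" unfolding rational_map_def using H nz by blast
  ultimately show ?thesis using Y by (simp add: same_rational_map_def)
qed

text \<open>Restriction to the curve \<open>t \<mapsto> (t, \<dots>, t)\<close> in the chart \<open>x\<^sub>0 = 1\<close>.\<close>

definition test_eval :: "mpol \<Rightarrow> complex poly" where
  "test_eval = mev (\<lambda>a. [:a:]) (\<lambda>i. if i = 0 then 1 else [:0, 1:])"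

lemma test_eval_ring_hom [simp]: "is_ring_hom test_eval"
  by (simp add: test_eval_def)

lemma test_eval_mconst [simp]: "test_eval (mconst c) = [:c:]"
  and test_eval_mvar: "test_eval (mvar i) = (if i = 0 then 1 else [:0, 1:])"
  by (simp_all add: test_eval_def)

text \<open>Here p / q is an affine coordinate of \<open>Y\<close>. A representative of degree
  \<open>map_degree k Y\<close> turns it into a relation between \<open>p\<close> and
  \<open>q\<close> with coefficients of that degree, which is restricted to the test line.\<close>

lemma map_degree_ge:
  assumes Y: "rational_map k Y" "Y 0 \<noteq> 0" and i: "i \<le> k" and eq: "Y i * q = Y 0 * p"
    and no: "no_small_relation D (test_eval p) (test_eval q)"
  shows "D \<le> map_degree k Y"
proof -
  obtain G where G: "same_rational_map k Y G" "\<forall>i\<le>k. homogeneous (map_degree k Y) (G i)"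
    using map_degree_exists[OF Y(1)] by blast
  have G0: "G 0 \<noteq> 0" using same_rational_map_nz[OF G(1), of 0] Y by simp
  have "Y 0 * (G i * q) = (Y 0 * G i) * q" by (simp only: mult.assoc)
  also have "Y 0 * G i = Y i * G 0" using G(1) i unfolding same_rational_map_def by simp
  also have "Y i * G 0 * q = G 0 * (Y i * q)" by (simp add: ac_simps)
  also have "\<dots> = Y 0 * (G 0 * p)" unfolding eq by (simp add: ac_simps)
  finally have "G i * q = G 0 * p" using Y by simp
  then show ?thesis
    using G i G0 no unfolding test_eval_def
    by (intro degree_lower_bound[of "map_degree k Y" "G i" "G 0" q p]) auto
qed

section \<open>Linear fractional recurrences\<close>

definition lform :: "nat \<Rightarrow> (nat \<Rightarrow> 'r::comm_ring_1) \<Rightarrow> (nat \<Rightarrow> 'r) \<Rightarrow> 'r" where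
  "lform k a Y = a 0 * Y 0 + (\<Sum>i<k. a (Suc i) * Y (Suc i))"

lemma linear_form_eq: "linear_form k \<gamma> = lform k (\<lambda>i. mconst (\<gamma> i)) mvar"
  by (simp add: linear_form_def lform_def sum.atMost_shift)

lemma msubst_linear_form: "msubst Y (linear_form k \<gamma>) = lform k (\<lambda>i. mconst (\<gamma> i)) Y"
  by (simp add: linear_form_eq lform_def msubst_simps)

lemma homogeneous_linear_form: "homogeneous 1 (linear_form k \<gamma>)"
  unfolding linear_form_def
  using homogeneous_mult[OF homogeneous_mconst homogeneous_mvar]
  by (intro homogeneous_sum) simp

lemma mvars_linear_form: "mvars (linear_form k \<gamma>) \<subseteq> {..k}"
  unfolding linear_form_def by (intro mvars_sumI mvars_multI) auto

lemma linear_form_nonzero: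
  assumes "i \<le> k" "\<gamma> i \<noteq> 0"
  shows "linear_form k \<gamma> \<noteq> 0"
proof
  let ?e = "\<lambda>j. if j = i then 1 else 0 :: complex"
  assume "linear_form k \<gamma> = 0"
  then have "mev (\<lambda>c. c) ?e (linear_form k \<gamma>) = 0" by simp
  moreover have "mev (\<lambda>c. c) ?e (linear_form k \<gamma>) = (\<Sum>j\<le>k. \<gamma> j * ?e j)"
    unfolding linear_form_def by (simp add: is_ring_hom_simps[OF mev_ring_hom])
  moreover have "(\<Sum>j\<le>k. \<gamma> j * ?e j) = (\<Sum>j\<le>k. if j = i then \<gamma> j else 0)"
    by (intro sum.cong) auto
  ultimately show False using assms by simp
qed

text \<open>Isolates \<open>Y 1\<close>, for which the inverse solves.\<close>

lemma lform_split:
  assumes "k \<ge> 1"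
  shows "lform k a Y = a 1 * Y 1 + (a 0 * Y 0 + (\<Sum>j<k - 1. a (j + 2) * Y (j + 2)))"
proof -
  obtain m where m: "k = Suc m" using assms by (cases k) auto
  show ?thesis unfolding m lform_def
    by (simp add: sum.lessThan_Suc_shift algebra_simps del: sum.lessThan_Suc)
qed

lemma msubst_linfrac_map:
  assumes "k > 0"
  shows "msubst Y (linfrac_map k \<alpha> \<beta> 0) = Y 0 * lform k (\<lambda>i. mconst (\<beta> i)) Y"
    "0 < i \<Longrightarrow> i < k \<Longrightarrow> msubst Y (linfrac_map k \<alpha> \<beta> i) = Y (Suc i) * lform k (\<lambda>i. mconst (\<beta> i)) Y"
    "msubst Y (linfrac_map k \<alpha> \<beta> k) = Y 0 * lform k (\<lambda>i. mconst (\<alpha> i)) Y"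
  using assms by (simp_all add: linfrac_map_def msubst_simps msubst_linear_form)

lemma rational_map_linfrac:
  assumes k: "k > 0" and b: "linear_form k \<beta> \<noteq> 0"
  shows "rational_map k (linfrac_map k \<alpha> \<beta>)"
proof -
  have "homogeneous (1 + 1) (linfrac_map k \<alpha> \<beta> i)" for i
    unfolding linfrac_map_def
    using homogeneous_mult[OF homogeneous_mvar homogeneous_linear_form] by simp
  moreover have "mvars (linfrac_map k \<alpha> \<beta> i) \<subseteq> {..k}" if "i \<le> k" for i
    using that mvars_linear_form by (simp add: linfrac_map_def mvars_multI)
  moreover have "linfrac_map k \<alpha> \<beta> 0 \<noteq> 0" using b by (simp add: linfrac_map_def)
  ultimately show ?thesis unfolding rational_map_def by blast
qed

lemma same_rational_map_scaled:
  assumes "rational_map k Z" and Z: "\<And>i. i \<le> k \<Longrightarrow> Z i = K * mvar i"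
  shows "same_rational_map k Z mvar"
  unfolding same_rational_map_def
proof (intro conjI allI impI assms(1))
  show "rational_map k mvar"
    unfolding rational_map_def using homogeneous_mvar
    by (intro conjI exI[of _ 1] exI[of _ 0]) auto
  fix i j assume "i \<le> k" "j \<le> k"
  then show "Z i * mvar j = Z j * mvar i" by (simp add: Z ac_simps)
qed

text \<open>The map solves \<open>y\<^sub>k b(x) = a(x)\<close> for \<open>y\<^sub>k\<close>; the inverse solves it for \<open>x\<^sub>1\<close>.\<close>

definition rest_form :: "nat \<Rightarrow> (nat \<Rightarrow> complex) \<Rightarrow> (nat \<Rightarrow> mpol) \<Rightarrow> mpol" where
  "rest_form k \<gamma> Y = mconst (\<gamma> 0) * Y 0 + (\<Sum>j<k - 1. mconst (\<gamma> (j + 2)) * Y (Suc j))"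

definition linfrac_inverse :: "nat \<Rightarrow> (nat \<Rightarrow> complex) \<Rightarrow> (nat \<Rightarrow> complex) \<Rightarrow> (nat \<Rightarrow> mpol)" where
  "linfrac_inverse k \<alpha> \<beta> = (\<lambda>i.
     if i = 0 then mvar 0 * (mconst (\<beta> 1) * mvar k - mconst (\<alpha> 1) * mvar 0)
     else if i = 1 then mvar 0 * rest_form k \<alpha> mvar - mvar k * rest_form k \<beta> mvar
     else mvar (i - 1) * (mconst (\<beta> 1) * mvar k - mconst (\<alpha> 1) * mvar 0))"

lemma homogeneous_smult: "homogeneous d p \<Longrightarrow> homogeneous d (mconst c * p)"
  using homogeneous_mult[OF homogeneous_mconst] by fastforce

lemma inverse_map_linfrac:
  assumes k: "k \<ge> 2" and D: "\<alpha> 0 * \<beta> 1 - \<alpha> 1 * \<beta> 0 \<noteq> 0"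
  shows "inverse_map k (linfrac_map k \<alpha> \<beta>) (linfrac_inverse k \<alpha> \<beta>)"
proof -
  let ?F = "linfrac_map k \<alpha> \<beta>" and ?G = "linfrac_inverse k \<alpha> \<beta>"
  let ?c = "mconst :: complex \<Rightarrow> mpol"
  define s where "s = ?c (\<beta> 1) * mvar k - ?c (\<alpha> 1) * mvar 0"
  define A where "A = rest_form k \<alpha> mvar"
  define B where "B = rest_form k \<beta> mvar"
  define a where "a = linear_form k \<alpha>"
  define b where "b = linear_form k \<beta>"
  \<comment> \<open>Both \<open>e\<close> and \<open>E\<close> eliminate the variable for which the
    inverse solves. The two composites are the identity times \<open>s * mvar 0 * e\<close> and
    \<open>mvar 0 * b * E\<close>, and at the point [1 : 0 : ... : 0] both \<open>e\<close> and
    \<open>E\<close> equal the determinant in \<open>D\<close>.\<close>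
  define e where "e = ?c (\<beta> 1) * A - ?c (\<alpha> 1) * B"
  define E where "E = ?c (\<beta> 1) * a - ?c (\<alpha> 1) * b"
  have ev0: "p \<noteq> 0" if "meval (\<lambda>i. if i = 0 then 1 else 0) p \<noteq> 0" for p
    using that by (auto simp: meval_eq_mev)
  note evs = meval_eq_mev is_ring_hom_simps[OF mev_ring_hom[OF is_ring_hom_id]]
  have s_lin: "s = linear_form k (\<lambda>i. if i = 0 then - \<alpha> 1 else if i = k then \<beta> 1 else 0)"
  proof -
    have "linear_form k (\<lambda>i. if i = 0 then - \<alpha> 1 else if i = k then \<beta> 1 else 0)
        = ?c (- \<alpha> 1) * mvar 0 + (\<Sum>i<k. if i = k - 1 then ?c (\<beta> 1) * mvar k else 0)"
      unfolding linear_form_eq lform_def using k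
      by (intro arg_cong2[of _ _ _ _ "(+)"] sum.cong refl) auto
    then show ?thesis using k by (simp add: s_def is_ring_hom_uminus[OF mconst_ring_hom])
  qed
  have "\<alpha> 1 \<noteq> 0 \<or> \<beta> 1 \<noteq> 0" using D by auto
  then have s0: "s \<noteq> 0"
    unfolding s_lin
    using k linear_form_nonzero[of 0 k "\<lambda>i. if i = 0 then - \<alpha> 1 else if i = k then \<beta> 1 else 0"]
      linear_form_nonzero[of k k "\<lambda>i. if i = 0 then - \<alpha> 1 else if i = k then \<beta> 1 else 0"]
    by auto
  have e0: "e \<noteq> 0" using D
    by (intro ev0) (simp add: e_def A_def B_def rest_form_def evs algebra_simps)
  have E0: "E \<noteq> 0" using D
    by (intro ev0) (simp add: E_def a_def b_def linear_form_eq lform_def evs algebra_simps)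
  have b0: "b \<noteq> 0"
  proof -
    have "\<beta> 0 \<noteq> 0 \<or> \<beta> 1 \<noteq> 0" using D by auto
    then show ?thesis unfolding b_def using k linear_form_nonzero[of 0 k \<beta>] linear_form_nonzero[of 1 k \<beta>] by auto
  qed
  have F: "rational_map k ?F" using k b0 by (intro rational_map_linfrac) (auto simp: b_def)
  have hs: "homogeneous 1 s" "mvars s \<subseteq> {..k}"
    unfolding s_lin by (rule homogeneous_linear_form mvars_linear_form)+
  have hr: "homogeneous 1 (rest_form k \<gamma> mvar)" "mvars (rest_form k \<gamma> mvar) \<subseteq> {..k}" for \<gamma>
    unfolding rest_form_def
     apply (intro homogeneous_add homogeneous_sum homogeneous_smult homogeneous_mvar)
    apply (intro mvars_addI mvars_sumI mvars_multI; use k in auto)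
    done
  have Gdef: "?G i = (if i = 0 then mvar 0 * s else if i = 1 then mvar 0 * A - mvar k * B else mvar (i - 1) * s)" for i
    by (simp add: linfrac_inverse_def s_def A_def B_def)
  have h2: "homogeneous 2 (mvar j * p)" if "homogeneous 1 p" for j p
    using homogeneous_mult[OF homogeneous_mvar that] by (simp add: numeral_2_eq_2)
  have hG: "homogeneous 2 (?G i)" for i
    using hs hr by (simp add: Gdef A_def B_def h2 homogeneous_diff)
  have vG: "mvars (?G i) \<subseteq> {..k}" if "i \<le> k" for i
    using hs hr that k by (simp add: Gdef A_def B_def mvars_multI mvars_diffI)
  have G: "rational_map k ?G"
  proof -
    have "?G 0 \<noteq> 0" using s0 by (simp add: Gdef)
    then show ?thesis unfolding rational_map_def using hG vG by blast
  qed
  have lG: "lform k (\<lambda>i. ?c (\<gamma> i)) ?G = s * rest_form k \<gamma> mvar + ?c (\<gamma> 1) * (mvar 0 * A - mvar k * B)" for \<gamma>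
  proof -
    have "lform k (\<lambda>i. ?c (\<gamma> i)) ?G = ?c (\<gamma> 1) * (mvar 0 * A - mvar k * B)
        + (?c (\<gamma> 0) * (mvar 0 * s) + (\<Sum>j<k - 1. ?c (\<gamma> (j + 2)) * (mvar (Suc j) * s)))"
      using k by (subst lform_split) (simp_all add: Gdef)
    then show ?thesis by (simp add: rest_form_def algebra_simps sum_distrib_left)
  qed
  have lb: "lform k (\<lambda>i. ?c (\<beta> i)) ?G = mvar 0 * e"
    unfolding lG by (simp add: B_def[symmetric] s_def e_def algebra_simps)
  have la: "lform k (\<lambda>i. ?c (\<alpha> i)) ?G = mvar k * e"
    unfolding lG by (simp add: A_def[symmetric] s_def e_def algebra_simps)
  have FG: "map_comp ?F ?G i = (s * mvar 0 * e) * mvar i" if i: "i \<le> k" for i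
  proof -
    consider "i = 0" | "0 < i" "i < k" | "i = k" using i by linarith
    then show ?thesis
    proof cases
      case 1
      then show ?thesis using k by (simp add: map_comp_def msubst_linfrac_map lb Gdef ac_simps)
    next
      case 2
      then show ?thesis using k by (simp add: map_comp_def msubst_linfrac_map lb Gdef ac_simps)
    next
      case 3
      then show ?thesis using k by (simp add: map_comp_def msubst_linfrac_map la Gdef ac_simps)
    qed
  qed
  have mc: "rational_map k (map_comp P Q)" if P: "rational_map k P" and Q: "rational_map k Q" and nz: "map_comp P Q 0 \<noteq> 0" for P Q
  proof -
    obtain d where "\<forall>i\<le>k. mvars (P i) \<subseteq> {..k} \<and> homogeneous d (P i)" using P by (auto simp: rational_map_def)
    moreover obtain d' where "\<forall>i\<le>k. mvars (Q i) \<subseteq> {..k} \<and> homogeneous d' (Q i)" using Q by (auto simp: rational_map_def)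
    ultimately have "\<forall>i\<le>k. mvars (map_comp P Q i) \<subseteq> {..k} \<and> homogeneous (d * d') (map_comp P Q i)"
      unfolding map_comp_def
      by (intro allI impI conjI mvars_msubst[where k = k] homogeneous_msubst[where k = k]) blast+
    then show ?thesis unfolding rational_map_def using nz by blast
  qed
  have "same_rational_map k (map_comp ?F ?G) mvar"
  proof -
    have "map_comp ?F ?G 0 \<noteq> 0" using FG[of 0] s0 e0 by simp
    then show ?thesis by (rule same_rational_map_scaled[OF mc[OF F G] FG])
  qed
  moreover have GF: "map_comp ?G ?F i = (mvar 0 * b * E) * mvar i" if i: "i \<le> k" for i
  proof -
    have F0: "?F 0 = mvar 0 * b" and Fk: "?F k = mvar 0 * a" and Fi: "\<And>j. 0 < j \<Longrightarrow> j < k \<Longrightarrow> ?F j = mvar (Suc j) * b"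
      using k by (auto simp: linfrac_map_def a_def b_def)
    have S: "msubst ?F s = mvar 0 * E"
      by (simp add: s_def msubst_simps F0 Fk E_def algebra_simps)
    have R: "msubst ?F (rest_form k \<gamma> mvar) = b * (linear_form k \<gamma> - ?c (\<gamma> 1) * mvar 1)" for \<gamma>
    proof -
      have "(\<Sum>j<k - 1. ?c (\<gamma> (j + 2)) * ?F (Suc j)) = (\<Sum>j<k - 1. ?c (\<gamma> (j + 2)) * (mvar (j + 2) * b))"
        by (intro sum.cong) (auto simp: Fi)
      then have "msubst ?F (rest_form k \<gamma> mvar) = ?c (\<gamma> 0) * (mvar 0 * b) + (\<Sum>j<k - 1. ?c (\<gamma> (j + 2)) * (mvar (j + 2) * b))"
        by (simp add: rest_form_def msubst_simps F0)
      moreover have "linear_form k \<gamma> - ?c (\<gamma> 1) * mvar 1 = ?c (\<gamma> 0) * mvar 0 + (\<Sum>j<k - 1. ?c (\<gamma> (j + 2)) * mvar (j + 2))"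
        using k unfolding linear_form_eq by (subst lform_split) auto
      ultimately show ?thesis by (simp add: algebra_simps sum_distrib_left)
    qed
    consider "i = 0" | "i = 1" | "2 \<le> i" by linarith
    then show ?thesis
    proof cases
      case 1
      then show ?thesis by (simp add: map_comp_def Gdef msubst_simps S F0 ac_simps)
    next
      case 2
      then show ?thesis
        by (simp add: map_comp_def Gdef msubst_simps S F0 Fk A_def B_def R a_def[symmetric] b_def[symmetric] E_def algebra_simps)
    next
      case 3
      then have "?F (i - 1) = mvar i * b" using Fi[of "i - 1"] i by simp
      then show ?thesis using 3 by (simp add: map_comp_def Gdef msubst_simps S ac_simps)
    qed
  qed
  moreover have "same_rational_map k (map_comp ?G ?F) mvar"
  proof -
    have "map_comp ?G ?F 0 \<noteq> 0" using GF[of 0] b0 E0 by simp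
    then show ?thesis by (rule same_rational_map_scaled[OF mc[OF G F] GF])
  qed
  ultimately show ?thesis using F G by (simp add: inverse_map_def)
qed

section \<open>The degrees of the forward iterates\<close>

text \<open>A window holds the last \<open>k\<close> terms of the recurrence, oldest first, as pairs of a numerator
  and a denominator; nothing is ever cancelled.\<close>

definition lincomb :: "nat \<Rightarrow> (nat \<Rightarrow> 'r::comm_ring_1) \<Rightarrow> (nat \<Rightarrow> 'r \<times> 'r) \<Rightarrow> 'r" where
  "lincomb k a w = a 0 * (\<Prod>j<k. snd (w j))
     + (\<Sum>i<k. a (Suc i) * (fst (w i) * (\<Prod>j\<in>{..<k} - {i}. snd (w j))))"

primrec fwin :: "nat \<Rightarrow> (nat \<Rightarrow> 'r::comm_ring_1) \<Rightarrow> (nat \<Rightarrow> 'r) \<Rightarrow> (nat \<Rightarrow> 'r \<times> 'r) \<Rightarrow> nat \<Rightarrow> nat \<Rightarrow> 'r \<times> 'r" where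
  "fwin k a b w 0 = w"
| "fwin k a b w (Suc n) = (\<lambda>i. if Suc i < k then fwin k a b w n (Suc i)
     else (lincomb k a (fwin k a b w n), lincomb k b (fwin k a b w n)))"

lemma lincomb_cong:
  "(\<And>j. j \<le> k \<Longrightarrow> a j = a' j) \<Longrightarrow> lincomb k a w = lincomb k a' w"
  unfolding lincomb_def by (intro arg_cong2[of _ _ _ _ "(+)"] arg_cong2[of _ _ _ _ "(*)"] sum.cong) auto

lemma fwin_cong:
  assumes "\<And>j. j \<le> k \<Longrightarrow> a j = a' j" "\<And>j. j \<le> k \<Longrightarrow> b j = b' j"
  shows "fwin k a b w n = fwin k a' b' w n"
proof -
  have "lincomb k a w = lincomb k a' w" "lincomb k b w = lincomb k b' w" for w
    using assms by (blast intro: lincomb_cong)+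
  then show ?thesis by (induction n) (simp_all cong: if_cong)
qed

lemma hom_lincomb:
  assumes h: "is_ring_hom h"
  shows "h (lincomb k a w) = lincomb k (\<lambda>j. h (a j)) (\<lambda>i. map_prod h h (w i))"
  by (simp add: lincomb_def is_ring_hom_simps[OF h])

text \<open>Transfers the window from polynomials in all variables to the test line.\<close>

lemma hom_fwin:
  assumes h: "is_ring_hom h"
  shows "map_prod h h (fwin k a b w n i)
    = fwin k (\<lambda>j. h (a j)) (\<lambda>j. h (b j)) (\<lambda>i. map_prod h h (w i)) n i"
  by (induction n arbitrary: i) (simp_all add: hom_lincomb[OF h])

lemma prod_split: "i < k \<Longrightarrow> (\<Prod>j<k. f j) = f i * (\<Prod>j\<in>{..<k} - {i}. f j)" for f :: "nat \<Rightarrow> 'r::comm_ring_1"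
  by (simp add: prod.remove)

text \<open>Clearing denominators: if the window holds the affine coordinates of \<open>Y\<close>,
  then the linear form divided by \<open>Y 0\<close> is \<open>lincomb\<close> over the product of
  the denominators.\<close>

lemma lincomb_lform:
  assumes "\<And>i. i < k \<Longrightarrow> Y (Suc i) * snd (w i) = Y 0 * fst (w i)"
  shows "Y 0 * lincomb k a w = lform k a Y * (\<Prod>j<k. snd (w j))"
proof -
  have "Y 0 * (a (Suc i) * (fst (w i) * (\<Prod>j\<in>{..<k} - {i}. snd (w j))))
      = a (Suc i) * Y (Suc i) * (\<Prod>j<k. snd (w j))" if "i < k" for i
  proof -
    have "Y 0 * (a (Suc i) * (fst (w i) * (\<Prod>j\<in>{..<k} - {i}. snd (w j))))
        = a (Suc i) * (Y 0 * fst (w i)) * (\<Prod>j\<in>{..<k} - {i}. snd (w j))" by (simp add: ac_simps)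
    also have "\<dots> = a (Suc i) * Y (Suc i) * (\<Prod>j<k. snd (w j))"
      unfolding assms[OF that, symmetric] prod_split[OF that] by (simp add: ac_simps)
    finally show ?thesis .
  qed
  then have "(\<Sum>i<k. Y 0 * (a (Suc i) * (fst (w i) * (\<Prod>j\<in>{..<k} - {i}. snd (w j)))))
      = (\<Sum>i<k. a (Suc i) * Y (Suc i) * (\<Prod>j<k. snd (w j)))" by (intro sum.cong) auto
  then show ?thesis
    unfolding lincomb_def lform_def distrib_left distrib_right sum_distrib_left sum_distrib_right
    by (simp add: ac_simps)
qed

lemma homogeneous_lincomb:
  assumes "\<And>i. i < k \<Longrightarrow> homogeneous (d i) (fst (w i)) \<and> homogeneous (d i) (snd (w i))"
  shows "homogeneous (\<Sum>j<k. d j) (lincomb k (\<lambda>j. mconst (a j)) w)"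
proof -
  have q: "homogeneous (\<Sum>j\<in>A. d j) (\<Prod>j\<in>A. snd (w j))" if "A \<subseteq> {..<k}" for A
    using assms that by (intro homogeneous_prod) auto
  have "homogeneous (\<Sum>j<k. d j) (fst (w i) * (\<Prod>j\<in>{..<k} - {i}. snd (w j)))" if "i < k" for i
    using homogeneous_mult[of "d i" "fst (w i)" "\<Sum>j\<in>{..<k} - {i}. d j"] q[of "{..<k} - {i}"] assms[OF that] that
    by (simp add: sum.remove[of "{..<k}" i])
  then show ?thesis
    unfolding lincomb_def using q[of "{..<k}"]
    by (intro homogeneous_add homogeneous_sum homogeneous_smult) auto
qed

lemma mvars_lincomb:
  assumes "\<And>i. i < k \<Longrightarrow> mvars (fst (w i)) \<subseteq> V \<and> mvars (snd (w i)) \<subseteq> V"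
  shows "mvars (lincomb k (\<lambda>j. mconst (a j)) w) \<subseteq> V"
  unfolding lincomb_def
  by (intro mvars_addI mvars_multI mvars_sumI mvars_prodI) (use assms in simp_all)

section \<open>The forward windows compute the iterates\<close>

abbreviation fwd_window :: "nat \<Rightarrow> (nat \<Rightarrow> complex) \<Rightarrow> (nat \<Rightarrow> complex) \<Rightarrow> nat \<Rightarrow> nat \<Rightarrow> mpol \<times> mpol" where
  "fwd_window k \<alpha> \<beta> \<equiv> fwin k (\<lambda>j. mconst (\<alpha> j)) (\<lambda>j. mconst (\<beta> j)) (\<lambda>i. (mvar (Suc i), mvar 0))"

lemma fwd_window_properties:
  assumes "i < k"
  shows "homogeneous (fdeg k n i) (fst (fwd_window k \<alpha> \<beta> n i)) \<and>
    homogeneous (fdeg k n i) (snd (fwd_window k \<alpha> \<beta> n i)) \<and>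
    mvars (fst (fwd_window k \<alpha> \<beta> n i)) \<subseteq> {..k} \<and> mvars (snd (fwd_window k \<alpha> \<beta> n i)) \<subseteq> {..k}"
  using assms
proof (induction n arbitrary: i)
  case 0
  then show ?case using homogeneous_mvar by simp
next
  case (Suc n)
  show ?case
  proof (cases "Suc i < k")
    case True
    then show ?thesis using Suc.IH[of "Suc i"] by simp
  next
    case False
    then show ?thesis using Suc.IH by (simp add: homogeneous_lincomb mvars_lincomb)
  qed
qed

lemma fwd_window_iterate:
  assumes k: "k \<ge> 2" and D: "\<alpha> 0 * \<beta> 1 - \<alpha> 1 * \<beta> 0 \<noteq> 0"
  defines "Y \<equiv> map_iterate (linfrac_map k \<alpha> \<beta>)"
  assumes i: "i < k"
  shows "snd (fwd_window k \<alpha> \<beta> n i) \<noteq> 0 \<and>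
    Y n (Suc i) * snd (fwd_window k \<alpha> \<beta> n i) = Y n 0 * fst (fwd_window k \<alpha> \<beta> n i)"
  using i
proof (induction n arbitrary: i)
  case 0
  then show ?case by (simp add: Y_def mult.commute)
next
  case (Suc n)
  let ?W = "fwd_window k \<alpha> \<beta> n"
  let ?a = "lform k (\<lambda>i. mconst (\<alpha> i)) (Y n)" and ?b = "lform k (\<lambda>i. mconst (\<beta> i)) (Y n)"
  have dom: "dominant k (Y n)"
    unfolding Y_def using map_iterate_dominant[OF inverse_map_linfrac[OF k D]] by blast
  have Y0: "Y n 0 \<noteq> 0" using dominantD[OF dom homogeneous_mvar, of 0] by simp
  have "\<beta> 0 \<noteq> 0 \<or> \<beta> 1 \<noteq> 0" using D by auto
  then have "linear_form k \<beta> \<noteq> 0"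
    using k linear_form_nonzero[of 0 k \<beta>] linear_form_nonzero[of 1 k \<beta>] by auto
  then have b0: "?b \<noteq> 0"
    using dominantD[OF dom homogeneous_linear_form mvars_linear_form] by (simp add: msubst_linear_form)
  have step: "Y (Suc n) 0 = Y n 0 * ?b" "Y (Suc n) k = Y n 0 * ?a"
    "\<And>j. 0 < j \<Longrightarrow> j < k \<Longrightarrow> Y (Suc n) j = Y n (Suc j) * ?b"
    using k by (simp_all add: Y_def map_comp_def msubst_linfrac_map)
  show ?case
  proof (cases "Suc i < k")
    case True
    have "Y n (Suc (Suc i)) * snd (?W (Suc i)) = Y n 0 * fst (?W (Suc i))" using Suc.IH[OF True] by blast
    then have "?b * (Y n (Suc (Suc i)) * snd (?W (Suc i))) = ?b * (Y n 0 * fst (?W (Suc i)))" by simp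
    then have "Y n (Suc (Suc i)) * ?b * snd (?W (Suc i)) = Y n 0 * ?b * fst (?W (Suc i))"
      by (simp only: ac_simps)
    then show ?thesis using True Suc.IH[OF True] by (simp add: step)
  next
    case False
    then have ik: "Suc i = k" using Suc.prems by simp
    let ?A = "lincomb k (\<lambda>j. mconst (\<alpha> j)) ?W" and ?B = "lincomb k (\<lambda>j. mconst (\<beta> j)) ?W"
    let ?Q = "\<Prod>j<k. snd (?W j)"
    have Q0: "?Q \<noteq> 0" using Suc.IH by simp
    have A: "Y n 0 * ?A = ?a * ?Q" and B: "Y n 0 * ?B = ?b * ?Q"
      using Suc.IH by (intro lincomb_lform; blast)+
    have "?B \<noteq> 0" using B b0 Q0 by auto
    moreover have "Y n 0 * (Y n 0 * ?a * ?B) = Y n 0 * (Y n 0 * ?b * ?A)"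
    proof -
      have "Y n 0 * (Y n 0 * ?a * ?B) = Y n 0 * ?a * (Y n 0 * ?B)" by (simp only: ac_simps)
      also have "\<dots> = Y n 0 * ?b * (Y n 0 * ?A)" unfolding A B by (simp only: ac_simps)
      also have "\<dots> = Y n 0 * (Y n 0 * ?b * ?A)" by (simp only: ac_simps)
      finally show ?thesis .
    qed
    ultimately show ?thesis using Y0 False by (simp add: ik step)
  qed
qed

lemma map_degree_forward_le:
  assumes k: "k \<ge> 2" and D: "\<alpha> 0 * \<beta> 1 - \<alpha> 1 * \<beta> 0 \<noteq> 0"
  shows "map_degree k (map_iterate (linfrac_map k \<alpha> \<beta>) n) \<le> fdeg k (Suc n) (k - 1)"
proof -
  let ?Y = "map_iterate (linfrac_map k \<alpha> \<beta>) n" and ?W = "fwd_window k \<alpha> \<beta> n"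
  have Y: "rational_map k ?Y" "dominant k ?Y"
    using map_iterate_dominant[OF inverse_map_linfrac[OF k D]] by blast+
  have Y0: "?Y 0 \<noteq> 0" using dominantD[OF Y(2) homogeneous_mvar, of 0] by simp
  note W = fwd_window_iterate[OF k D, of _ n] and P = fwd_window_properties[of _ k n \<alpha> \<beta>]
  let ?rest = "\<lambda>i. \<Prod>j\<in>{..<k} - {i}. snd (?W j)"
  \<comment> \<open>All coordinates over the product of the \<open>k\<close> denominators; the sum
    of their degrees is the next value of the degree recurrence.\<close>
  define H where "H i = (if i = 0 then \<Prod>j<k. snd (?W j) else fst (?W (i - 1)) * ?rest (i - 1))" for i
  let ?d = "\<Sum>j<k. fdeg k n j"
  have H: "homogeneous ?d (H i)" "mvars (H i) \<subseteq> {..k}" "?Y i * H 0 = ?Y 0 * H i" if i: "i \<le> k" for i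
  proof -
    have q: "homogeneous (\<Sum>j\<in>A. fdeg k n j) (\<Prod>j\<in>A. snd (?W j))" "mvars (\<Prod>j\<in>A. snd (?W j)) \<subseteq> {..k}"
      if "A \<subseteq> {..<k}" for A
    proof -
      show "homogeneous (\<Sum>j\<in>A. fdeg k n j) (\<Prod>j\<in>A. snd (?W j))"
        using P that by (intro homogeneous_prod) blast
      show "mvars (\<Prod>j\<in>A. snd (?W j)) \<subseteq> {..k}"
        using P that by (intro mvars_prodI) blast
    qed
    have "homogeneous ?d (H i) \<and> mvars (H i) \<subseteq> {..k} \<and> ?Y i * H 0 = ?Y 0 * H i"
    proof (cases i)
      case 0
      then show ?thesis using q[of "{..<k}"] by (simp add: H_def)
    next
      case (Suc m)
      then have m: "m < k" using i by simp
      have d: "?d = fdeg k n m + (\<Sum>j\<in>{..<k} - {m}. fdeg k n j)" using m by (simp add: sum.remove)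
      have "homogeneous ?d (H i)"
        unfolding d H_def using Suc P[OF m] q(1)[of "{..<k} - {m}"] by (auto intro!: homogeneous_mult)
      moreover have "mvars (H i) \<subseteq> {..k}"
        using Suc P[OF m] q(2)[of "{..<k} - {m}"] by (simp add: H_def mvars_multI)
      moreover have "?Y i * H 0 = ?Y 0 * H i"
      proof -
        have "?Y i * H 0 = (?Y (Suc m) * snd (?W m)) * ?rest m"
          by (simp add: H_def Suc prod_split[OF m] mult.assoc)
        also have "\<dots> = ?Y 0 * H i" using W[OF m] by (simp add: H_def Suc mult.assoc)
        finally show ?thesis .
      qed
      ultimately show ?thesis by blast
    qed
    then show "homogeneous ?d (H i)" "mvars (H i) \<subseteq> {..k}" "?Y i * H 0 = ?Y 0 * H i" by blast+
  qed
  have "H 0 \<noteq> 0" using W by (simp add: H_def)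
  then have "same_rational_map k ?Y H" using Y(1) H Y0 by (intro same_rational_mapI[where d = ?d]) auto
  then have "map_degree k ?Y \<le> ?d" using H(1) by (intro map_degree_le[OF Y(1)]) auto
  then show ?thesis using k by simp
qed

text \<open>The window along the test curve, as a function of the point \<open>x = (\<alpha>, \<beta>)\<close>.\<close>

abbreviation fwd_test :: "nat \<Rightarrow> (nat \<Rightarrow> complex) \<Rightarrow> nat \<Rightarrow> nat \<Rightarrow> complex poly \<times> complex poly" where
  "fwd_test k x \<equiv> fwin k (\<lambda>j. [:x j:]) (\<lambda>j. [:x (Suc (k + j)):]) (\<lambda>i. ([:0, 1:], 1))"

lemma param_point_simps:
  "j \<le> k \<Longrightarrow> param_point k \<alpha> \<beta> j = \<alpha> j" "j \<le> k \<Longrightarrow> param_point k \<alpha> \<beta> (Suc (k + j)) = \<beta> j"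
  by (auto simp: param_point_def)

lemma test_eval_fwd_window:
  "map_prod test_eval test_eval (fwd_window k \<alpha> \<beta> n i) = fwd_test k (param_point k \<alpha> \<beta>) n i"
proof -
  have "map_prod test_eval test_eval (fwd_window k \<alpha> \<beta> n i)
      = fwin k (\<lambda>j. [:\<alpha> j:]) (\<lambda>j. [:\<beta> j:]) (\<lambda>i. ([:0, 1:], 1)) n i"
    by (subst hom_fwin) (simp_all add: test_eval_mvar)
  also have "\<dots> = fwd_test k (param_point k \<alpha> \<beta>) n i"
    by (rule fun_cong[OF fwin_cong]) (simp_all only: param_point_simps)
  finally show ?thesis .
qed

lemma map_degree_forward_ge:
  assumes k: "k \<ge> 2" and D: "\<alpha> 0 * \<beta> 1 - \<alpha> 1 * \<beta> 0 \<noteq> 0"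
    and no: "no_small_relation d (fst (fwd_test k (param_point k \<alpha> \<beta>) n (k - 1)))
      (snd (fwd_test k (param_point k \<alpha> \<beta>) n (k - 1)))"
  shows "d \<le> map_degree k (map_iterate (linfrac_map k \<alpha> \<beta>) n)"
proof -
  let ?Y = "map_iterate (linfrac_map k \<alpha> \<beta>) n" and ?W = "fwd_window k \<alpha> \<beta> n (k - 1)"
  have Y: "rational_map k ?Y" "dominant k ?Y"
    using map_iterate_dominant[OF inverse_map_linfrac[OF k D]] by blast+
  have Y0: "?Y 0 \<noteq> 0" using dominantD[OF Y(2) homogeneous_mvar, of 0] by simp
  have "Suc (k - 1) = k" using k by simp
  then have "?Y k * snd ?W = ?Y 0 * fst ?W" using fwd_window_iterate[OF k D, of "k - 1" n] k by simp
  moreover have "no_small_relation d (test_eval (fst ?W)) (test_eval (snd ?W))"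
    using no unfolding test_eval_fwd_window[symmetric] by simp
  ultimately show ?thesis using map_degree_ge[OF Y(1) Y0, of k] by blast
qed

section \<open>Polynomial dependence of the test windows on the parameters\<close>

definition coeffs_polyfun :: "nat \<Rightarrow> ((nat \<Rightarrow> complex) \<Rightarrow> complex poly) \<Rightarrow> bool" where
  "coeffs_polyfun N P \<longleftrightarrow> (\<forall>r. polyfun N (\<lambda>x. coeff (P x) r))"

lemma coeffs_polyfun_const: "coeffs_polyfun N (\<lambda>x. p)"
  by (simp add: coeffs_polyfun_def polyfun_const)

lemma coeffs_polyfun_var: "i < N \<Longrightarrow> coeffs_polyfun N (\<lambda>x. [:x i:])"
  unfolding coeffs_polyfun_def
proof
  fix r assume "i < N"
  then show "polyfun N (\<lambda>x. coeff [:x i:] r)" by (cases r) (simp_all add: polyfun_const polyfun_var)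
qed

lemma coeffs_polyfun_add: "coeffs_polyfun N P \<Longrightarrow> coeffs_polyfun N Q \<Longrightarrow> coeffs_polyfun N (\<lambda>x. P x + Q x)"
  by (simp add: coeffs_polyfun_def polyfun_add)

lemma coeffs_polyfun_diff: "coeffs_polyfun N P \<Longrightarrow> coeffs_polyfun N Q \<Longrightarrow> coeffs_polyfun N (\<lambda>x. P x - Q x)"
  by (simp add: coeffs_polyfun_def polyfun_diff)

lemma coeffs_polyfun_mult: "coeffs_polyfun N P \<Longrightarrow> coeffs_polyfun N Q \<Longrightarrow> coeffs_polyfun N (\<lambda>x. P x * Q x)"
  unfolding coeffs_polyfun_def coeff_mult by (intro allI polyfun_sum polyfun_mult) auto

lemma coeffs_polyfun_sum:
  "(\<And>j. j \<in> A \<Longrightarrow> coeffs_polyfun N (P j)) \<Longrightarrow> coeffs_polyfun N (\<lambda>x. \<Sum>j\<in>A. P j x)"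
  by (induction A rule: infinite_finite_induct) (simp_all add: coeffs_polyfun_const coeffs_polyfun_add)

lemma coeffs_polyfun_prod:
  "(\<And>j. j \<in> A \<Longrightarrow> coeffs_polyfun N (P j)) \<Longrightarrow> coeffs_polyfun N (\<lambda>x. \<Prod>j\<in>A. P j x)"
  by (induction A rule: infinite_finite_induct) (simp_all add: coeffs_polyfun_const coeffs_polyfun_mult)

lemma coeffs_polyfun_lincomb:
  assumes "\<And>j. j \<le> k \<Longrightarrow> coeffs_polyfun N (\<lambda>x. a x j)"
    and "\<And>i. i < k \<Longrightarrow> coeffs_polyfun N (\<lambda>x. fst (w x i)) \<and> coeffs_polyfun N (\<lambda>x. snd (w x i))"
  shows "coeffs_polyfun N (\<lambda>x. lincomb k (a x) (w x))"
  unfolding lincomb_def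
  by (intro coeffs_polyfun_add coeffs_polyfun_mult coeffs_polyfun_sum coeffs_polyfun_prod)
    (use assms in auto)

lemma coeffs_polyfun_fwd_test:
  assumes "i < k"
  shows "coeffs_polyfun (2 * k + 2) (\<lambda>x. fst (fwd_test k x n i)) \<and>
    coeffs_polyfun (2 * k + 2) (\<lambda>x. snd (fwd_test k x n i))"
  using assms
proof (induction n arbitrary: i)
  case 0
  then show ?case by (simp add: coeffs_polyfun_const)
next
  case (Suc n)
  show ?case
  proof (cases "Suc i < k")
    case True
    then show ?thesis using Suc.IH[of "Suc i"] by simp
  next
    case False
    have "coeffs_polyfun (2 * k + 2) (\<lambda>x. lincomb k (\<lambda>j. [:x j:]) (fwd_test k x n))"
      "coeffs_polyfun (2 * k + 2) (\<lambda>x. lincomb k (\<lambda>j. [:x (Suc (k + j)):]) (fwd_test k x n))"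
      using Suc.IH by (intro coeffs_polyfun_lincomb coeffs_polyfun_var; simp)+
    then show ?thesis using False by simp
  qed
qed

text \<open>A special parameter: \<open>x\<^sub>k\<^sub>+\<^sub>1 = 1 / (1 + x\<^sub>1 + \<dots> + x\<^sub>k)\<close>. Here denominators stay pairwise
  coprime, and they have the full degree because no cancellation occurs between nonnegative
  coefficients.\<close>

definition fwd_point :: "nat \<Rightarrow> nat \<Rightarrow> complex" where
  "fwd_point k j = (if j = 0 \<or> j > k then 1 else 0)"

definition nonneg_poly :: "complex poly \<Rightarrow> bool" where
  "nonneg_poly p \<longleftrightarrow> (\<forall>i. coeff p i \<in> \<real>\<^sub>\<ge>\<^sub>0)"

lemma nonneg_poly_0 [simp]: "nonneg_poly 0"
  and nonneg_poly_1 [simp]: "nonneg_poly 1"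
  by (simp_all add: nonneg_poly_def coeff_1)

lemma nonneg_poly_add: "nonneg_poly p \<Longrightarrow> nonneg_poly q \<Longrightarrow> nonneg_poly (p + q)"
  by (simp add: nonneg_poly_def nonneg_Reals_add_I)

lemma nonneg_Reals_sum: "(\<And>x. x \<in> A \<Longrightarrow> f x \<in> \<real>\<^sub>\<ge>\<^sub>0) \<Longrightarrow> sum f A \<in> (\<real>\<^sub>\<ge>\<^sub>0 :: complex set)"
  by (induction A rule: infinite_finite_induct) (auto intro: nonneg_Reals_add_I)

lemma nonneg_poly_mult: "nonneg_poly p \<Longrightarrow> nonneg_poly q \<Longrightarrow> nonneg_poly (p * q)"
  unfolding nonneg_poly_def coeff_mult by (auto intro!: nonneg_Reals_sum nonneg_Reals_mult_I)

lemma nonneg_poly_sum: "(\<And>x. x \<in> A \<Longrightarrow> nonneg_poly (f x)) \<Longrightarrow> nonneg_poly (sum f A)"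
  by (induction A rule: infinite_finite_induct) (auto simp: nonneg_poly_add)

lemma nonneg_poly_prod: "(\<And>x. x \<in> A \<Longrightarrow> nonneg_poly (f x)) \<Longrightarrow> nonneg_poly (prod f A)"
  by (induction A rule: infinite_finite_induct) (auto simp: nonneg_poly_mult)

text \<open>A nonnegative coefficient cannot cancel the leading coefficient of
  \<open>p\<close>.\<close>

lemma degree_add_nonneg:
  assumes "nonneg_poly p" "nonneg_poly q" "p \<noteq> 0"
  shows "degree p \<le> degree (p + q)" "p + q \<noteq> 0"
proof -
  have "coeff p (degree p) + coeff q (degree p) \<noteq> 0"
  proof
    assume z: "coeff p (degree p) + coeff q (degree p) = 0"
    have "coeff p (degree p) \<in> \<real>\<^sub>\<ge>\<^sub>0" "coeff q (degree p) \<in> \<real>\<^sub>\<ge>\<^sub>0"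
      using assms by (auto simp: nonneg_poly_def)
    then have "coeff p (degree p) = 0"
      using z by (auto simp: complex_nonneg_Reals_iff complex_eq_iff)
    then show False using assms(3) by simp
  qed
  then have c: "coeff (p + q) (degree p) \<noteq> 0" by simp
  then show "degree p \<le> degree (p + q)" by (rule le_degree)
  show "p + q \<noteq> 0" using c by (metis coeff_0)
qed

definition fwd_numer :: "nat \<Rightarrow> (nat \<Rightarrow> complex poly \<times> complex poly) \<Rightarrow> complex poly" where
  "fwd_numer k w = (\<Prod>j<k. snd (w j))"

definition fwd_denom :: "nat \<Rightarrow> (nat \<Rightarrow> complex poly \<times> complex poly) \<Rightarrow> complex poly" where
  "fwd_denom k w = (\<Prod>j<k. snd (w j)) + (\<Sum>i<k. fst (w i) * (\<Prod>j\<in>{..<k} - {i}. snd (w j)))"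

lemma fwd_test_point_Suc:
  "fwd_test k (fwd_point k) (Suc n) i = (if Suc i < k then fwd_test k (fwd_point k) n (Suc i)
     else (fwd_numer k (fwd_test k (fwd_point k) n), fwd_denom k (fwd_test k (fwd_point k) n)))"
proof -
  have c1: "[:1:] = (1 :: complex poly)" by simp
  have "lincomb k (\<lambda>j. [:fwd_point k j:]) w = fwd_numer k w" for w
  proof -
    have "(\<Sum>i<k. [:fwd_point k (Suc i):] * (fst (w i) * (\<Prod>j\<in>{..<k} - {i}. snd (w j)))) = 0"
      by (intro sum.neutral) (auto simp: fwd_point_def)
    then show ?thesis by (simp add: lincomb_def fwd_numer_def fwd_point_def c1)
  qed
  moreover have "lincomb k (\<lambda>j. [:fwd_point k (Suc (k + j)):]) w = fwd_denom k w" for w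
    by (simp add: lincomb_def fwd_denom_def fwd_point_def c1)
  ultimately show ?thesis by simp
qed

lemma coprime_add_mult:
  fixes a b :: "complex poly"
  assumes "coprime a b"
  shows "coprime (a + t * b) b"
  using gcd_add_mult[of b t a] assms by (simp add: coprime_iff_gcd_eq_1 gcd.commute add.commute)

text \<open>Modulo an old denominator only one summand of the new one survives: the numerator of
  that term times the other denominators, all coprime to it by induction. The new numerator is the
  product of the old denominators, hence coprime to the new denominator too.\<close>

lemma fwd_test_point_coprime:
  assumes i: "i < k"
  shows "nonneg_poly (fst (fwd_test k (fwd_point k) n i)) \<and> nonneg_poly (snd (fwd_test k (fwd_point k) n i)) \<and>
    snd (fwd_test k (fwd_point k) n i) \<noteq> 0 \<and>
    coprime (fst (fwd_test k (fwd_point k) n i)) (snd (fwd_test k (fwd_point k) n i)) \<and>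
    (\<forall>j<k. j \<noteq> i \<longrightarrow> coprime (snd (fwd_test k (fwd_point k) n i)) (snd (fwd_test k (fwd_point k) n j)))"
    (is "?P n i")
  using i
proof (induction n arbitrary: i)
  case 0
  then show ?case by (simp add: nonneg_poly_def coeff_pCons coeff_1 split: nat.splits)
next
  case (Suc n)
  let ?w = "fwd_test k (fwd_point k) n"
  let ?q = "\<lambda>j. snd (?w j)" and ?R = "\<lambda>i. fst (?w i) * (\<Prod>j\<in>{..<k} - {i}. snd (?w j))"
  have nn: "nonneg_poly (fwd_numer k ?w)" "nonneg_poly (\<Sum>i<k. ?R i)"
    unfolding fwd_numer_def using Suc.IH
    by (intro nonneg_poly_prod nonneg_poly_sum nonneg_poly_mult; simp)+
  have n0: "fwd_numer k ?w \<noteq> 0" using Suc.IH by (simp add: fwd_numer_def)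
  have d0: "fwd_denom k ?w \<noteq> 0"
    using degree_add_nonneg(2)[OF nn n0] by (simp add: fwd_denom_def fwd_numer_def)
  have cq: "coprime (fwd_denom k ?w) (?q j)" if j: "j < k" for j
  proof -
    define T where "T = (\<Prod>l\<in>{..<k} - {j}. ?q l) + (\<Sum>i\<in>{..<k} - {j}. fst (?w i) * (\<Prod>l\<in>{..<k} - {i} - {j}. ?q l))"
    have "(\<Sum>i\<in>{..<k} - {j}. ?R i) = (\<Sum>i\<in>{..<k} - {j}. ?q j * (fst (?w i) * (\<Prod>l\<in>{..<k} - {i} - {j}. ?q l)))"
    proof (rule sum.cong[OF refl])
      fix i assume "i \<in> {..<k} - {j}"
      then have "(\<Prod>l\<in>{..<k} - {i}. ?q l) = ?q j * (\<Prod>l\<in>{..<k} - {i} - {j}. ?q l)"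
        using j by (intro prod.remove) auto
      then show "?R i = ?q j * (fst (?w i) * (\<Prod>l\<in>{..<k} - {i} - {j}. ?q l))" by (simp only: ac_simps)
    qed
    moreover have "(\<Sum>i<k. ?R i) = ?R j + (\<Sum>i\<in>{..<k} - {j}. ?R i)" using j by (simp add: sum.remove)
    ultimately have eq: "fwd_denom k ?w = ?R j + T * ?q j"
      unfolding fwd_denom_def T_def prod_split[OF j] by (simp add: algebra_simps sum_distrib_left)
    have "coprime (?R j) (?q j)"
    proof -
      have "coprime (\<Prod>l\<in>{..<k} - {j}. ?q l) (?q j)"
        using Suc.IH j by (intro prod_coprime_left) auto
      then show ?thesis using Suc.IH[OF j] by (simp add: coprime_mult_left_iff)
    qed
    then show ?thesis unfolding eq by (rule coprime_add_mult)
  qed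
  have cn: "coprime (fwd_numer k ?w) (fwd_denom k ?w)"
    unfolding fwd_numer_def using cq by (intro prod_coprime_left) (auto simp: coprime_commute)
  show ?case
  proof (cases "Suc i < k")
    case True
    then show ?thesis
      using Suc.IH[OF True] cq[OF True] by (auto simp: fwd_test_point_Suc coprime_commute simp del: fwin.simps)
  next
    case False
    have "coprime (fwd_denom k ?w) (snd (fwd_test k (fwd_point k) (Suc n) j))" if "j < k" "j \<noteq> i" for j
      using that False Suc.prems cq by (simp add: fwd_test_point_Suc del: fwin.simps)
    then show ?thesis
      using False nn n0 d0 cn nonneg_poly_add[OF nn]
      by (simp add: fwd_test_point_Suc fwd_denom_def fwd_numer_def del: fwin.simps)
  qed
qed

section \<open>Degree growth at the special forward parameter\<close>

lemma degree_fwd_numer: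
  "degree (fwd_numer k (fwd_test k (fwd_point k) n)) = (\<Sum>j<k. degree (snd (fwd_test k (fwd_point k) n j)))"
  unfolding fwd_numer_def using fwd_test_point_coprime by (intro degree_prod_eq_sum_degree) auto

lemma degree_fwd_denom:
  "(\<Sum>j<k. degree (snd (fwd_test k (fwd_point k) n j))) \<le> degree (fwd_denom k (fwd_test k (fwd_point k) n))"
proof -
  let ?w = "fwd_test k (fwd_point k) n"
  have "nonneg_poly (fwd_numer k ?w)" "nonneg_poly (\<Sum>i<k. fst (?w i) * (\<Prod>j\<in>{..<k} - {i}. snd (?w j)))"
    unfolding fwd_numer_def using fwd_test_point_coprime[of _ k n]
    by (intro nonneg_poly_prod nonneg_poly_sum nonneg_poly_mult; simp)+
  moreover have "fwd_numer k ?w \<noteq> 0"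
    unfolding fwd_numer_def using fwd_test_point_coprime[of _ k n] by simp
  ultimately show ?thesis
    unfolding degree_fwd_numer[symmetric] using degree_add_nonneg(1) by (simp add: fwd_denom_def fwd_numer_def)
qed

text \<open>The starting denominators are 1, the first new one is 1 + k t, and from then on no new
  denominator has smaller degree than its predecessor.\<close>

lemma degree_fwd_test_newest:
  assumes k: "k \<ge> 2"
  shows "1 \<le> degree (snd (fwd_test k (fwd_point k) (Suc n) (k - 1)))"
proof (induction n)
  case 0
  let ?t = "[:0, 1:] :: complex poly"
  have "fwd_denom k (fwd_test k (fwd_point k) 0) = 1 + of_nat k * ?t"
    by (simp add: fwd_denom_def)
  also have "\<dots> = [:1, of_nat k:]" by (simp add: of_nat_poly one_pCons)
  finally have "degree (fwd_denom k (fwd_test k (fwd_point k) 0)) = 1" using k by simp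
  then show ?case using k by (simp add: fwd_test_point_Suc del: fwin.simps)
next
  case (Suc n)
  have "degree (snd (fwd_test k (fwd_point k) (Suc n) (k - 1)))
      \<le> (\<Sum>j<k. degree (snd (fwd_test k (fwd_point k) (Suc n) j)))"
    using k by (intro member_le_sum) auto
  also note degree_fwd_denom
  finally show ?case using Suc k fwd_test_point_Suc[of k "Suc n" "k - 1"] by simp
qed

lemma fwd_test_shift: "i + l < k \<Longrightarrow> fwd_test k x (n + l) i = fwd_test k x n (i + l)"
  by (induction l arbitrary: i) auto

text \<open>After \<open>k\<close> steps all denominators in the window are nonconstant, which
  matches the starting values of \<open>fdeg\<close>; from there the degrees grow at least as the
  recurrence demands.\<close>

lemma degree_fwd_test_ge:
  assumes k: "k \<ge> 2" and i: "i < k"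
  shows "fdeg k n i \<le> degree (snd (fwd_test k (fwd_point k) (n + k) i))"
  using i
proof (induction n arbitrary: i)
  case 0
  have "fwd_test k (fwd_point k) (Suc i + (k - 1 - i)) i = fwd_test k (fwd_point k) (Suc i) (i + (k - 1 - i))"
    using 0 by (intro fwd_test_shift) simp
  moreover have "Suc i + (k - 1 - i) = k" "i + (k - 1 - i) = k - 1" using 0 by auto
  ultimately show ?case using degree_fwd_test_newest[OF k, of i] by (simp del: fwin.simps)
next
  case (Suc n)
  show ?case
  proof (cases "Suc i < k")
    case True
    then show ?thesis using Suc.IH[OF True] by simp
  next
    case False
    have "(\<Sum>j<k. fdeg k n j) \<le> (\<Sum>j<k. degree (snd (fwd_test k (fwd_point k) (n + k) j)))"
      using Suc.IH by (intro sum_mono) auto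
    also note degree_fwd_denom
    finally show ?thesis using False fwd_test_point_Suc[of k "n + k" i] by simp
  qed
qed

text \<open>By coprimality \<open>P\<close> divides \<open>u\<close>, whose degree is too small for
  a nonzero multiple.\<close>

lemma coprime_no_small_relation:
  assumes c: "coprime P Q" and d: "D \<le> degree P" and P: "P \<noteq> 0"
  shows "no_small_relation D P Q"
  unfolding no_small_relation_def
proof (intro allI impI)
  fix u v assume uv: "small D u" "small D v" "u * Q = v * P"
  have "P dvd u * Q" unfolding uv(3) by simp
  then have dv: "P dvd u" using c by (simp add: coprime_dvd_mult_left_iff)
  have "u = 0"
  proof (rule ccontr)
    assume "u \<noteq> 0"
    then have "degree P \<le> degree u" using dv by (intro dvd_imp_degree_le)
    then have "coeff u (degree u) = 0" using uv(1) d by (auto simp: small_def)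
    then show False using \<open>u \<noteq> 0\<close> by simp
  qed
  then show "u = 0 \<and> v = 0" using uv(3) P by simp
qed

lemma fwd_point_no_small_relation:
  assumes k: "k \<ge> 2"
  shows "no_small_relation (fdeg k (Suc n) (k - 1)) (fst (fwd_test k (fwd_point k) (Suc (n + k)) (k - 1)))
    (snd (fwd_test k (fwd_point k) (Suc (n + k)) (k - 1)))"
proof (rule coprime_no_small_relation)
  let ?w = "fwd_test k (fwd_point k) (n + k)"
  have f: "fst (fwd_test k (fwd_point k) (Suc (n + k)) (k - 1)) = fwd_numer k ?w"
    using k by (simp add: fwd_test_point_Suc del: fwin.simps)
  show "coprime (fst (fwd_test k (fwd_point k) (Suc (n + k)) (k - 1))) (snd (fwd_test k (fwd_point k) (Suc (n + k)) (k - 1)))"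
    using fwd_test_point_coprime[of "k - 1" k "Suc (n + k)"] k by simp
  show "fst (fwd_test k (fwd_point k) (Suc (n + k)) (k - 1)) \<noteq> 0"
    unfolding f fwd_numer_def using fwd_test_point_coprime[of _ k "n + k"] by simp
  have "fdeg k (Suc n) (k - 1) = (\<Sum>j<k. fdeg k n j)" using k by simp
  also have "\<dots> \<le> (\<Sum>j<k. degree (snd (?w j)))"
    using degree_fwd_test_ge[OF k] by (intro sum_mono) auto
  finally show "fdeg k (Suc n) (k - 1) \<le> degree (fst (fwd_test k (fwd_point k) (Suc (n + k)) (k - 1)))"
    unfolding f degree_fwd_numer .
qed

lemma forward_dynamical_degree:
  assumes k: "k \<ge> 3" and D: "\<alpha> 0 * \<beta> 1 - \<alpha> 1 * \<beta> 0 \<noteq> 0"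
    and no: "\<And>n. no_small_relation (fdeg k (Suc n) (k - 1))
      (fst (fwd_test k (param_point k \<alpha> \<beta>) (Suc (n + k)) (k - 1)))
      (snd (fwd_test k (param_point k \<alpha> \<beta>) (Suc (n + k)) (k - 1)))"
  shows "has_dynamical_degree k (linfrac_map k \<alpha> \<beta>) (Delta_plus k)"
  unfolding has_dynamical_degree_def
\<comment> \<open>The lower bound for iterate \<open>n\<close> uses the degree term of index
  \<open>n - 1\<close>, which costs one factor \<open>Delta_plus k\<close> besides the
  \<open>k\<close> factors from \<open>fdeg_bounds\<close>. It is available from iterate
  \<open>k + 1\<close> on.\<close>
proof (rule root_tendsto_growth_rate[where c = "1 / Delta_plus k ^ (k + 1)" and C = "Delta_plus k ^ k" and N = "k + 1"])
  let ?l = "Delta_plus k" and ?d = "\<lambda>n. map_degree k (map_iterate (linfrac_map k \<alpha> \<beta>) n)"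
  have l: "?l \<ge> 1" "?l ^ k = (\<Sum>i<k. ?l ^ i)" using Delta_plus[OF k] by auto
  have k2: "k \<ge> 2" using k by simp
  have l0: "?l > 0" using l by linarith
  show "?l \<ge> 0" "?l ^ k > 0" "1 / ?l ^ (k + 1) > 0" using l0 by auto
  have b: "real (fdeg k n (k - 1)) \<le> ?l ^ (n + (k - 1))"
    "?l ^ (n + (k - 1)) \<le> ?l ^ k * real (fdeg k n (k - 1))" for n
    using fdeg_bounds[OF l, of "k - 1" n] k by auto
  show "real (?d n) \<le> ?l ^ k * ?l ^ n" for n
  proof -
    have "real (?d n) \<le> real (fdeg k (Suc n) (k - 1))"
      using map_degree_forward_le[of k \<alpha> \<beta> n, OF k2 D] by linarith
    also have "\<dots> \<le> ?l ^ (Suc n + (k - 1))" by (rule b)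
    also have "Suc n + (k - 1) = k + n" using k by simp
    finally show ?thesis by (simp add: power_add)
  qed
  show "1 / ?l ^ (k + 1) * ?l ^ n \<le> real (?d n)" if n: "n \<ge> k + 1" for n
  proof -
    obtain m where m: "n = Suc (m + k)" using n by (metis add.commute less_eqE add_Suc_right plus_1_eq_Suc)
    have "?l ^ n = ?l * ?l ^ (m + k)" by (simp add: m)
    also have "\<dots> \<le> ?l * (?l ^ k * real (fdeg k (Suc m) (k - 1)))"
      using b(2)[of "Suc m"] l0 k by (intro mult_left_mono) auto
    finally have "?l ^ n \<le> ?l ^ (k + 1) * real (fdeg k (Suc m) (k - 1))" by (simp add: mult.assoc)
    also have "\<dots> \<le> ?l ^ (k + 1) * real (?d n)"
      using map_degree_forward_ge[of k \<alpha> \<beta> _ n, OF k2 D] no[of m] l0 unfolding m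
      by (intro mult_left_mono) (auto simp del: fdeg.simps fwin.simps)
    finally show ?thesis using l0 by (simp add: field_simps)
  qed
qed

section \<open>The degrees of the backward iterates\<close>

text \<open>The backward recurrence
  \<open>z\<^sub>n = (A(z\<^sub>n\<^sub>-\<^sub>1, \<dots>) - z\<^sub>n\<^sub>-\<^sub>k B(z\<^sub>n\<^sub>-\<^sub>1, \<dots>)) / (\<beta>\<^sub>1 z\<^sub>n\<^sub>-\<^sub>k - \<alpha>\<^sub>1)\<close> has denominators that divide each other.
  A window lists the last \<open>k\<close> terms, newest first, as triples of a numerator, a denominator and
  the cofactor that completes the denominator to the newest one.\<close>

definition bcomb :: "nat \<Rightarrow> (nat \<Rightarrow> 'r::comm_ring_1) \<Rightarrow> (nat \<Rightarrow> 'r \<times> 'r \<times> 'r) \<Rightarrow> 'r" where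
  "bcomb k a w = a 0 * fst (snd (w 0)) + (\<Sum>j<k - 1. a (j + 2) * (fst (w j) * snd (snd (w j))))"

text \<open>Over the denominator of the oldest term z, this is the numerator of
  \<open>\<beta>\<^sub>1 z - \<alpha>\<^sub>1\<close>. That denominator cancels against the one in
  \<open>bnumer\<close>, so the newest denominator is multiplied by this factor alone; hence a
  degree recurrence with only two summands.\<close>

definition bscale :: "nat \<Rightarrow> (nat \<Rightarrow> 'r::comm_ring_1) \<Rightarrow> (nat \<Rightarrow> 'r) \<Rightarrow> (nat \<Rightarrow> 'r \<times> 'r \<times> 'r) \<Rightarrow> 'r" where
  "bscale k a b w = b 1 * fst (w (k - 1)) - a 1 * fst (snd (w (k - 1)))"

definition bnumer :: "nat \<Rightarrow> (nat \<Rightarrow> 'r::comm_ring_1) \<Rightarrow> (nat \<Rightarrow> 'r) \<Rightarrow> (nat \<Rightarrow> 'r \<times> 'r \<times> 'r) \<Rightarrow> 'r" where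
  "bnumer k a b w = bcomb k a w * fst (snd (w (k - 1))) - fst (w (k - 1)) * bcomb k b w"

primrec bwin :: "nat \<Rightarrow> (nat \<Rightarrow> 'r::comm_ring_1) \<Rightarrow> (nat \<Rightarrow> 'r) \<Rightarrow> (nat \<Rightarrow> 'r \<times> 'r \<times> 'r) \<Rightarrow> nat \<Rightarrow> nat \<Rightarrow> 'r \<times> 'r \<times> 'r" where
  "bwin k a b w 0 = w"
| "bwin k a b w (Suc n) = (\<lambda>i. case i of
      0 \<Rightarrow> (bnumer k a b (bwin k a b w n), fst (snd (bwin k a b w n 0)) * bscale k a b (bwin k a b w n), 1)
    | Suc j \<Rightarrow> (fst (bwin k a b w n j), fst (snd (bwin k a b w n j)),
        snd (snd (bwin k a b w n j)) * bscale k a b (bwin k a b w n)))"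

lemma bcomb_cong:
  assumes "\<And>j. j \<le> k \<Longrightarrow> a j = a' j"
  shows "bcomb k a w = bcomb k a' w"
proof -
  have "(\<Sum>j<k - 1. a (j + 2) * (fst (w j) * snd (snd (w j)))) = (\<Sum>j<k - 1. a' (j + 2) * (fst (w j) * snd (snd (w j))))"
    using assms by (intro sum.cong) auto
  then show ?thesis using assms[of 0] by (simp add: bcomb_def)
qed

lemma bwin_cong:
  assumes "k \<ge> 1" "\<And>j. j \<le> k \<Longrightarrow> a j = a' j" "\<And>j. j \<le> k \<Longrightarrow> b j = b' j"
  shows "bwin k a b w n = bwin k a' b' w n"
proof -
  have "bcomb k a w = bcomb k a' w" "bcomb k b w = bcomb k b' w" for w
    using assms by (blast intro: bcomb_cong)+
  then have "bnumer k a b w = bnumer k a' b' w" "bscale k a b w = bscale k a' b' w" for w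
    using assms by (simp_all add: bnumer_def bscale_def)
  then show ?thesis by (induction n) (simp_all cong: nat.case_cong)
qed

definition map_triple :: "('a \<Rightarrow> 'b) \<Rightarrow> 'a \<times> 'a \<times> 'a \<Rightarrow> 'b \<times> 'b \<times> 'b" where
  "map_triple h = map_prod h (map_prod h h)"

lemma map_triple_simps [simp]:
  "fst (map_triple h t) = h (fst t)" "fst (snd (map_triple h t)) = h (fst (snd t))"
  "snd (snd (map_triple h t)) = h (snd (snd t))" "map_triple h (x, y, z) = (h x, h y, h z)"
  by (simp_all add: map_triple_def)

lemma hom_bwin:
  assumes h: "is_ring_hom h"
  shows "map_triple h (bwin k a b w n i)
    = bwin k (\<lambda>j. h (a j)) (\<lambda>j. h (b j)) (\<lambda>i. map_triple h (w i)) n i"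
proof (induction n arbitrary: i)
  case (Suc n)
  have "bcomb k (\<lambda>j. h (a j)) (\<lambda>i. map_triple h (u i)) = h (bcomb k a u)" for a u
    by (simp add: bcomb_def is_ring_hom_simps[OF h])
  then have "bnumer k (\<lambda>j. h (a j)) (\<lambda>j. h (b j)) (\<lambda>i. map_triple h (u i)) = h (bnumer k a b u)"
    "bscale k (\<lambda>j. h (a j)) (\<lambda>j. h (b j)) (\<lambda>i. map_triple h (u i)) = h (bscale k a b u)" for u
    by (simp_all add: bnumer_def bscale_def is_ring_hom_simps[OF h])
  moreover have "bwin k (\<lambda>j. h (a j)) (\<lambda>j. h (b j)) (\<lambda>i. map_triple h (w i)) n
      = (\<lambda>i. map_triple h (bwin k a b w n i))"
    using Suc by (simp add: fun_eq_iff)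
  ultimately show ?case by (cases i) (simp_all add: is_ring_hom_simps[OF h])
qed simp

section \<open>The backward windows compute the iterates of the inverse\<close>

abbreviation bwd_window :: "nat \<Rightarrow> (nat \<Rightarrow> complex) \<Rightarrow> (nat \<Rightarrow> complex) \<Rightarrow> nat \<Rightarrow> nat \<Rightarrow> mpol \<times> mpol \<times> mpol" where
  "bwd_window k \<alpha> \<beta> \<equiv> bwin k (\<lambda>j. mconst (\<alpha> j)) (\<lambda>j. mconst (\<beta> j)) (\<lambda>i. (mvar (Suc i), mvar 0, 1))"

text \<open>Keeps the subtraction of natural numbers in the degrees of the cofactors exact.\<close>

lemma bdeg_le: "bdeg k n i \<le> bdeg k n 0"
proof (induction n arbitrary: i)
  case (Suc n)
  show ?case using Suc[of "i - 1"] by (cases i) auto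
qed simp

lemma bwd_window_properties:
  assumes k: "k \<ge> 1" and i: "i < k"
  shows "homogeneous (bdeg k n i) (fst (bwd_window k \<alpha> \<beta> n i)) \<and>
    homogeneous (bdeg k n i) (fst (snd (bwd_window k \<alpha> \<beta> n i))) \<and>
    homogeneous (bdeg k n 0 - bdeg k n i) (snd (snd (bwd_window k \<alpha> \<beta> n i))) \<and>
    mvars (fst (bwd_window k \<alpha> \<beta> n i)) \<subseteq> {..k} \<and> mvars (fst (snd (bwd_window k \<alpha> \<beta> n i))) \<subseteq> {..k} \<and>
    mvars (snd (snd (bwd_window k \<alpha> \<beta> n i))) \<subseteq> {..k} \<and>
    snd (snd (bwd_window k \<alpha> \<beta> n i)) * fst (snd (bwd_window k \<alpha> \<beta> n i)) = fst (snd (bwd_window k \<alpha> \<beta> n 0))"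
  using i
proof (induction n arbitrary: i)
  case 0
  then show ?case using homogeneous_mvar by simp
next
  case (Suc n)
  let ?W = "bwd_window k \<alpha> \<beta> n" and ?c = "\<lambda>\<gamma> j. mconst (\<gamma> j) :: mpol"
  let ?e = "bdeg k n"
  note IH = Suc.IH
  have k1: "k - 1 < k" "0 < k" using k by auto
  have comb: "homogeneous (?e 0) (bcomb k (?c \<gamma>) ?W)" "mvars (bcomb k (?c \<gamma>) ?W) \<subseteq> {..k}" for \<gamma>
  proof -
    have "homogeneous (?e 0) (fst (?W j) * snd (snd (?W j)))" if "j < k" for j
      using homogeneous_mult[of "?e j" "fst (?W j)" "?e 0 - ?e j"] IH[OF that] bdeg_le[of k n j] by simp
    then show "homogeneous (?e 0) (bcomb k (?c \<gamma>) ?W)"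
      unfolding bcomb_def using IH[OF k1(2)]
      by (intro homogeneous_add homogeneous_sum homogeneous_smult) auto
    show "mvars (bcomb k (?c \<gamma>) ?W) \<subseteq> {..k}"
      unfolding bcomb_def by (intro mvars_addI mvars_multI mvars_sumI) (use IH k1 in auto)
  qed
  have scale: "homogeneous (?e (k - 1)) (bscale k (?c \<alpha>) (?c \<beta>) ?W)" "mvars (bscale k (?c \<alpha>) (?c \<beta>) ?W) \<subseteq> {..k}"
    unfolding bscale_def using IH[OF k1(1)]
    by (simp_all add: homogeneous_diff homogeneous_smult mvars_diffI mvars_multI)
  have numer: "homogeneous (?e 0 + ?e (k - 1)) (bnumer k (?c \<alpha>) (?c \<beta>) ?W)" "mvars (bnumer k (?c \<alpha>) (?c \<beta>) ?W) \<subseteq> {..k}"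
  proof -
    have "homogeneous (?e 0 + ?e (k - 1)) (bcomb k (?c \<alpha>) ?W * fst (snd (?W (k - 1))))"
      using comb IH[OF k1(1)] by (intro homogeneous_mult) auto
    moreover have "homogeneous (?e 0 + ?e (k - 1)) (fst (?W (k - 1)) * bcomb k (?c \<beta>) ?W)"
      using homogeneous_mult[OF _ comb(1), of "?e (k - 1)" "fst (?W (k - 1))" \<beta>] IH[OF k1(1)] by (simp add: add.commute)
    ultimately show "homogeneous (?e 0 + ?e (k - 1)) (bnumer k (?c \<alpha>) (?c \<beta>) ?W)"
      unfolding bnumer_def by (rule homogeneous_diff)
    show "mvars (bnumer k (?c \<alpha>) (?c \<beta>) ?W) \<subseteq> {..k}"
      unfolding bnumer_def using comb(2) IH[OF k1(1)] by (simp add: mvars_diffI mvars_multI)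
  qed
  show ?case
  proof (cases i)
    case 0
    then show ?thesis using numer scale IH[OF k1(2)]
      by (simp add: homogeneous_mult mvars_multI)
  next
    case (Suc j)
    then have j: "j < k" using Suc.prems by simp
    have "homogeneous ((?e 0 - ?e j) + ?e (k - 1)) (snd (snd (?W j)) * bscale k (?c \<alpha>) (?c \<beta>) ?W)"
      using IH[OF j] scale by (intro homogeneous_mult) auto
    moreover have "(?e 0 - ?e j) + ?e (k - 1) = ?e 0 + ?e (k - 1) - ?e j" using bdeg_le[of k n j] by simp
    moreover have "(snd (snd (?W j)) * bscale k (?c \<alpha>) (?c \<beta>) ?W) * fst (snd (?W j))
        = (snd (snd (?W j)) * fst (snd (?W j))) * bscale k (?c \<alpha>) (?c \<beta>) ?W" by (simp only: ac_simps)
    ultimately show ?thesis using Suc IH[OF j] scale(2) by (simp add: mvars_multI)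
  qed
qed

text \<open>Since \<open>g\<close> may be any representative of the inverse, no formula for it is
  used, only that the map after \<open>g\<close> is the identity: the image of the new iterate
  \<open>X\<close> is the previous one \<open>Y\<close> up to a factor, and this is solved for
  \<open>X 1\<close>.\<close>

lemma bwd_window_iterate:
  assumes k: "k \<ge> 2" and D: "\<alpha> 0 * \<beta> 1 - \<alpha> 1 * \<beta> 0 \<noteq> 0"
    and g: "inverse_map k (linfrac_map k \<alpha> \<beta>) g"
    and i: "i < k"
  shows "fst (snd (bwd_window k \<alpha> \<beta> n i)) \<noteq> 0 \<and>
    map_iterate g n (Suc i) * fst (snd (bwd_window k \<alpha> \<beta> n i)) = map_iterate g n 0 * fst (bwd_window k \<alpha> \<beta> n i)"
  using i
proof (induction n arbitrary: i)
  case 0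
  then show ?case by (simp add: mult.commute)
next
  case (Suc n)
  let ?F = "linfrac_map k \<alpha> \<beta>" and ?W = "bwd_window k \<alpha> \<beta> n"
  define Y where "Y = map_iterate g n"
  define X where "X = map_iterate g (Suc n)"
  define a where "a = lform k (\<lambda>i. mconst (\<alpha> i)) X"
  define b where "b = lform k (\<lambda>i. mconst (\<beta> i)) X"
  define rest where "rest \<gamma> = mconst (\<gamma> 0) * X 0 + (\<Sum>j<k - 1. mconst (\<gamma> (j + 2)) * X (j + 2))" for \<gamma>
  have IH: "fst (snd (?W i)) \<noteq> 0" "Y (Suc i) * fst (snd (?W i)) = Y 0 * fst (?W i)" if "i < k" for i
    using Suc.IH[OF that] by (auto simp: Y_def)
  have k1: "k - 1 < k" "0 < k" "Suc (k - 1) = k" using k by auto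
  have domY: "dominant k Y" and domX: "dominant k X"
    unfolding X_def Y_def using map_iterate_dominant[OF inverse_map_sym[OF g]] by blast+
  have Y0: "Y 0 \<noteq> 0" and X0: "X 0 \<noteq> 0"
    using dominantD[OF domY homogeneous_mvar, of 0] dominantD[OF domX homogeneous_mvar, of 0] by simp_all
  have "\<beta> 0 \<noteq> 0 \<or> \<beta> 1 \<noteq> 0" using D by auto
  then have "linear_form k \<beta> \<noteq> 0"
    using k linear_form_nonzero[of 0 k \<beta>] linear_form_nonzero[of 1 k \<beta>] by auto
  then have b0: "b \<noteq> 0"
    using dominantD[OF domX homogeneous_linear_form mvars_linear_form] by (simp add: msubst_linear_form b_def)
  have cross: "msubst X (?F i) * Y j = msubst X (?F j) * Y i" if "i \<le> k" "j \<le> k" for i j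
  proof -
    have X: "X = map_comp g Y" by (simp add: X_def Y_def)
    have "map_comp ?F g i * mvar j = map_comp ?F g j * mvar i"
      using g that by (simp add: inverse_map_def same_rational_map_def)
    then have "msubst Y (map_comp ?F g i) * Y j = msubst Y (map_comp ?F g j) * Y i"
      by (metis msubst_simps(4) msubst_mvar)
    then show ?thesis by (simp add: X map_comp_def[of ?F g] msubst_msubst)
  qed
  have old: "X (Suc j) * Y 0 = X 0 * Y j" if j: "0 < j" "j < k" for j
  proof -
    have "b * (X (Suc j) * Y 0) = b * (X 0 * Y j)"
      using cross[of j 0] j by (simp add: msubst_linfrac_map b_def[symmetric] ac_simps)
    then show ?thesis using b0 by simp
  qed
  have new: "a * Y 0 = b * Y k"
  proof -
    have "X 0 * (a * Y 0) = X 0 * (b * Y k)"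
      using cross[of k 0] k by (simp add: msubst_linfrac_map a_def[symmetric] b_def[symmetric] ac_simps)
    then show ?thesis using X0 by simp
  qed
  have split: "a = mconst (\<alpha> 1) * X 1 + rest \<alpha>" "b = mconst (\<beta> 1) * X 1 + rest \<beta>"
    unfolding a_def b_def rest_def using k by (simp_all add: lform_split)
  have solve: "X 1 * (mconst (\<beta> 1) * Y k - mconst (\<alpha> 1) * Y 0) = rest \<alpha> * Y 0 - rest \<beta> * Y k"
    using new unfolding split by (simp add: algebra_simps)
  have win: "X (Suc (Suc j)) * fst (snd (?W j)) = X 0 * fst (?W j)" if j: "Suc j < k" for j
  proof -
    have jk: "j < k" using j by simp
    have "Y 0 * (X (Suc (Suc j)) * fst (snd (?W j))) = (X (Suc (Suc j)) * Y 0) * fst (snd (?W j))"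
      by (simp only: ac_simps)
    also have "\<dots> = X 0 * (Y (Suc j) * fst (snd (?W j)))" using old[of "Suc j"] j by (simp add: mult.assoc)
    also have "\<dots> = Y 0 * (X 0 * fst (?W j))" unfolding IH(2)[OF jk] by (simp only: ac_simps)
    finally show ?thesis using Y0 by simp
  qed
  let ?r0 = "fst (snd (?W 0))" and ?rk = "fst (snd (?W (k - 1)))" and ?pk = "fst (?W (k - 1))"
  let ?comb = "\<lambda>\<gamma>. bcomb k (\<lambda>j. mconst (\<gamma> j)) ?W" and ?s = "bscale k (\<lambda>j. mconst (\<alpha> j)) (\<lambda>j. mconst (\<beta> j)) ?W"
  have comb: "?r0 * rest \<gamma> = X 0 * ?comb \<gamma>" for \<gamma>
  proof -
    have "?r0 * X (j + 2) = X 0 * (fst (?W j) * snd (snd (?W j)))" if "j < k - 1" for j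
    proof -
      have j: "j < k" "Suc j < k" using that by auto
      have "?r0 * X (j + 2) = (snd (snd (?W j)) * fst (snd (?W j))) * X (j + 2)"
        using bwd_window_properties[of k j n \<alpha> \<beta>] k j by simp
      also have "\<dots> = snd (snd (?W j)) * (X (Suc (Suc j)) * fst (snd (?W j)))" by (simp add: ac_simps)
      also have "\<dots> = X 0 * (fst (?W j) * snd (snd (?W j)))" unfolding win[OF j(2)] by (simp only: ac_simps)
      finally show ?thesis .
    qed
    then have "(\<Sum>j<k - 1. mconst (\<gamma> (j + 2)) * (?r0 * X (j + 2)))
        = (\<Sum>j<k - 1. mconst (\<gamma> (j + 2)) * (X 0 * (fst (?W j) * snd (snd (?W j)))))"
      by (intro sum.cong) auto
    then show ?thesis
      unfolding rest_def bcomb_def distrib_left sum_distrib_left by (simp add: ac_simps)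
  qed
  have scale: "Y 0 * ?s = ?rk * (mconst (\<beta> 1) * Y k - mconst (\<alpha> 1) * Y 0)"
  proof -
    have "Y 0 * ?s = mconst (\<beta> 1) * (Y 0 * ?pk) - mconst (\<alpha> 1) * Y 0 * ?rk"
      by (simp add: bscale_def algebra_simps)
    also have "Y 0 * ?pk = Y k * ?rk" using IH(2)[OF k1(1)] k1 by simp
    finally show ?thesis by (simp add: algebra_simps)
  qed
  \<comment> \<open>Up to denominators the scale factor is a linear form in \<open>Y\<close> with
    coefficients \<beta> 1 and - \<alpha> 1, not both zero; dominance excludes that it
    vanishes.\<close>
  have s0: "?s \<noteq> 0"
  proof -
    define \<gamma> where "\<gamma> i = (if i = 0 then - \<alpha> 1 else if i = k then \<beta> 1 else 0)" for i
    have "\<alpha> 1 \<noteq> 0 \<or> \<beta> 1 \<noteq> 0" using D by auto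
    then have "linear_form k \<gamma> \<noteq> 0"
      using k linear_form_nonzero[of 0 k \<gamma>] linear_form_nonzero[of k k \<gamma>] by (auto simp: \<gamma>_def)
    then have "lform k (\<lambda>i. mconst (\<gamma> i)) Y \<noteq> 0"
      using dominantD[OF domY homogeneous_linear_form mvars_linear_form] by (simp add: msubst_linear_form)
    moreover have "lform k (\<lambda>i. mconst (\<gamma> i)) Y = mconst (\<beta> 1) * Y k - mconst (\<alpha> 1) * Y 0"
    proof -
      have "(\<Sum>i<k. mconst (\<gamma> (Suc i)) * Y (Suc i)) = (\<Sum>i<k. if i = k - 1 then mconst (\<beta> 1) * Y k else 0)"
        using k by (intro sum.cong) (auto simp: \<gamma>_def)
      then show ?thesis using k by (simp add: lform_def \<gamma>_def is_ring_hom_uminus[OF mconst_ring_hom])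
    qed
    ultimately have "Y 0 * ?s \<noteq> 0" unfolding scale using IH(1)[OF k1(1)] by simp
    then show ?thesis by auto
  qed
  show ?case
  proof (cases i)
    case (Suc j)
    then show ?thesis using Suc.prems win[of j] IH(1)[of j] by (simp del: map_iterate.simps add: X_def[symmetric])
  next
    case 0
    have "Y 0 * (X 1 * (?r0 * ?s)) = ?r0 * X 1 * (Y 0 * ?s)" by (simp only: ac_simps)
    also have "\<dots> = ?r0 * ?rk * (X 1 * (mconst (\<beta> 1) * Y k - mconst (\<alpha> 1) * Y 0))"
      unfolding scale by (simp only: ac_simps)
    also have "\<dots> = ?rk * ((?r0 * rest \<alpha>) * Y 0 - (?r0 * rest \<beta>) * Y k)"
      unfolding solve by (simp add: algebra_simps)
    also have "\<dots> = X 0 * (?comb \<alpha> * ?rk * Y 0 - (Y k * ?rk) * ?comb \<beta>)"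
      unfolding comb by (simp add: algebra_simps)
    also have "Y k * ?rk = Y 0 * ?pk" using IH(2)[OF k1(1)] k1 by simp
    also have "X 0 * (?comb \<alpha> * ?rk * Y 0 - (Y 0 * ?pk) * ?comb \<beta>)
        = Y 0 * (X 0 * bnumer k (\<lambda>j. mconst (\<alpha> j)) (\<lambda>j. mconst (\<beta> j)) ?W)"
      by (simp add: bnumer_def algebra_simps)
    finally have "X 1 * (?r0 * ?s) = X 0 * bnumer k (\<lambda>j. mconst (\<alpha> j)) (\<lambda>j. mconst (\<beta> j)) ?W" using Y0 by simp
    then show ?thesis using 0 s0 IH(1)[OF k1(2)] by (simp del: map_iterate.simps add: X_def[symmetric])
  qed
qed

lemma map_degree_backward_le:
  assumes k: "k \<ge> 2" and D: "\<alpha> 0 * \<beta> 1 - \<alpha> 1 * \<beta> 0 \<noteq> 0"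
    and g: "inverse_map k (linfrac_map k \<alpha> \<beta>) g"
  shows "map_degree k (map_iterate g n) \<le> bdeg k n 0"
proof -
  let ?Y = "map_iterate g n" and ?W = "bwd_window k \<alpha> \<beta> n"
  have Y: "rational_map k ?Y" "dominant k ?Y"
    using map_iterate_dominant[OF inverse_map_sym[OF g]] by blast+
  have Y0: "?Y 0 \<noteq> 0" using dominantD[OF Y(2) homogeneous_mvar, of 0] by simp
  note W = bwd_window_iterate[OF k D g, of _ n] and P = bwd_window_properties[of k _ n \<alpha> \<beta>]
  \<comment> \<open>The newest denominator is a common denominator, and the cofactors adapt the
    numerators to it.\<close>
  define H where "H i = (if i = 0 then fst (snd (?W 0)) else fst (?W (i - 1)) * snd (snd (?W (i - 1))))" for i
  have H: "homogeneous (bdeg k n 0) (H i) \<and> mvars (H i) \<subseteq> {..k} \<and> ?Y i * H 0 = ?Y 0 * H i" if i: "i \<le> k" for i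
  proof (cases i)
    case 0
    then show ?thesis using P[of 0] k by (simp add: H_def)
  next
    case (Suc m)
    then have m: "m < k" using i by simp
    have "homogeneous (bdeg k n m + (bdeg k n 0 - bdeg k n m)) (H i)"
      unfolding H_def using Suc P[OF _ m] k by (auto intro!: homogeneous_mult)
    then have "homogeneous (bdeg k n 0) (H i)" using bdeg_le[of k n m] by simp
    moreover have "mvars (H i) \<subseteq> {..k}" using Suc P[OF _ m] k by (simp add: H_def mvars_multI)
    moreover have "?Y i * H 0 = ?Y 0 * H i"
    proof -
      have "H 0 = snd (snd (?W m)) * fst (snd (?W m))" using P[OF _ m] k by (simp add: H_def)
      then have "?Y i * H 0 = (?Y (Suc m) * fst (snd (?W m))) * snd (snd (?W m))" by (simp add: Suc ac_simps)
      also have "\<dots> = ?Y 0 * H i" using W[OF m] by (simp add: H_def Suc mult.assoc)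
      finally show ?thesis .
    qed
    ultimately show ?thesis by blast
  qed
  have "H 0 \<noteq> 0" using W[of 0] k by (simp add: H_def)
  then have "same_rational_map k ?Y H"
    using Y(1) H Y0 by (intro same_rational_mapI[where d = "bdeg k n 0"]) auto
  then show ?thesis using H by (intro map_degree_le[OF Y(1)]) auto
qed

section \<open>The backward windows on the test line\<close>

abbreviation bwd_test :: "nat \<Rightarrow> (nat \<Rightarrow> complex) \<Rightarrow> nat \<Rightarrow> nat \<Rightarrow> complex poly \<times> complex poly \<times> complex poly" where
  "bwd_test k x \<equiv> bwin k (\<lambda>j. [:x j:]) (\<lambda>j. [:x (Suc (k + j)):]) (\<lambda>i. ([:0, 1:], 1, 1))"

lemma test_eval_bwd_window:
  assumes k: "k \<ge> 1"
  shows "map_triple test_eval (bwd_window k \<alpha> \<beta> n i) = bwd_test k (param_point k \<alpha> \<beta>) n i"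
proof -
  have "map_triple test_eval (bwd_window k \<alpha> \<beta> n i)
      = bwin k (\<lambda>j. [:\<alpha> j:]) (\<lambda>j. [:\<beta> j:]) (\<lambda>i. ([:0, 1:], 1, 1)) n i"
    by (subst hom_bwin) (simp_all add: test_eval_mvar is_ring_hom_1[OF test_eval_ring_hom])
  also have "\<dots> = bwd_test k (param_point k \<alpha> \<beta>) n i"
    by (rule fun_cong[OF bwin_cong]) (use k param_point_simps in simp_all)
  finally show ?thesis .
qed

text \<open>For the inverse the newest term sits in the first affine coordinate; for the forward map
  it sits in the last.\<close>

lemma map_degree_backward_ge:
  assumes k: "k \<ge> 2" and D: "\<alpha> 0 * \<beta> 1 - \<alpha> 1 * \<beta> 0 \<noteq> 0"
    and g: "inverse_map k (linfrac_map k \<alpha> \<beta>) g"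
    and no: "no_small_relation d (fst (bwd_test k (param_point k \<alpha> \<beta>) n 0))
      (fst (snd (bwd_test k (param_point k \<alpha> \<beta>) n 0)))"
  shows "d \<le> map_degree k (map_iterate g n)"
proof -
  let ?Y = "map_iterate g n" and ?W = "bwd_window k \<alpha> \<beta> n 0"
  have Y: "rational_map k ?Y" "dominant k ?Y"
    using map_iterate_dominant[OF inverse_map_sym[OF g]] by blast+
  have Y0: "?Y 0 \<noteq> 0" using dominantD[OF Y(2) homogeneous_mvar, of 0] by simp
  have "?Y (Suc 0) * fst (snd ?W) = ?Y 0 * fst ?W" using bwd_window_iterate[OF k D g, of 0 n] k by simp
  moreover have "no_small_relation d (test_eval (fst ?W)) (test_eval (fst (snd ?W)))"
    using no test_eval_bwd_window[of k \<alpha> \<beta> n 0, symmetric] k by simp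
  ultimately show ?thesis using map_degree_ge[OF Y(1) Y0, of "Suc 0"] k by auto
qed

lemma coeffs_polyfun_bwd_test:
  assumes k: "k \<ge> 1" and i: "i < k"
  shows "coeffs_polyfun (2 * k + 2) (\<lambda>x. fst (bwd_test k x n i)) \<and>
    coeffs_polyfun (2 * k + 2) (\<lambda>x. fst (snd (bwd_test k x n i))) \<and>
    coeffs_polyfun (2 * k + 2) (\<lambda>x. snd (snd (bwd_test k x n i)))"
  using i
proof (induction n arbitrary: i)
  case 0
  then show ?case by (simp add: coeffs_polyfun_const)
next
  case (Suc n)
  have comb: "coeffs_polyfun (2 * k + 2) (\<lambda>x. bcomb k (a x) (bwd_test k x n))"
    if "\<And>j. j \<le> k \<Longrightarrow> coeffs_polyfun (2 * k + 2) (\<lambda>x. a x j)" for a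
    unfolding bcomb_def
    by (intro coeffs_polyfun_add coeffs_polyfun_mult coeffs_polyfun_sum) (use that Suc.IH k in auto)
  have va: "coeffs_polyfun (2 * k + 2) (\<lambda>x. [:x j:])" "coeffs_polyfun (2 * k + 2) (\<lambda>x. [:x (Suc (k + j)):])"
    if "j \<le> k" for j
    using that by (auto intro!: coeffs_polyfun_var)
  have "coeffs_polyfun (2 * k + 2) (\<lambda>x. bscale k (\<lambda>j. [:x j:]) (\<lambda>j. [:x (Suc (k + j)):]) (bwd_test k x n))"
    unfolding bscale_def using Suc.IH[of "k - 1"] va[OF k]
    by (intro coeffs_polyfun_diff coeffs_polyfun_mult) (use k in auto)
  moreover have "coeffs_polyfun (2 * k + 2) (\<lambda>x. bnumer k (\<lambda>j. [:x j:]) (\<lambda>j. [:x (Suc (k + j)):]) (bwd_test k x n))"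
    unfolding bnumer_def using Suc.IH[of "k - 1"] k va
    by (intro coeffs_polyfun_diff coeffs_polyfun_mult comb) auto
  ultimately show ?case
    using Suc.IH[of "i - 1"] Suc.IH[of 0] Suc.prems
    by (cases i) (auto intro!: coeffs_polyfun_mult coeffs_polyfun_const)
qed

text \<open>A special parameter: \<open>a = x\<^sub>1\<close> and \<open>b = x\<^sub>1 + x\<^sub>2\<close>, so that
  \<open>z\<^sub>n = z\<^sub>n\<^sub>-\<^sub>1 z\<^sub>n\<^sub>-\<^sub>k / (1 - z\<^sub>n\<^sub>-\<^sub>k)\<close>. Along the test curve the numerator is a power of \<open>t\<close> up to sign,
  and the denominator does not vanish at \<open>t = 0\<close>.\<close>

definition bwd_point :: "nat \<Rightarrow> nat \<Rightarrow> complex" where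
  "bwd_point k j = (if j = 1 \<or> j = Suc (k + 1) \<or> j = Suc (k + 2) then 1 else 0)"

lemma bdeg_pos: "bdeg k n i > 0"
  by (induction n arbitrary: i) (auto split: nat.splits)

text \<open>Numerators multiply up to sign, so their exponents follow \<open>bdeg\<close>. All of
  them vanish at t = 0, where the scale factor is therefore minus an old denominator, and the new
  denominator stays nonzero. The cofactor 1 of the newest term makes the form b contribute exactly
  its numerator.\<close>

lemma bwd_test_point:
  assumes k: "k \<ge> 2" and i: "i < k"
  shows "(\<exists>c. c \<noteq> 0 \<and> fst (bwd_test k (bwd_point k) n i) = monom c (bdeg k n i)) \<and>
    coeff (fst (snd (bwd_test k (bwd_point k) n i))) 0 \<noteq> 0 \<and> snd (snd (bwd_test k (bwd_point k) n 0)) = 1"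
  using i
proof (induction n arbitrary: i)
  case 0
  have "[:0, 1:] = monom (1 :: complex) 1" by (simp add: monom_Suc monom_0)
  then show ?case by (intro conjI exI[of _ 1]) simp_all
next
  case (Suc n)
  let ?w = "bwd_test k (bwd_point k) n"
  have c1: "[:1:] = (1 :: complex poly)" by simp
  have k1: "k - 1 < k" "0 < k" using k by auto
  have A: "bcomb k (\<lambda>j. [:bwd_point k j:]) ?w = 0"
    unfolding bcomb_def using k by (auto simp: bwd_point_def intro!: sum.neutral)
  have B: "bcomb k (\<lambda>j. [:bwd_point k (Suc (k + j)):]) ?w = fst (?w 0)"
  proof -
    have "(\<Sum>j<k - 1. [:bwd_point k (Suc (k + (j + 2))):] * (fst (?w j) * snd (snd (?w j))))
        = (\<Sum>j<k - 1. if j = 0 then fst (?w 0) else 0)"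
      using Suc.IH[OF k1(2)] by (intro sum.cong) (auto simp: bwd_point_def c1)
    then show ?thesis using k by (simp add: bcomb_def bwd_point_def)
  qed
  have s: "bscale k (\<lambda>j. [:bwd_point k j:]) (\<lambda>j. [:bwd_point k (Suc (k + j)):]) ?w = fst (?w (k - 1)) - fst (snd (?w (k - 1)))"
    by (simp add: bscale_def bwd_point_def c1)
  have p: "bnumer k (\<lambda>j. [:bwd_point k j:]) (\<lambda>j. [:bwd_point k (Suc (k + j)):]) ?w = - (fst (?w (k - 1)) * fst (?w 0))"
    by (simp add: bnumer_def A B)
  show ?case
  proof (cases i)
    case (Suc j)
    then show ?thesis using Suc.IH[of j] Suc.prems by simp
  next
    case 0
    obtain c c' where c: "c \<noteq> 0" "fst (?w (k - 1)) = monom c (bdeg k n (k - 1))"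
      "c' \<noteq> 0" "fst (?w 0) = monom c' (bdeg k n 0)"
      using Suc.IH[OF k1(1)] Suc.IH[OF k1(2)] by blast
    have "- (fst (?w (k - 1)) * fst (?w 0)) = monom (- (c * c')) (bdeg k n 0 + bdeg k n (k - 1))"
      unfolding c(2,4) by (simp add: mult_monom minus_monom add.commute)
    moreover have "coeff (fst (snd (?w 0)) * (fst (?w (k - 1)) - fst (snd (?w (k - 1))))) 0 \<noteq> 0"
      using Suc.IH[OF k1(1)] Suc.IH[OF k1(2)] bdeg_pos[of k n "k - 1"]
      unfolding c(2) by (simp add: coeff_mult_0)
    ultimately show ?thesis using 0 c by (auto simp: s p)
  qed
qed

text \<open>As \<open>R\<close> does not vanish at t = 0, the lowest term of \<open>u * R\<close>
  has the order of \<open>u\<close>, below \<open>D\<close>, whereas the other side is divisible by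
  t^D.\<close>

lemma monom_no_small_relation:
  assumes c: "c \<noteq> 0" and R: "coeff R 0 \<noteq> 0"
  shows "no_small_relation D (monom c D) R"
  unfolding no_small_relation_def
proof (intro allI impI)
  fix u v assume uv: "small D u" "small D v" "u * R = v * monom c D"
  have "u = 0"
  proof (rule ccontr)
    assume u: "u \<noteq> 0"
    define m where "m = (LEAST m. coeff u m \<noteq> 0)"
    have "coeff u (degree u) \<noteq> 0" using u by simp
    then have m: "coeff u m \<noteq> 0" unfolding m_def by (rule LeastI)
    have low: "coeff u i = 0" if "i < m" for i using not_less_Least[OF that[unfolded m_def]] by simp
    have "m < D" using m uv(1) by (meson not_le small_def)
    then have "coeff (v * monom c D) m = 0" by (simp add: mult.commute[of v] coeff_monom_mult)
    moreover have "coeff (u * R) m = (\<Sum>i\<le>m. if i = m then coeff u m * coeff R 0 else 0)"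
      unfolding coeff_mult using low by (intro sum.cong) auto
    ultimately show False using uv(3) m R by simp
  qed
  then show "u = 0 \<and> v = 0" using uv(3) c by auto
qed

lemma bwd_point_no_small_relation:
  assumes k: "k \<ge> 2"
  shows "no_small_relation (bdeg k n 0) (fst (bwd_test k (bwd_point k) n 0)) (fst (snd (bwd_test k (bwd_point k) n 0)))"
  using bwd_test_point[OF k, of 0 n] k monom_no_small_relation by auto

lemma backward_dynamical_degree:
  assumes k: "k \<ge> 3" and D: "\<alpha> 0 * \<beta> 1 - \<alpha> 1 * \<beta> 0 \<noteq> 0"
    and g: "inverse_map k (linfrac_map k \<alpha> \<beta>) g"
    and no: "\<And>n. no_small_relation (bdeg k n 0) (fst (bwd_test k (param_point k \<alpha> \<beta>) n 0))
      (fst (snd (bwd_test k (param_point k \<alpha> \<beta>) n 0)))"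
  shows "has_dynamical_degree k g (Delta_minus k)"
  unfolding has_dynamical_degree_def
proof (rule root_tendsto_growth_rate[where c = "1 / Delta_minus k" and C = "Delta_minus k ^ (k - 1)" and N = 0])
  let ?l = "Delta_minus k" and ?d = "\<lambda>n. map_degree k (map_iterate g n)"
  have l: "?l \<ge> 1" "?l ^ k = ?l ^ (k - 1) + 1" using Delta_minus[OF k] by auto
  have k2: "k \<ge> 2" using k by simp
  have l0: "?l > 0" using l by linarith
  show "?l \<ge> 0" "?l ^ (k - 1) > 0" "1 / ?l > 0" using l0 by auto
  \<comment> \<open>Unlike in the forward case the two bounds coincide, so every degree is known
    exactly.\<close>
  have d: "?d n = bdeg k n 0" for n
    using map_degree_backward_le[OF k2 D g, of n] map_degree_backward_ge[OF k2 D g no[of n]] by simp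
  fix n
  have b: "real (bdeg k n 0) \<le> ?l ^ (n + (k - 1))" "?l ^ (n + (k - 1)) \<le> ?l ^ k * real (bdeg k n 0)"
    using bdeg_bounds[OF l, of 0 n] k by auto
  show "real (?d n) \<le> ?l ^ (k - 1) * ?l ^ n" using b(1) by (simp add: d power_add mult.commute)
  have "?l ^ (k - 1) * ?l ^ n \<le> ?l ^ (k - 1) * (?l * real (bdeg k n 0))"
  proof -
    have "?l ^ k = ?l * ?l ^ (k - 1)" using k by (cases k) auto
    then show ?thesis using b(2) by (simp add: power_add ac_simps)
  qed
  then have "?l ^ n \<le> ?l * real (bdeg k n 0)" using l0 by simp
  then show "1 / ?l * ?l ^ n \<le> real (?d n)" using l0 by (simp add: d field_simps)
qed

section \<open>Combining the generic conditions\<close>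

lemma generic_dynamical_degrees:
  assumes k: "k \<ge> 3"
  shows "for_generic_params k (\<lambda>\<alpha> \<beta>.
    birational_map k (linfrac_map k \<alpha> \<beta>) \<and>
    has_dynamical_degree k (linfrac_map k \<alpha> \<beta>) (Delta_plus k) \<and>
    (\<forall>g. inverse_map k (linfrac_map k \<alpha> \<beta>) g \<longrightarrow> has_dynamical_degree k g (Delta_minus k)))"
proof -
  let ?N = "2 * k + 2"
  have k2: "k \<ge> 2" and k1: "k \<ge> 1" "k - 1 < k" "0 < k" using k by auto
  let ?R = "\<lambda>n x. no_small_relation (fdeg k (Suc n) (k - 1)) (fst (fwd_test k x (Suc (n + k)) (k - 1)))
    (snd (fwd_test k x (Suc (n + k)) (k - 1)))"
  let ?S = "\<lambda>n x. no_small_relation (bdeg k n 0) (fst (bwd_test k x n 0)) (fst (snd (bwd_test k x n 0)))"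
  have "\<exists>\<phi>. polyfun ?N \<phi> \<and> \<phi> (fwd_point k) \<noteq> 0 \<and> (\<forall>x. \<phi> x \<noteq> 0 \<longrightarrow> ?R n x)" for n
    using coeffs_polyfun_fwd_test[OF k1(2), of "Suc (n + k)"] fwd_point_no_small_relation[OF k2, of n]
    unfolding coeffs_polyfun_def by (intro generic_no_small_relation) blast+
  then obtain \<phi> where \<phi>: "\<And>n. polyfun ?N (\<phi> n)" "\<And>n. \<phi> n (fwd_point k) \<noteq> 0" "\<And>n x. \<phi> n x \<noteq> 0 \<Longrightarrow> ?R n x"
    by metis
  have "\<exists>\<psi>. polyfun ?N \<psi> \<and> \<psi> (bwd_point k) \<noteq> 0 \<and> (\<forall>x. \<psi> x \<noteq> 0 \<longrightarrow> ?S n x)" for n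
    using coeffs_polyfun_bwd_test[OF k1(1,3), of n] bwd_point_no_small_relation[OF k2, of n]
    unfolding coeffs_polyfun_def by (intro generic_no_small_relation) blast+
  then obtain \<psi> where \<psi>: "\<And>n. polyfun ?N (\<psi> n)" "\<And>n. \<psi> n (bwd_point k) \<noteq> 0" "\<And>n x. \<psi> n x \<noteq> 0 \<Longrightarrow> ?S n x"
    by metis
  \<comment> \<open>The determinant that yields the explicit inverse. It vanishes at
    \<open>bwd_point k\<close>, so it forms a condition of its own with a separate witness.\<close>
  define D where "D x = x 0 * x (Suc (k + 1)) - x 1 * x (Suc (k + 0))" for x :: "nat \<Rightarrow> complex"
  have D: "polyfun ?N D" "D (\<lambda>j. if j = 0 \<or> j = Suc (k + 1) then 1 else 0) \<noteq> 0"
    unfolding D_def using k by (auto intro!: polyfun_diff polyfun_mult polyfun_var)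
  let ?f = "\<lambda>i :: nat + nat + unit. case i of Inl n \<Rightarrow> \<phi> n | Inr (Inl n) \<Rightarrow> \<psi> n | Inr (Inr _) \<Rightarrow> D"
  show ?thesis
  proof (rule for_generic_params_polyfun[where f = ?f])
    show "polyfun ?N (?f i)" for i using \<phi>(1) \<psi>(1) D(1) by (auto split: sum.splits)
    show "\<exists>x. ?f i x \<noteq> 0" for i using \<phi>(2) \<psi>(2) D(2) by (auto split: sum.splits)
    fix \<alpha> \<beta> assume f: "\<And>i. ?f i (param_point k \<alpha> \<beta>) \<noteq> 0"
    have R: "?R n (param_point k \<alpha> \<beta>)" for n using f[of "Inl n"] by (intro \<phi>(3)) simp
    have S: "?S n (param_point k \<alpha> \<beta>)" for n using f[of "Inr (Inl n)"] by (intro \<psi>(3)) simp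
    have "D (param_point k \<alpha> \<beta>) \<noteq> 0" using f[of "Inr (Inr ())"] by simp
    then have det: "\<alpha> 0 * \<beta> 1 - \<alpha> 1 * \<beta> 0 \<noteq> 0"
      unfolding D_def using k1(1) param_point_simps[of 0 k \<alpha> \<beta>] param_point_simps[of 1 k \<alpha> \<beta>] by simp
    show "birational_map k (linfrac_map k \<alpha> \<beta>) \<and>
        has_dynamical_degree k (linfrac_map k \<alpha> \<beta>) (Delta_plus k) \<and>
        (\<forall>g. inverse_map k (linfrac_map k \<alpha> \<beta>) g \<longrightarrow> has_dynamical_degree k g (Delta_minus k))"
      using inverse_map_linfrac[OF k2 det] forward_dynamical_degree[OF k det R] backward_dynamical_degree[OF k det _ S]
      unfolding birational_map_def by blast
  qed
qed

theorem theorem2p3: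
  shows "(\<forall>k\<ge>3. for_generic_params k (\<lambda>\<alpha> \<beta>.
            birational_map k (linfrac_map k \<alpha> \<beta>) \<and>
            has_dynamical_degree k (linfrac_map k \<alpha> \<beta>) (Delta_plus k) \<and>
            (\<forall>g. inverse_map k (linfrac_map k \<alpha> \<beta>) g \<longrightarrow>
                 has_dynamical_degree k g (Delta_minus k)))) \<and>
         Delta_plus \<longlonglongrightarrow> 2 \<and> Delta_minus \<longlonglongrightarrow> 1"
  using generic_dynamical_degrees Delta_plus_tendsto Delta_minus_tendsto by blast

end
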